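(* Let $H,K$ be complex Hilbert spaces, $(\Sigma,\mathcal H,\rho)$ a measure space, $V\subseteq B(H;K)$ a linear subspace, $F:\Sigma\to V$ a map, and $\mathcal T\in\{\mathrm{WOT},\mathrm{SOT},\mathrm{S^*OT}\}$ (regarded as a topology on $V$; $\sigma$-$\mathcal T$ denotes the corresponding topology among $\sigma$-WOT, $\sigma$-SOT, $\sigma$-S$^*$OT on $V$). (i) If $\mathscr F:=\sigma(\{V\ni A\mapsto\operatorname{Tr}(AB)\in\mathbb C: B\in\mathcal S_1(K;H)\})\subseteq2^V$ and $\mathscr G:=\sigma(\{V\ni A\mapsto\langle Ah,k\rangle_K\in\mathbb C: h\in H,k\in K\})\subseteq2^V$, then $\mathscr F=\mathscr G=\sigma\big((V,\sigma\text{-}\mathcal T)^*\big)=\sigma\big((V,\mathcal T)^*\big)$. In particular, $F:\Sigma\to V$ is pointwise weakly measurable if and only if it is weakly measurable in $\mathcal T$, if and only if it is weakly measurable in $\sigma$-$\mathcal T$. (ii) $F:\Sigma\to V$ is pointwise Pettis integrable in $V$ if and only if it is Gel'fand--Pettis integrable in $\mathcal T$, and in this case the pointwise Pettis and Gel'fand--Pettis integrals of $F$ agree (so one may write $\rho_S(F)=\int_SF\,d\rho$ for $S\in\mathcal H$). Also, in this case, $$\Big\|\int_\Sigma F\,d\rho\Big\|\le\underline{\int_\Sigma}\|F\|\,d\rho.$$ (iii) Suppose $V\subseteq B(H;K)$ is $\sigma$-weakly closed. Then $F:\Sigma\to V$ is Gel'fand--Pettis integrable in $\sigma$-$\mathcal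 T$ if and only if it is weak$^*$ integrable under the usual identification $V\cong V_*^{\,*}$, if and only if $F$ is pointwise weakly measurable and $$\int_\Sigma\big|\langle(F(\sigma)h_n)_{n\in\mathbb N},(k_n)_{n\in\mathbb N}\rangle_{\ell^2(\mathbb N;K)}\big|\,\rho(d\sigma)<\infty$$ whenever $(h_n)_{n\in\mathbb N}\in\ell^2(\mathbb N;H)$ and $(k_n)_{n\in\mathbb N}\in\ell^2(\mathbb N;K)$. In this case, the Gel'fand--Pettis, weak$^*$, and pointwise Pettis integrals of $F$ all agree. (iv) If $H=K$ and $V=\mathcal M\subseteq B(H)$ is a von Neumann algebra, then the notions of pointwise weak measurability and Gel'fand--Pettis integrability in $\sigma$-$\mathcal T$ are independent of the representation of $\mathcal M$. More precisely, if $\mathcal N$ is another von Neumann algebra and $\pi:\mathcal M\to\mathcal N$ is an algebraic $\ast$-isomorphism, then $F$ is pointwise weakly measurable (respectively, Gel'fand--Pettis integrable in $\sigma$-$\mathcal T$) if and only if $\pi\circ F$ is pointwise weakly measurable (respectively, Gel'fand--Pettis integrable in $\sigma$-$\mathcal T$ with $\int_S(\pi\circ F)\,d\rho=\pi\big(\int_SF\,d\rho\big)$ whenever $S\in\mathcal H$).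
   Context: Hilbert spaces are not assumed separable; inner products are linear in the first argument; $\|\cdot\|$ is the operator norm. Topologies on $B(H;K)$ (and, as subspace topologies, on $V$), each generated by the listed seminorms: WOT: $A\mapsto|\langle Ah,k\rangle_K|$; SOT: $A\mapsto\|Ah\|_K$; S$^*$OT: $A\mapsto\|Ah\|_K+\|A^*k\|_H$ ($h\in H,k\in K$). $\sigma$-WOT ("$\sigma$-weak"): $A\mapsto|\langle(Ah_n),(k_n)\rangle_{\ell^2(\mathbb N;K)}|$; $\sigma$-SOT: $A\mapsto\|(Ah_n)\|_{\ell^2(\mathbb N;K)}$; $\sigma$-S$^*$OT: $A\mapsto\|(Ah_n)\|_{\ell^2(\mathbb N;K)}+\|(A^*k_n)\|_{\ell^2(\mathbb N;H)}$, for $(h_n)\in\ell^2(\mathbb N;H)$, $(k_n)\in\ell^2(\mathbb N;K)$, where $\ell^2(\mathbb N;H)$ is the Hilbert space of square-summable $H$-valued sequences. For a set $\mathscr S$ of functions $V\to\mathbb C$, $\sigma(\mathscr S)$ is the smallest $\sigma$-algebra on $V$ making all of them Borel measurable. $(V,\mathcal T)^*$ is the topological dual. $\mathcal S_1(K;H)$ is the space of trace class operators $K\to H$, i.e. $B\in B(K;H)$ with $\operatorname{Tr}((B^*B)^{1/2})<\infty$. Lower integral of arbitrary $h:\Sigma\to[0,\infty]$: $\underline{\int_\Sigma}h\,d\rho=\sup\{\int\tilde h\,d\rho:\tilde h\le h\ \rho\text{-a.e.},\ \tilde h:\Sigma\to[0,\infty]\text{ measurable}\}$. For a Hausdorff locally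 convex space $W$, $f:\Sigma\to W$ is weakly measurable if $\ell\circ f$ is measurable for all $\ell\in W^*$; it is Gel'fand--Pettis (weakly) integrable if also $\int_\Sigma|\ell\circ f|\,d\rho<\infty$ for all $\ell\in W^*$ and for every $S\in\mathcal H$ there is a (necessarily unique) $\int_Sf\,d\rho\in W$ with $\ell(\int_Sf\,d\rho)=\int_S\ell\circ f\,d\rho$ for all $\ell\in W^*$. "In $\mathcal T$" means $W=(V,\mathcal T)$. $F:\Sigma\to B(H;K)$ is pointwise weakly measurable if $\langle F(\cdot)h,k\rangle_K$ is measurable for all $h,k$; pointwise Pettis integrable if also $\int_\Sigma|\langle F(\sigma)h,k\rangle_K|\,\rho(d\sigma)<\infty$ for all $h,k$. Then for $S\in\mathcal H$ the pointwise Pettis integral $\rho_S(F)\in B(H;K)$ is the (existing, unique) bounded operator with $\langle\rho_S(F)h,k\rangle=\int_S\langle F(\sigma)h,k\rangle\,\rho(d\sigma)$. It is pointwise Pettis integrable in $V$ if moreover $F(\Sigma)\subseteq V$ and $\rho_S(F)\in V$ for all $S\in\mathcal H$. If $V$ is $\sigma$-weakly closed, $V_*:=(V,\sigma\text{-WOT})^*$ (a Banach space with the operator norm) is its predual and $V\to V_*^{\,*}$, $A\mapsto(\ell\mapsto\ell(A))$, is an isometric isomorphism and a homeomorphism from the $\sigma$-WOT to the weak$^*$ topology (the usual identification). For a Banach space $W$, $g:\Sigma\to W^*$ is weak$^*$ integrable if $g(\cdot)(w)$ is measurable and $\int_\Sigma|g(\sigma)(w)|\,\rho(d\sigma)<\infty$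 for all $w\in W$; then $g$ is Gel'fand--Pettis integrable in the weak$^*$ topology, and its weak$^*$ integral $\int_Sg\,d\rho\in W^*$ is given by $w\mapsto\int_Sg(\sigma)(w)\,\rho(d\sigma)$. *)

theory Defs
  imports "HOL-Analysis.Analysis" "HOL-Library.Function_Algebras"
begin

section \<open>Complex vector spaces and complex Hilbert spaces\<close>

class complex_vector = ab_group_add +
  fixes scaleC :: "complex \<Rightarrow> 'a \<Rightarrow> 'a"  (infixr \<open>*\<^sub>C\<close> 75)
  assumes scaleC_add_right: "c *\<^sub>C (x + y) = c *\<^sub>C x + c *\<^sub>C y"
    and scaleC_add_left: "(c + d) *\<^sub>C x = c *\<^sub>C x + d *\<^sub>C x"
    and scaleC_scaleC: "c *\<^sub>C d *\<^sub>C x = (c * d) *\<^sub>C x"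
    and scaleC_one: "1 *\<^sub>C x = x"

text \<open>The inner product is linear in the first argument. No separability is assumed.\<close>

class complex_hilbert = complex_vector + banach +
  fixes cinner :: "'a \<Rightarrow> 'a \<Rightarrow> complex"
  assumes scaleR_scaleC: "r *\<^sub>R x = complex_of_real r *\<^sub>C x"
    and cinner_commute: "cinner x y = cnj (cinner y x)"
    and cinner_add_left: "cinner (x + y) z = cinner x z + cinner y z"
    and cinner_scaleC_left: "cinner (c *\<^sub>C x) y = c * cinner x y"
    and cinner_ge_zero: "0 \<le> Re (cinner x x)"
    and cinner_eq_zero_iff: "cinner x x = 0 \<longleftrightarrow> x = 0"
    and norm_eq_sqrt_cinner: "norm x = sqrt (Re (cinner x x))"

instantiation complex :: complex_hilbert
begin

definition scaleC_complex :: "complex \<Rightarrow> complex \<Rightarrow> complex"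
  where "scaleC_complex c x = c * x"

definition cinner_complex :: "complex \<Rightarrow> complex \<Rightarrow> complex"
  where "cinner_complex x y = x * cnj y"

instance
proof
  fix x y z c d :: complex and r :: real
  show "c *\<^sub>C (x + y) = c *\<^sub>C x + c *\<^sub>C y" "(c + d) *\<^sub>C x = c *\<^sub>C x + d *\<^sub>C x"
    "c *\<^sub>C d *\<^sub>C x = (c * d) *\<^sub>C x" "1 *\<^sub>C x = x" "r *\<^sub>R x = complex_of_real r *\<^sub>C x"
    by (simp_all add: scaleC_complex_def algebra_simps scaleR_conv_of_real)
  show "cinner x y = cnj (cinner y x)" "cinner (x + y) z = cinner x z + cinner y z"
    "cinner (c *\<^sub>C x) y = c * cinner x y" "0 \<le> Re (cinner x x)" "cinner x x = 0 \<longleftrightarrow> x = 0"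
    by (simp_all add: cinner_complex_def scaleC_complex_def algebra_simps)
  show "norm x = sqrt (Re (cinner x x))"
    by (simp add: cinner_complex_def cmod_def power2_eq_square)
qed

end

instantiation "fun" :: (type, complex_vector) complex_vector
begin

definition scaleC_fun :: "complex \<Rightarrow> ('a \<Rightarrow> 'b) \<Rightarrow> 'a \<Rightarrow> 'b"
  where "scaleC_fun c f = (\<lambda>x. c *\<^sub>C f x)"

instance
  by standard
    (auto simp: scaleC_fun_def fun_eq_iff scaleC_add_right scaleC_add_left scaleC_scaleC scaleC_one)

end

lemma norm_scaleC: "norm (c *\<^sub>C x) = cmod c * norm (x :: 'a :: complex_hilbert)"
proof -
  have "cinner (c *\<^sub>C x) (c *\<^sub>C x) = c * cnj (c * cinner x x)"
    by (metis cinner_commute cinner_scaleC_left)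
  also have "\<dots> = complex_of_real ((cmod c)\<^sup>2) * cinner x x"
    by (metis cinner_commute complex_cnj_mult complex_norm_square mult.assoc)
  finally have "Re (cinner (c *\<^sub>C x) (c *\<^sub>C x)) = (cmod c)\<^sup>2 * Re (cinner x x)"
    by simp
  then show ?thesis
    by (simp add: norm_eq_sqrt_cinner [where 'a = 'a] real_sqrt_mult)
qed

lemma bounded_linear_scaleC: "bounded_linear (\<lambda>x :: 'a :: complex_hilbert. c *\<^sub>C x)"
  by (rule bounded_linear_intro [where K = "cmod c"])
    (simp_all add: scaleC_add_right scaleR_scaleC scaleC_scaleC norm_scaleC mult.commute)

instantiation blinfun :: (real_normed_vector, complex_hilbert) complex_vector
begin

lift_definition scaleC_blinfun :: "complex \<Rightarrow> ('a \<Rightarrow>\<^sub>L 'b) \<Rightarrow> 'a \<Rightarrow>\<^sub>L 'b"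
  is "\<lambda>c A x. c *\<^sub>C A x"
  by (rule bounded_linear_compose [OF bounded_linear_scaleC])

instance
  by standard (transfer; simp add: scaleC_add_right scaleC_add_left scaleC_scaleC scaleC_one)+

end

definition csubspace :: "'a::complex_vector set \<Rightarrow> bool" where
  "csubspace V \<longleftrightarrow> 0 \<in> V \<and> (\<forall>x\<in>V. \<forall>y\<in>V. x + y \<in> V) \<and> (\<forall>c. \<forall>x\<in>V. c *\<^sub>C x \<in> V)"

definition clinear_on :: "'a::complex_vector set \<Rightarrow> ('a \<Rightarrow> complex) \<Rightarrow> bool" where
  "clinear_on V l \<longleftrightarrow>
    (\<forall>x\<in>V. \<forall>y\<in>V. l (x + y) = l x + l y) \<and> (\<forall>c. \<forall>x\<in>V. l (c *\<^sub>C x) = c * l x)"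

text \<open>
  A functional on a subset \<open>V\<close> of a type is represented by the total function that is
  \<open>0\<close> off \<open>V\<close>; this makes the representation unique and compatible with the
  pointwise vector operations on functions.
\<close>

definition top_dual :: "'a::complex_vector topology \<Rightarrow> ('a \<Rightarrow> complex) set" where
  "top_dual W = {l. clinear_on (topspace W) l \<and> continuous_map W euclidean l \<and>
                    (\<forall>x. x \<notin> topspace W \<longrightarrow> l x = 0)}"


section \<open>Bounded operators, adjoint, trace\<close>

text \<open>
  The library type \<^typ>\<open>'a \<Rightarrow>\<^sub>L 'b\<close> consists of the bounded \<^emph>\<open>real\<close>-linear maps. The space
  \<open>B(H;K)\<close> is the set of complex-linear ones; the library norm is the operator norm.
\<close>

definition bops :: "('a::complex_hilbert \<Rightarrow>\<^sub>L 'b::complex_hilbert) set" where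
  "bops = {A. \<forall>c x. blinfun_apply A (c *\<^sub>C x) = c *\<^sub>C blinfun_apply A x}"

definition adj :: "('a::complex_hilbert \<Rightarrow>\<^sub>L 'b::complex_hilbert) \<Rightarrow> 'b \<Rightarrow>\<^sub>L 'a" where
  "adj A = (THE B. B \<in> bops \<and>
              (\<forall>h k. cinner (blinfun_apply A h) k = cinner h (blinfun_apply B k)))"

definition positive_op :: "('a::complex_hilbert \<Rightarrow>\<^sub>L 'a) \<Rightarrow> bool" where
  "positive_op A \<longleftrightarrow> A \<in> bops \<and> (\<forall>h. cinner (blinfun_apply A h) h \<in> \<real>\<^sub>\<ge>\<^sub>0)"

definition sqrt_op :: "('a::complex_hilbert \<Rightarrow>\<^sub>L 'a) \<Rightarrow> 'a \<Rightarrow>\<^sub>L 'a" where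
  "sqrt_op A = (THE R. positive_op R \<and> R o\<^sub>L R = A)"

definition is_onb :: "'a::complex_hilbert set \<Rightarrow> bool" where
  "is_onb E \<longleftrightarrow> (\<forall>e\<in>E. norm e = 1) \<and> (\<forall>e\<in>E. \<forall>f\<in>E. e \<noteq> f \<longrightarrow> cinner e f = 0) \<and>
     (\<forall>x. (\<forall>e\<in>E. cinner x e = 0) \<longrightarrow> x = 0)"

text \<open>The traces below do not depend on the choice of the orthonormal basis.\<close>

definition some_onb :: "'a::complex_hilbert set" where
  "some_onb = (SOME E. is_onb E)"

definition trace_pos :: "('a::complex_hilbert \<Rightarrow>\<^sub>L 'a) \<Rightarrow> ennreal" where
  "trace_pos A = (\<Sum>\<^sub>\<infinity>e\<in>some_onb. ennreal (Re (cinner (blinfun_apply A e) e)))"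

definition trace_op :: "('a::complex_hilbert \<Rightarrow>\<^sub>L 'a) \<Rightarrow> complex" where
  "trace_op A = (\<Sum>\<^sub>\<infinity>e\<in>some_onb. cinner (blinfun_apply A e) e)"

definition trace_class :: "('a::complex_hilbert \<Rightarrow>\<^sub>L 'b::complex_hilbert) set" where
  "trace_class = {B \<in> bops. trace_pos (sqrt_op (adj B o\<^sub>L B)) < \<infinity>}"


section \<open>Operator topologies\<close>

definition ell2 :: "(nat \<Rightarrow> 'a::complex_hilbert) set" where
  "ell2 = {h. summable (\<lambda>n. (norm (h n))\<^sup>2)}"

definition ell2_inner :: "(nat \<Rightarrow> 'a::complex_hilbert) \<Rightarrow> (nat \<Rightarrow> 'a) \<Rightarrow> complex" where
  "ell2_inner h k = (\<Sum>n. cinner (h n) (k n))"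

definition ell2_norm :: "(nat \<Rightarrow> 'a::complex_hilbert) \<Rightarrow> real" where
  "ell2_norm h = sqrt (\<Sum>n. (norm (h n))\<^sup>2)"

datatype optop = WOT | SOT | SstarOT

fun op_seminorms :: "optop \<Rightarrow> (('a::complex_hilbert \<Rightarrow>\<^sub>L 'b::complex_hilbert) \<Rightarrow> real) set" where
  "op_seminorms WOT = {\<lambda>A. cmod (cinner (blinfun_apply A h) k) |h k. True}"
| "op_seminorms SOT = {\<lambda>A. norm (blinfun_apply A h) |h. True}"
| "op_seminorms SstarOT =
     {\<lambda>A. norm (blinfun_apply A h) + norm (blinfun_apply (adj A) k) |h k. True}"

fun sigma_op_seminorms ::
  "optop \<Rightarrow> (('a::complex_hilbert \<Rightarrow>\<^sub>L 'b::complex_hilbert) \<Rightarrow> real) set" where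
  "sigma_op_seminorms WOT =
     {\<lambda>A. cmod (ell2_inner (\<lambda>n. blinfun_apply A (h n)) k) |h k. h \<in> ell2 \<and> k \<in> ell2}"
| "sigma_op_seminorms SOT =
     {\<lambda>A. ell2_norm (\<lambda>n. blinfun_apply A (h n)) |h. h \<in> ell2}"
| "sigma_op_seminorms SstarOT =
     {\<lambda>A. ell2_norm (\<lambda>n. blinfun_apply A (h n)) + ell2_norm (\<lambda>n. blinfun_apply (adj A) (k n))
        |h k. h \<in> ell2 \<and> k \<in> ell2}"

definition seminorm_topology ::
  "(('a::complex_hilbert \<Rightarrow>\<^sub>L 'b::complex_hilbert) \<Rightarrow> real) set \<Rightarrow> ('a \<Rightarrow>\<^sub>L 'b) topology" where
  "seminorm_topology P =
     topology_generated_by {{B \<in> bops. p (B - A) < e} |p A e. p \<in> P \<and> A \<in> bops \<and> 0 < e}"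

definition op_topology ::
  "optop \<Rightarrow> ('a::complex_hilbert \<Rightarrow>\<^sub>L 'b::complex_hilbert) set \<Rightarrow> ('a \<Rightarrow>\<^sub>L 'b) topology" where
  "op_topology \<T> V = subtopology (seminorm_topology (op_seminorms \<T>)) V"

definition sigma_op_topology ::
  "optop \<Rightarrow> ('a::complex_hilbert \<Rightarrow>\<^sub>L 'b::complex_hilbert) set \<Rightarrow> ('a \<Rightarrow>\<^sub>L 'b) topology" where
  "sigma_op_topology \<T> V = subtopology (seminorm_topology (sigma_op_seminorms \<T>)) V"


section \<open>Measurability and integrals\<close>

definition sigma_alg :: "'a set \<Rightarrow> ('a \<Rightarrow> complex) set \<Rightarrow> 'a set set" where
  "sigma_alg V \<S> = sigma_sets V {f -` X \<inter> V |f X. f \<in> \<S> \<and> X \<in> sets borel}"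

definition lower_integral :: "'s measure \<Rightarrow> ('s \<Rightarrow> ennreal) \<Rightarrow> ennreal" where
  "lower_integral M h =
     Sup {\<integral>\<^sup>+\<sigma>. g \<sigma> \<partial>M |g. g \<in> borel_measurable M \<and> (AE \<sigma> in M. g \<sigma> \<le> h \<sigma>)}"

subsection \<open>Gelfand-Pettis integral in a locally convex space\<close>

definition weakly_measurable ::
  "'s measure \<Rightarrow> 'a::complex_vector topology \<Rightarrow> ('s \<Rightarrow> 'a) \<Rightarrow> bool" where
  "weakly_measurable M W f \<longleftrightarrow>
     f \<in> space M \<rightarrow> topspace W \<and> (\<forall>l\<in>top_dual W. (\<lambda>\<sigma>. l (f \<sigma>)) \<in> borel_measurable M)"

definition is_GP_integral ::
  "'s measure \<Rightarrow> 'a::complex_vector topology \<Rightarrow> ('s \<Rightarrow> 'a) \<Rightarrow> 's set \<Rightarrow> 'a \<Rightarrow> bool" where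
  "is_GP_integral M W f S I \<longleftrightarrow>
     I \<in> topspace W \<and> (\<forall>l\<in>top_dual W. l I = (LINT \<sigma>:S|M. l (f \<sigma>)))"

definition GP_integrable ::
  "'s measure \<Rightarrow> 'a::complex_vector topology \<Rightarrow> ('s \<Rightarrow> 'a) \<Rightarrow> bool" where
  "GP_integrable M W f \<longleftrightarrow> weakly_measurable M W f \<and>
     (\<forall>l\<in>top_dual W. (\<integral>\<^sup>+\<sigma>. ennreal (cmod (l (f \<sigma>))) \<partial>M) < \<infinity>) \<and>
     (\<forall>S\<in>sets M. \<exists>I. is_GP_integral M W f S I)"

definition GP_integral ::
  "'s measure \<Rightarrow> 'a::complex_vector topology \<Rightarrow> ('s \<Rightarrow> 'a) \<Rightarrow> 's set \<Rightarrow> 'a" where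
  "GP_integral M W f S = (THE I. is_GP_integral M W f S I)"

subsection \<open>Pointwise Pettis integral of operator-valued maps\<close>

definition pw_weakly_measurable ::
  "'s measure \<Rightarrow> ('s \<Rightarrow> 'a::complex_hilbert \<Rightarrow>\<^sub>L 'b::complex_hilbert) \<Rightarrow> bool" where
  "pw_weakly_measurable M F \<longleftrightarrow>
     (\<forall>h k. (\<lambda>\<sigma>. cinner (blinfun_apply (F \<sigma>) h) k) \<in> borel_measurable M)"

definition pw_Pettis_integrable ::
  "'s measure \<Rightarrow> ('s \<Rightarrow> 'a::complex_hilbert \<Rightarrow>\<^sub>L 'b::complex_hilbert) \<Rightarrow> bool" where
  "pw_Pettis_integrable M F \<longleftrightarrow> pw_weakly_measurable M F \<and>
     (\<forall>h k. (\<integral>\<^sup>+\<sigma>. ennreal (cmod (cinner (blinfun_apply (F \<sigma>) h) k)) \<partial>M) < \<infinity>)"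

definition pw_Pettis_integral ::
  "'s measure \<Rightarrow> ('s \<Rightarrow> 'a::complex_hilbert \<Rightarrow>\<^sub>L 'b::complex_hilbert) \<Rightarrow> 's set \<Rightarrow> 'a \<Rightarrow>\<^sub>L 'b" where
  "pw_Pettis_integral M F S = (THE R. R \<in> bops \<and>
     (\<forall>h k. cinner (blinfun_apply R h) k = (LINT \<sigma>:S|M. cinner (blinfun_apply (F \<sigma>) h) k)))"

definition pw_Pettis_integrable_in ::
  "'s measure \<Rightarrow> ('a::complex_hilbert \<Rightarrow>\<^sub>L 'b::complex_hilbert) set \<Rightarrow> ('s \<Rightarrow> 'a \<Rightarrow>\<^sub>L 'b) \<Rightarrow> bool"
where
  "pw_Pettis_integrable_in M V F \<longleftrightarrow> pw_Pettis_integrable M F \<and> F \<in> space M \<rightarrow> V \<and>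
     (\<forall>S\<in>sets M. pw_Pettis_integral M F S \<in> V)"

subsection \<open>Predual and weak* integral\<close>

definition predual ::
  "('a::complex_hilbert \<Rightarrow>\<^sub>L 'b::complex_hilbert) set \<Rightarrow> (('a \<Rightarrow>\<^sub>L 'b) \<Rightarrow> complex) set" where
  "predual V = top_dual (sigma_op_topology WOT V)"

definition functional_norm :: "'a::real_normed_vector set \<Rightarrow> ('a \<Rightarrow> complex) \<Rightarrow> real" where
  "functional_norm V l = (SUP A\<in>{A \<in> V. norm A \<le> 1}. cmod (l A))"

definition normed_dual ::
  "'w::complex_vector set \<Rightarrow> ('w \<Rightarrow> real) \<Rightarrow> ('w \<Rightarrow> complex) set" where
  "normed_dual W nrm = {\<Lambda>. clinear_on W \<Lambda> \<and> (\<exists>C. \<forall>w\<in>W. cmod (\<Lambda> w) \<le> C * nrm w) \<and>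
                            (\<forall>w. w \<notin> W \<longrightarrow> \<Lambda> w = 0)}"

definition weakstar_integrable ::
  "'s measure \<Rightarrow> 'w::complex_vector set \<Rightarrow> ('w \<Rightarrow> real) \<Rightarrow> ('s \<Rightarrow> 'w \<Rightarrow> complex) \<Rightarrow> bool" where
  "weakstar_integrable M W nrm g \<longleftrightarrow> g \<in> space M \<rightarrow> normed_dual W nrm \<and>
     (\<forall>w\<in>W. (\<lambda>\<sigma>. g \<sigma> w) \<in> borel_measurable M \<and>
             (\<integral>\<^sup>+\<sigma>. ennreal (cmod (g \<sigma> w)) \<partial>M) < \<infinity>)"

definition weakstar_integral ::
  "'s measure \<Rightarrow> 'w set \<Rightarrow> ('s \<Rightarrow> 'w \<Rightarrow> complex) \<Rightarrow> 's set \<Rightarrow> 'w \<Rightarrow> complex" where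
  "weakstar_integral M W g S = (\<lambda>w. if w \<in> W then (LINT \<sigma>:S|M. g \<sigma> w) else 0)"

text \<open>The usual identification of \<open>V\<close> with the dual of its predual.\<close>

definition predual_eval ::
  "('a::complex_hilbert \<Rightarrow>\<^sub>L 'b::complex_hilbert) set \<Rightarrow> ('a \<Rightarrow>\<^sub>L 'b) \<Rightarrow>
     (('a \<Rightarrow>\<^sub>L 'b) \<Rightarrow> complex) \<Rightarrow> complex" where
  "predual_eval V A = (\<lambda>l. if l \<in> predual V then l A else 0)"


section \<open>Von Neumann algebras\<close>

definition von_neumann_algebra :: "('a::complex_hilbert \<Rightarrow>\<^sub>L 'a) set \<Rightarrow> bool" where
  "von_neumann_algebra \<M> \<longleftrightarrow> \<M> \<subseteq> bops \<and> csubspace \<M> \<and> id_blinfun \<in> \<M> \<and>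
     (\<forall>A\<in>\<M>. \<forall>B\<in>\<M>. A o\<^sub>L B \<in> \<M>) \<and> (\<forall>A\<in>\<M>. adj A \<in> \<M>) \<and>
     closedin (op_topology WOT bops) \<M>"

definition star_isomorphism ::
  "('a::complex_hilbert \<Rightarrow>\<^sub>L 'a) set \<Rightarrow> ('b::complex_hilbert \<Rightarrow>\<^sub>L 'b) set \<Rightarrow>
     (('a \<Rightarrow>\<^sub>L 'a) \<Rightarrow> ('b \<Rightarrow>\<^sub>L 'b)) \<Rightarrow> bool" where
  "star_isomorphism \<M> \<N> \<pi> \<longleftrightarrow> bij_betw \<pi> \<M> \<N> \<and>
     (\<forall>A\<in>\<M>. \<forall>B\<in>\<M>. \<pi> (A + B) = \<pi> A + \<pi> B) \<and> (\<forall>c. \<forall>A\<in>\<M>. \<pi> (c *\<^sub>C A) = c *\<^sub>C \<pi> A) \<and>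
     (\<forall>A\<in>\<M>. \<forall>B\<in>\<M>. \<pi> (A o\<^sub>L B) = \<pi> A o\<^sub>L \<pi> B) \<and> (\<forall>A\<in>\<M>. \<pi> (adj A) = adj (\<pi> A))"

end

theory Submission
  imports Defs
begin

text \<open>
  A functional on \<open>V\<close> that is continuous for one of the topologies is bounded by finitely many
  seminorms, hence factors through \<open>A \<mapsto> ((A h\<^sub>n), (A\<^sup>* k\<^sub>n))\<close>; Riesz representation in
  \<open>\<ell>\<^sup>2(K) \<oplus> \<ell>\<^sup>2(H)\<close> shows that it is a (finite or square-summable) sum of matrix coefficients.
  So the duals do not depend on the choice of \<open>\<T>\<close>. Integrals exist by uniform boundedness, and they
  lie in a \<open>\<sigma>\<close>-weakly closed \<open>V\<close> because \<open>\<sigma>\<close>-weakly continuous functionals separate points from \<open>V\<close>.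
  Independence of the representation is the normality of \<open>*\<close>-isomorphisms, proved without
  spectral theory from square roots, Vigier's theorem for chains, and Zorn's lemma.
\<close>

section \<open>Hilbert space preliminaries\<close>

text \<open>Amplification and interleaving make every \<open>\<sigma>\<close>-weakly continuous
  functional a single coefficient \<open>cinner (ampl A h) k\<close>, so that questions about
  sequences become questions about one Hilbert space. In the strong-star case the map to be factored
  contains \<open>adj A\<close> and is only real-linear, which is why Riesz comes first in a real
  version. For normality, \<open>norm (ampl (\<pi> A) \<zeta>)\<close> has to be dominated by some
  \<open>norm (ampl A \<xi>)\<close>. A comparison with vector states achieves this only on a piece
  of the identity, and the difficulty is to glue infinitely many pieces: their dominating vectors
  have to be square-summable, while domination alone says nothing about their size. A Radon-Nikodym
  step brings each norm close to its least possible value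
  \<open>norm (ampl (\<pi> B) \<zeta>)\<close>, and these values are small along a chain because
  suprema are mapped to suprema. Traces are handled without duality: a trace class operator
  annihilates all but countably many basis vectors, so its trace functional is a countable sum of
  coefficients even in a nonseparable space.\<close>

lemma scaleC_zero_left [simp]: "0 *\<^sub>C x = (0 :: 'a::complex_vector)"
  by (metis add_cancel_right_left scaleC_add_left)

lemma scaleC_zero_right [simp]: "c *\<^sub>C 0 = (0 :: 'a::complex_vector)"
  by (metis add_cancel_right_left scaleC_add_right)

lemma scaleC_minus_one: "(-1) *\<^sub>C x = - (x :: 'a::complex_vector)"
proof -
  have "(-1) *\<^sub>C x + x = ((-1) + 1) *\<^sub>C x"
    by (subst scaleC_add_left) (simp add: scaleC_one)
  then show ?thesis by (simp add: eq_neg_iff_add_eq_0)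
qed

lemma scaleC_minus_right: "c *\<^sub>C (- x) = - (c *\<^sub>C (x :: 'a::complex_vector))"
  by (metis add.right_inverse add_eq_0_iff scaleC_add_right scaleC_zero_right)

lemma scaleC_diff_right: "c *\<^sub>C (x - y) = c *\<^sub>C x - c *\<^sub>C (y :: 'a::complex_vector)"
  by (metis diff_conv_add_uminus scaleC_add_right scaleC_minus_right)

lemma cinner_add_right: "cinner x (y + z) = cinner x y + cinner x (z :: 'a::complex_hilbert)"
  by (metis cinner_add_left cinner_commute complex_cnj_add)

lemma cinner_scaleC_right: "cinner x (c *\<^sub>C y) = cnj c * cinner x (y :: 'a::complex_hilbert)"
  by (metis cinner_commute cinner_scaleC_left complex_cnj_mult)

lemma cinner_zero_left [simp]: "cinner 0 (x :: 'a::complex_hilbert) = 0"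
  by (metis add_cancel_right_left cinner_add_left)

lemma cinner_zero_right [simp]: "cinner (x :: 'a::complex_hilbert) 0 = 0"
  by (metis add_cancel_right_left cinner_add_right)

lemma cinner_minus_left: "cinner (- x) (y :: 'a::complex_hilbert) = - cinner x y"
  by (metis add.right_inverse add_eq_0_iff cinner_add_left cinner_zero_left)

lemma cinner_minus_right: "cinner x (- y :: 'a::complex_hilbert) = - cinner x y"
  by (metis add.right_inverse add_eq_0_iff cinner_add_right cinner_zero_right)

lemma cinner_diff_left: "cinner (x - y) (z :: 'a::complex_hilbert) = cinner x z - cinner y z"
  by (metis cinner_add_left cinner_minus_left diff_conv_add_uminus)

lemma cinner_diff_right: "cinner x (y - z :: 'a::complex_hilbert) = cinner x y - cinner x z"
  by (metis cinner_add_right cinner_minus_right diff_conv_add_uminus)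

lemma cinner_scaleR_left: "cinner (r *\<^sub>R x) (y :: 'a::complex_hilbert) = of_real r * cinner x y"
  by (simp add: scaleR_scaleC cinner_scaleC_left)

lemma cinner_scaleR_right: "cinner x (r *\<^sub>R y :: 'a::complex_hilbert) = of_real r * cinner x y"
  by (simp add: scaleR_scaleC cinner_scaleC_right)

lemmas cinner_linear = cinner_add_left cinner_add_right cinner_scaleC_left cinner_scaleC_right
  cinner_minus_left cinner_minus_right cinner_diff_left cinner_diff_right cinner_scaleR_left
  cinner_scaleR_right

lemma cinner_sum_left: "cinner (sum f S) (y :: 'a::complex_hilbert) = (\<Sum>i\<in>S. cinner (f i) y)"
  by (induction S rule: infinite_finite_induct) (auto simp: cinner_add_left)

lemma cinner_sum_right: "cinner y (sum f S :: 'a::complex_hilbert) = (\<Sum>i\<in>S. cinner y (f i))"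
  by (induction S rule: infinite_finite_induct) (auto simp: cinner_add_right)

lemma Re_cinner_self: "Re (cinner x (x :: 'a::complex_hilbert)) = (norm x)\<^sup>2"
  by (simp add: norm_eq_sqrt_cinner cinner_ge_zero)

lemma cinner_self: "cinner x (x :: 'a::complex_hilbert) = of_real ((norm x)\<^sup>2)"
proof -
  have "Im (cinner x x) = 0"
    using cinner_commute[of x x] by (metis Im_complex_of_real complex_In_mult_cnj_zero
        Reals_cnj_iff complex_is_Real_iff)
  then show ?thesis by (simp add: complex_eq_iff Re_cinner_self)
qed

lemma norm_add_sq:
  "(norm (x + y))\<^sup>2 = (norm x)\<^sup>2 + 2 * Re (cinner x y) + (norm (y :: 'a::complex_hilbert))\<^sup>2"
proof -
  have "Re (cinner y x) = Re (cinner x y)"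
    by (metis cinner_commute complex_cnj(1) complex_surj complex.sel(1))
  then show ?thesis
    by (simp add: Re_cinner_self[symmetric] cinner_linear)
qed

section \<open>Cauchy-Schwarz for semidefinite forms\<close>

lemma quadratic_nonneg_imp:
  fixes a b m :: real
  assumes "\<And>t. 0 \<le> a - 2 * t * m + t\<^sup>2 * b" and "0 \<le> b"
  shows "m\<^sup>2 \<le> a * b"
proof (cases "b = 0")
  case True
  have "m = 0"
  proof (rule ccontr)
    assume "m \<noteq> 0"
    \<comment> \<open>At this \<open>t\<close> the linear polynomial takes the value -1.\<close>
    then show False using assms(1)[of "(a + 1) / (2 * m)"] True by simp
  qed
  then show ?thesis by (simp add: True)
next
  case False
  then have "b > 0" using assms(2) by simp
  then have "0 \<le> b * (a - 2 * (m / b) * m + (m / b)\<^sup>2 * b)"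
    using assms(1)[of "m / b"] by (intro mult_nonneg_nonneg) auto
  also have "\<dots> = a * b - m\<^sup>2"
    using \<open>b > 0\<close> by (simp add: field_simps power2_eq_square)
  finally show ?thesis by simp
qed

text \<open>The form is only semidefinite and lives on a subspace of a vector space without a norm.
  Thus the lemma serves the inner product itself, the forms of positive operators, and
  square-summable sequences before they are known to form a Hilbert space.\<close>

lemma psd_Cauchy_Schwarz:
  fixes q :: "'a::complex_vector \<Rightarrow> 'a \<Rightarrow> complex"
  assumes V: "csubspace V"
    and add: "\<And>x y z. \<lbrakk>x \<in> V; y \<in> V; z \<in> V\<rbrakk> \<Longrightarrow> q (x + y) z = q x z + q y z"
    and scale: "\<And>c x z. \<lbrakk>x \<in> V; z \<in> V\<rbrakk> \<Longrightarrow> q (c *\<^sub>C x) z = c * q x z"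
    and herm: "\<And>x y. \<lbrakk>x \<in> V; y \<in> V\<rbrakk> \<Longrightarrow> q y x = cnj (q x y)"
    and pos: "\<And>x. x \<in> V \<Longrightarrow> 0 \<le> Re (q x x)"
    and x: "x \<in> V" and y: "y \<in> V"
  shows "(cmod (q x y))\<^sup>2 \<le> Re (q x x) * Re (q y y)"
proof (cases "q x y = 0")
  case True
  then show ?thesis using pos[OF x] pos[OF y] by simp
next
  case False
  define m where "m = cmod (q x y)"
  \<comment> \<open>\<open>w\<close> is the phase of \<open>q x y\<close>: along
    \<open>x - t w y\<close> the cross term is the real number \<open>- 2 t m\<close>, and the form
    becomes a real quadratic polynomial in \<open>t\<close>.\<close>
  define w where "w = q x y / of_real m"
  have m: "m > 0" using False by (simp add: m_def)
  have wq: "w * cnj (q x y) = of_real m"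
    using m by (simp add: w_def complex_norm_square[symmetric] m_def[symmetric] power2_eq_square)
  have ww: "w * cnj w = 1"
    using m by (simp add: w_def complex_norm_square[symmetric] m_def[symmetric] power2_eq_square)
  have "0 \<le> Re (q x x) - 2 * t * m + t\<^sup>2 * Re (q y y)" for t
  proof -
    define c where "c = - of_real t * w"
    define z where "z = c *\<^sub>C y"
    have z: "z \<in> V" and xz: "x + z \<in> V" using V x y by (auto simp: csubspace_def z_def)
    have zx: "q z x = - of_real (t * m)"
      unfolding z_def using scale[OF y x, of c] herm[OF x y] wq by (simp add: c_def)
    then have xz': "q x z = - of_real (t * m)" using herm[OF z x] by simp
    have yz: "q y z = cnj c * q y y"
      unfolding z_def using herm[of "c *\<^sub>C y" y] scale[OF y y, of c] herm[OF y y] y z z_def by simp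
    have cc: "c * cnj c = of_real (t\<^sup>2)"
    proof -
      have "c * cnj c = of_real t * of_real t * (w * cnj w)" by (simp add: c_def)
      then show ?thesis by (simp add: ww power2_eq_square)
    qed
    have zz: "q z z = of_real (t\<^sup>2) * q y y"
      using scale[OF y z, of c] yz cc by (simp add: z_def mult.assoc[symmetric])
    have 1: "q x (x + z) = q x x + q x z"
    proof -
      have "q x (x + z) = cnj (q x x) + cnj (q z x)"
        unfolding herm[OF xz x] add[OF x z x] by simp
      then show ?thesis by (metis herm x z)
    qed
    have 2: "q z (x + z) = q z x + q z z"
    proof -
      have "q z (x + z) = cnj (q x z) + cnj (q z z)"
        unfolding herm[OF xz z] add[OF x z z] by simp
      then show ?thesis by (metis herm x z)
    qed
    have "q (x + z) (x + z) = q x x + q z x + (q x z + q z z)"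
      unfolding add[OF x z xz] 1 2 by simp
    then have "Re (q (x + z) (x + z)) = Re (q x x) - 2 * t * m + t\<^sup>2 * Re (q y y)"
      by (simp add: zx xz' zz)
    then show ?thesis using pos[OF xz] by simp
  qed
  from quadratic_nonneg_imp[OF this pos[OF y]] show ?thesis by (simp add: m_def)
qed

lemma csubspace_UNIV [simp]: "csubspace UNIV"
  by (simp add: csubspace_def)

lemma norm_cinner_le: "cmod (cinner x y) \<le> norm x * norm (y :: 'a::complex_hilbert)"
proof -
  have "(cmod (cinner x y))\<^sup>2 \<le> Re (cinner x x) * Re (cinner y y)"
    by (rule psd_Cauchy_Schwarz[where V = UNIV])
      (simp_all add: cinner_linear cinner_ge_zero, rule cinner_commute)
  then have "(cmod (cinner x y))\<^sup>2 \<le> (norm x * norm y)\<^sup>2"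
    by (simp add: Re_cinner_self power_mult_distrib)
  then show ?thesis by (rule power2_le_imp_le) simp
qed

lemma bounded_bilinear_cinner:
  "bounded_bilinear (cinner :: 'a::complex_hilbert \<Rightarrow> 'a \<Rightarrow> complex)"
proof
  show "\<exists>K. \<forall>a b::'a. norm (cinner a b) \<le> norm a * norm b * K"
    using norm_cinner_le by (intro exI[of _ 1]) auto
qed (auto simp: cinner_linear scaleR_conv_of_real)

lemmas tendsto_cinner [tendsto_intros] = bounded_bilinear.tendsto[OF bounded_bilinear_cinner]

lemma cinner_eqI: "(\<And>z. cinner x z = cinner y z) \<Longrightarrow> x = (y :: 'a::complex_hilbert)"
  by (metis cinner_diff_left cinner_eq_zero_iff eq_iff_diff_eq_0)

text \<open>Riesz representation for a functional dominated by a seminorm \<open>v \<mapsto> \<parallel>L v\<parallel>\<close>; the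
  representing vector is the limit of a minimizing sequence of \<open>v \<mapsto> \<parallel>L v\<parallel>\<^sup>2 - 2 l v\<close>.\<close>

lemma Riesz_real:
  fixes L :: "'v::complex_vector \<Rightarrow> 'x::complex_hilbert" and l :: "'v \<Rightarrow> real"
  assumes V: "csubspace V"
    and L_add: "\<And>u v. \<lbrakk>u \<in> V; v \<in> V\<rbrakk> \<Longrightarrow> L (u + v) = L u + L v"
    and L_scale: "\<And>t v. v \<in> V \<Longrightarrow> L (complex_of_real t *\<^sub>C v) = t *\<^sub>R L v"
    and l_add: "\<And>u v. \<lbrakk>u \<in> V; v \<in> V\<rbrakk> \<Longrightarrow> l (u + v) = l u + l v"
    and l_scale: "\<And>t v. v \<in> V \<Longrightarrow> l (complex_of_real t *\<^sub>C v) = t * l v"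
    and bound: "\<And>v. v \<in> V \<Longrightarrow> \<bar>l v\<bar> \<le> C * norm (L v)" and C: "0 \<le> C"
  obtains r where "r \<in> closure (L ` V)" "norm r \<le> C" "\<And>v. v \<in> V \<Longrightarrow> l v = Re (cinner (L v) r)"
proof -
  define J where "J v = (norm (L v))\<^sup>2 - 2 * l v" for v
  define m where "m = Inf (J ` V)"
  have V0: "0 \<in> V" and Vadd: "\<And>u v. \<lbrakk>u \<in> V; v \<in> V\<rbrakk> \<Longrightarrow> u + v \<in> V"
    and Vsc: "\<And>c v. v \<in> V \<Longrightarrow> c *\<^sub>C v \<in> V"
    using V by (auto simp: csubspace_def)
  have J_ge: "J v \<ge> - C\<^sup>2" if "v \<in> V" for v
  proof -
    have "0 \<le> (norm (L v) - C)\<^sup>2" by simp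
    then have "2 * (C * norm (L v)) \<le> (norm (L v))\<^sup>2 + C\<^sup>2"
      by (simp add: power2_diff mult_ac)
    then show ?thesis using bound[OF that] by (simp add: J_def)
  qed
  have bdd: "bdd_below (J ` V)" using J_ge by (auto intro!: bdd_belowI2)
  have m_le: "m \<le> J v" if "v \<in> V" for v
    unfolding m_def using bdd that by (auto intro: cInf_lower)
  have "\<exists>v\<in>V. J v < m + 1 / real (Suc n)" for n
  proof -
    have "Inf (J ` V) < m + 1 / real (Suc n)" by (simp add: m_def)
    then show ?thesis using cInf_lessD[of "J ` V"] V0 by blast
  qed
  then obtain v where vV: "\<And>n. v n \<in> V" and vJ: "\<And>n. J (v n) < m + 1 / real (Suc n)"
    by metis
  have J_comb: "J (a + complex_of_real t *\<^sub>C b)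
      = J a + 2 * t * (Re (cinner (L a) (L b)) - l b) + t\<^sup>2 * (norm (L b))\<^sup>2"
    if "a \<in> V" "b \<in> V" for a b t
    using that Vsc[OF that(2), of "of_real t"]
    by (simp add: J_def L_add l_add L_scale l_scale norm_add_sq cinner_linear power_mult_distrib
        algebra_simps)
  \<comment> \<open>Parallelogram law: \<open>J\<close> is at least \<open>m\<close> at the
    midpoint, so two almost-minimizers have close images under \<open>L\<close>. The images form a
    Cauchy sequence although \<open>V\<close> itself carries no norm.\<close>
  have mid: "(norm (L a - L b))\<^sup>2 \<le> 2 * (J a - m) + 2 * (J b - m)" if "a \<in> V" "b \<in> V" for a b
  proof -
    let ?c = "complex_of_real (1/2) *\<^sub>C (a + b)"
    have "L ?c = (1/2) *\<^sub>R (L a + L b)" "l ?c = (l a + l b) / 2"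
      using L_scale[of "a+b" "1/2"] l_scale[of "a+b" "1/2"] Vadd[OF that] L_add l_add that by auto
    then have "J ?c = (norm (L a + L b))\<^sup>2 / 4 - (l a + l b)"
      by (simp add: J_def power_divide)
    moreover have "m \<le> J ?c" using m_le Vsc Vadd that by blast
    moreover have "(norm (L a - L b))\<^sup>2 = 2 * (norm (L a))\<^sup>2 + 2 * (norm (L b))\<^sup>2 - (norm (L a + L b))\<^sup>2"
      using norm_add_sq[of "L a" "L b"] norm_add_sq[of "L a" "- L b"] by (simp add: cinner_linear)
    ultimately show ?thesis by (simp add: J_def)
  qed
  have "Cauchy (\<lambda>n. L (v n))"
  proof (rule CauchyI)
    fix e :: real assume e: "0 < e"
    obtain N where N: "1 / real (Suc N) < e\<^sup>2 / 4"
      using reals_Archimedean[of "e\<^sup>2 / 4"] e by (auto simp: inverse_eq_divide)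
    have "norm (L (v i) - L (v j)) < e" if "i \<ge> N" "j \<ge> N" for i j
    proof -
      have "1 / real (Suc i) \<le> 1 / real (Suc N)" "1 / real (Suc j) \<le> 1 / real (Suc N)"
        using that by (auto intro!: divide_left_mono)
      then have "J (v i) - m < e\<^sup>2 / 4" "J (v j) - m < e\<^sup>2 / 4"
        using vJ[of i] vJ[of j] N by linarith+
      then have "(norm (L (v i) - L (v j)))\<^sup>2 < e\<^sup>2"
        using mid[OF vV vV, of i j] by simp
      then show ?thesis by (rule power2_less_imp_less) (use e in simp)
    qed
    then show "\<exists>M. \<forall>m\<ge>M. \<forall>n\<ge>M. norm (L (v m) - L (v n)) < e" by blast
  qed
  then obtain r where r: "(\<lambda>n. L (v n)) \<longlonglongrightarrow> r"
    using Cauchy_convergent_iff convergent_def by blast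
  have rep: "l b = Re (cinner (L b) r)" if b: "b \<in> V" for b
  proof -
    \<comment> \<open>The parabola \<open>t \<mapsto> J (v n + t b) - m\<close> is nonnegative and
      its constant term is below \<open>1 / Suc n\<close>; its discriminant bounds the defect in the
      Euler equation.\<close>
    have est: "(l b - Re (cinner (L (v n)) (L b)))\<^sup>2 \<le> (norm (L b))\<^sup>2 / real (Suc n)" for n
    proof -
      have "0 \<le> 1 / real (Suc n) - 2 * t * (l b - Re (cinner (L (v n)) (L b))) + t\<^sup>2 * (norm (L b))\<^sup>2" for t
      proof -
        have "m \<le> J (v n + complex_of_real t *\<^sub>C b)" using m_le Vadd Vsc vV b by blast
        then show ?thesis using vJ[of n] J_comb[OF vV b, of n t] by (simp add: algebra_simps)
      qed
      from quadratic_nonneg_imp[OF this] show ?thesis by simp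
    qed
    have "(\<lambda>n. (l b - Re (cinner (L (v n)) (L b)))\<^sup>2) \<longlonglongrightarrow> (l b - Re (cinner r (L b)))\<^sup>2"
      by (intro tendsto_intros r)
    moreover have "(\<lambda>n. (norm (L b))\<^sup>2 / real (Suc n)) \<longlonglongrightarrow> 0"
      using tendsto_mult_right_zero[OF LIMSEQ_inverse_real_of_nat, of "(norm (L b))\<^sup>2"]
      by (simp add: divide_inverse)
    ultimately have "(l b - Re (cinner r (L b)))\<^sup>2 \<le> 0"
      using est by (intro LIMSEQ_le) auto
    then show ?thesis by (subst cinner_commute) simp
  qed
  have "Re (cinner r r) \<le> C * norm r"
  proof (rule LIMSEQ_le)
    show "(\<lambda>n. Re (cinner (L (v n)) r)) \<longlonglongrightarrow> Re (cinner r r)" "(\<lambda>n. C * norm (L (v n))) \<longlonglongrightarrow> C * norm r"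
      by (intro tendsto_intros r)+
    show "\<exists>N. \<forall>n\<ge>N. Re (cinner (L (v n)) r) \<le> C * norm (L (v n))"
      using rep bound vV by (metis abs_le_D1)
  qed
  then have "norm r * norm r \<le> C * norm r" by (simp add: Re_cinner_self power2_eq_square)
  then have "norm r \<le> C" using C by (metis mult_right_le_imp_le norm_ge_zero order_le_less)
  moreover have "r \<in> closure (L ` V)"
    unfolding closure_sequential using r vV by (intro exI[of _ "\<lambda>n. L (v n)"]) auto
  ultimately show ?thesis using rep that by blast
qed

text \<open>The real part of a complex-linear functional determines it: the vector representing
  \<open>Re l\<close> is tested at \<open>v\<close> and at \<open>i v\<close>.\<close>

lemma Riesz_complex:
  fixes L :: "'v::complex_vector \<Rightarrow> 'x::complex_hilbert" and l :: "'v \<Rightarrow> complex"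
  assumes V: "csubspace V"
    and L_add: "\<And>u v. \<lbrakk>u \<in> V; v \<in> V\<rbrakk> \<Longrightarrow> L (u + v) = L u + L v"
    and L_scale: "\<And>c v. v \<in> V \<Longrightarrow> L (c *\<^sub>C v) = c *\<^sub>C L v"
    and l: "clinear_on V l"
    and bound: "\<And>v. v \<in> V \<Longrightarrow> cmod (l v) \<le> C * norm (L v)" and C: "0 \<le> C"
  obtains r where "r \<in> closure (L ` V)" "norm r \<le> C" "\<And>v. v \<in> V \<Longrightarrow> l v = cinner (L v) r"
proof -
  have b: "\<bar>Re (l v)\<bar> \<le> C * norm (L v)" if "v \<in> V" for v
    using bound[OF that] abs_Re_le_cmod[of "l v"] by linarith
  obtain r where r: "r \<in> closure (L ` V)" "norm r \<le> C"
    and rr: "\<And>v. v \<in> V \<Longrightarrow> Re (l v) = Re (cinner (L v) r)"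
    by (rule Riesz_real[OF V L_add, of "\<lambda>v. Re (l v)" C])
       (use l b C in \<open>auto simp: L_scale clinear_on_def scaleR_scaleC\<close>)
  have "l v = cinner (L v) r" if v: "v \<in> V" for v
  proof -
    have "\<i> *\<^sub>C v \<in> V" using V v by (auto simp: csubspace_def)
    then have "Re (\<i> * l v) = Re (\<i> * cinner (L v) r)"
      using rr[of "\<i> *\<^sub>C v"] v l L_scale by (simp add: clinear_on_def cinner_linear)
    then show ?thesis using rr[OF v] by (simp add: complex_eq_iff)
  qed
  then show ?thesis using that r by blast
qed

section \<open>Bounded operators and adjoints\<close>

lemma bopsD: "A \<in> bops \<Longrightarrow> blinfun_apply A (c *\<^sub>C x) = c *\<^sub>C blinfun_apply A x"
  by (simp add: bops_def)

lemma bops_add [simp, intro]: "A \<in> bops \<Longrightarrow> B \<in> bops \<Longrightarrow> A + B \<in> bops"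
  by (simp add: bops_def blinfun.add_left scaleC_add_right)

lemma bops_minus [simp, intro]: "A \<in> bops \<Longrightarrow> - A \<in> bops"
  by (simp add: bops_def blinfun.minus_left scaleC_minus_right)

lemma bops_diff [simp, intro]: "A \<in> bops \<Longrightarrow> B \<in> bops \<Longrightarrow> A - B \<in> bops"
  by (simp add: bops_def blinfun.diff_left scaleC_diff_right)

lemma scaleC_blinfun_apply: "blinfun_apply (c *\<^sub>C A) x = c *\<^sub>C blinfun_apply A x"
  by (simp add: scaleC_blinfun.rep_eq)

lemma bops_scaleC [simp, intro]: "A \<in> bops \<Longrightarrow> c *\<^sub>C A \<in> bops"
  by (simp add: bops_def scaleC_blinfun_apply scaleC_scaleC mult.commute)

lemma scaleR_blinfun_scaleC: "r *\<^sub>R A = complex_of_real r *\<^sub>C (A :: 'a::real_normed_vector \<Rightarrow>\<^sub>L 'b::complex_hilbert)"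
  by (rule blinfun_eqI) (simp add: scaleC_blinfun_apply blinfun.scaleR_left scaleR_scaleC)

lemma bops_scaleR [simp, intro]: "A \<in> bops \<Longrightarrow> r *\<^sub>R A \<in> bops"
  by (simp add: scaleR_blinfun_scaleC)

lemma bops_0 [simp, intro]: "0 \<in> bops" by (simp add: bops_def)
lemma bops_id [simp, intro]: "id_blinfun \<in> bops" by (simp add: bops_def)
lemma bops_comp [simp, intro]: "A \<in> bops \<Longrightarrow> B \<in> bops \<Longrightarrow> A o\<^sub>L B \<in> bops"
  by (simp add: bops_def)

lemma norm_scaleC_blinfun: "norm (c *\<^sub>C A) = cmod c * norm (A :: 'a::complex_hilbert \<Rightarrow>\<^sub>L 'b::complex_hilbert)"
proof -
  have le: "norm (c *\<^sub>C A) \<le> cmod c * norm A" for c and A :: "'a \<Rightarrow>\<^sub>L 'b"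
    by (rule norm_blinfun_bound)
       (auto simp: scaleC_blinfun_apply norm_scaleC mult.assoc intro!: mult_left_mono norm_blinfun)
  show ?thesis
  proof (cases "c = 0")
    case False
    have "norm A = norm (inverse c *\<^sub>C c *\<^sub>C A)" using False by (simp add: scaleC_scaleC scaleC_one)
    also have "\<dots> \<le> cmod (inverse c) * norm (c *\<^sub>C A)" by (rule le)
    finally have "cmod c * norm A \<le> norm (c *\<^sub>C A)" using False by (simp add: norm_inverse norm_divide field_simps)
    then show ?thesis using le[of c A] by linarith
  qed simp
qed

lemma bops_sesquilinear_rep:
  fixes b :: "'h::complex_hilbert \<Rightarrow> 'k::complex_hilbert \<Rightarrow> complex"
  assumes "\<And>x y k. b (x + y) k = b x k + b y k" "\<And>c x k. b (c *\<^sub>C x) k = c * b x k"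
    and "\<And>h x y. b h (x + y) = b h x + b h y" "\<And>h c x. b h (c *\<^sub>C x) = cnj c * b h x"
    and bound: "\<And>h k. cmod (b h k) \<le> C * norm h * norm k" and C: "0 \<le> C"
  obtains R where "R \<in> bops" "norm R \<le> C" "\<And>h k. cinner (blinfun_apply R h) k = b h k"
proof -
  have "\<exists>r. norm r \<le> C * norm h \<and> (\<forall>k. b h k = cinner r k)" for h
  proof -
    \<comment> \<open>\<open>b h\<close> is antilinear, so its conjugate is the functional to be
      represented.\<close>
    obtain r where "norm r \<le> C * norm h" "\<And>k. cnj (b h k) = cinner k r"
      by (rule Riesz_complex[of UNIV "\<lambda>x. x" "\<lambda>k. cnj (b h k)" "C * norm h"])
        (use assms in \<open>auto simp: clinear_on_def\<close>)
    then show ?thesis by (metis cinner_commute complex_cnj_cnj)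
  qed
  then obtain R where R: "\<And>h. norm (R h) \<le> C * norm h" and Rb: "\<And>h k. b h k = cinner (R h) k"
    by metis
  have sc: "R (c *\<^sub>C x) = c *\<^sub>C R x" for c x
    by (rule cinner_eqI) (simp add: Rb[symmetric] assms cinner_linear)
  have ad: "R (x + y) = R x + R y" for x y
    by (rule cinner_eqI) (simp add: Rb[symmetric] assms cinner_linear)
  have bl: "bounded_linear R"
    by (rule bounded_linear_intro[where K = C])
       (auto simp: ad sc scaleR_scaleC R mult.commute)
  have ap: "blinfun_apply (Blinfun R) = R" using bl by (rule bounded_linear_Blinfun_apply)
  show ?thesis
    by (rule that[of "Blinfun R"]) (auto simp: ap bops_def sc Rb norm_blinfun_bound C R)
qed

lemma bops_eqI:
  assumes "\<And>h k. cinner (blinfun_apply A h) k = cinner (blinfun_apply B h) k"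
  shows "A = (B :: 'a::complex_hilbert \<Rightarrow>\<^sub>L 'b::complex_hilbert)"
  by (rule blinfun_eqI, rule cinner_eqI, rule assms)

lemma adj_unique:
  assumes "B \<in> bops" "\<And>h k. cinner (blinfun_apply A h) k = cinner h (blinfun_apply B k)"
  shows "adj A = B"
  unfolding adj_def
proof (rule the_equality)
  fix B' assume B': "B' \<in> bops \<and> (\<forall>h k. cinner (blinfun_apply A h) k = cinner h (blinfun_apply B' k))"
  show "B' = B"
    by (rule bops_eqI) (metis B' assms(2) cinner_commute)
qed (use assms in auto)

lemma adj_ex:
  assumes A: "A \<in> bops"
  shows "adj A \<in> bops \<and> (\<forall>h k. cinner (blinfun_apply A h) k = cinner h (blinfun_apply (adj A) k))"
proof -
  have bd: "cmod (cinner k (blinfun_apply A h)) \<le> norm A * norm k * norm h" for h k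
  proof -
    have "cmod (cinner k (blinfun_apply A h)) \<le> norm k * norm (blinfun_apply A h)" by (rule norm_cinner_le)
    also have "\<dots> \<le> norm k * (norm A * norm h)" by (intro mult_left_mono norm_blinfun) auto
    finally show ?thesis by (simp add: mult_ac)
  qed
  obtain R where R: "R \<in> bops" "norm R \<le> norm A"
    and RR: "\<And>k h. cinner (blinfun_apply R k) h = cinner k (blinfun_apply A h)"
    by (rule bops_sesquilinear_rep[of "\<lambda>k h. cinner k (blinfun_apply A h)" "norm A"])
       (use bd in \<open>auto simp: cinner_linear blinfun.add_right bopsD[OF A]\<close>)
  have "adj A = R" by (rule adj_unique) (use R RR in \<open>auto, metis cinner_commute\<close>)
  then show ?thesis using R RR by (metis cinner_commute)
qed

lemma adj_bops [simp, intro]: "A \<in> bops \<Longrightarrow> adj A \<in> bops"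
  and cinner_adj_right: "A \<in> bops \<Longrightarrow> cinner h (blinfun_apply (adj A) k) = cinner (blinfun_apply A h) k"
  using adj_ex[of A] by auto

lemma cinner_adj_left: "A \<in> bops \<Longrightarrow> cinner (blinfun_apply (adj A) k) h = cinner k (blinfun_apply A h)"
  by (metis cinner_adj_right cinner_commute)

lemma adj_adj [simp]: "A \<in> bops \<Longrightarrow> adj (adj A) = A"
  by (rule adj_unique) (auto simp: cinner_adj_left)

lemma adj_add: "A \<in> bops \<Longrightarrow> B \<in> bops \<Longrightarrow> adj (A + B) = adj A + adj B"
  by (rule adj_unique) (auto simp: cinner_adj_right cinner_linear blinfun.add_left)

lemma adj_diff: "A \<in> bops \<Longrightarrow> B \<in> bops \<Longrightarrow> adj (A - B) = adj A - adj B"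
  by (rule adj_unique) (auto simp: cinner_adj_right cinner_linear blinfun.diff_left)

lemma adj_scaleC: "A \<in> bops \<Longrightarrow> adj (c *\<^sub>C A) = cnj c *\<^sub>C adj A"
  by (rule adj_unique) (auto simp: cinner_adj_right cinner_linear scaleC_blinfun_apply)

lemma adj_scaleR: "A \<in> bops \<Longrightarrow> adj (r *\<^sub>R A) = r *\<^sub>R adj A"
  by (simp add: scaleR_blinfun_scaleC adj_scaleC)

lemma adj_comp: "A \<in> bops \<Longrightarrow> B \<in> bops \<Longrightarrow> adj (A o\<^sub>L B) = adj B o\<^sub>L adj A"
  by (rule adj_unique) (auto simp: cinner_adj_right)

lemma adj_id [simp]: "adj id_blinfun = id_blinfun" and adj_0 [simp]: "adj 0 = 0"
  by (rule adj_unique; simp)+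

section \<open>Positive operators\<close>

lemma positive_op_iff:
  "positive_op A \<longleftrightarrow> A \<in> bops \<and> (\<forall>h. Im (cinner (blinfun_apply A h) h) = 0 \<and> 0 \<le> Re (cinner (blinfun_apply A h) h))"
  by (auto simp: positive_op_def complex_nonneg_Reals_iff)

lemma positive_op_bops: "positive_op A \<Longrightarrow> A \<in> bops" by (simp add: positive_op_def)

text \<open>The sesquilinear form \<open>s\<close> that measures the failure of symmetry vanishes on
  the diagonal. Expanding it at \<open>h + k\<close> and at \<open>h + i k\<close> gives two linear
  equations that force \<open>s h k = 0\<close>.\<close>

lemma adj_eq_if_real:
  assumes A: "A \<in> bops" and re: "\<And>h. Im (cinner (blinfun_apply A h) h) = 0"
  shows "adj A = A"
proof (rule adj_unique[OF A])
  fix h k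
  define s where "s h k = cinner (blinfun_apply A h) k - cinner h (blinfun_apply A k)" for h k
  have s0: "s h h = 0" for h
  proof -
    have "cinner h (blinfun_apply A h) = cnj (cinner (blinfun_apply A h) h)" by (rule cinner_commute)
    also have "\<dots> = cinner (blinfun_apply A h) h" using re[of h] by (simp add: complex_eq_iff)
    finally show ?thesis by (simp add: s_def)
  qed
  have add: "s (x + y) z = s x z + s y z" "s z (x + y) = s z x + s z y" for x y z
    by (simp_all add: s_def cinner_linear blinfun.add_right)
  have sc: "s (c *\<^sub>C x) y = c * s x y" "s x (c *\<^sub>C y) = cnj c * s x y" for c x y
    by (simp_all add: s_def cinner_linear bopsD[OF A] algebra_simps)
  have "s (h + k) (h + k) = s h h + s h k + (s k h + s k k)" by (simp only: add ac_simps)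
  then have "s h k + s k h = 0" by (simp add: s0)
  moreover have "s (h + \<i> *\<^sub>C k) (h + \<i> *\<^sub>C k)
      = s h h + cnj \<i> * s h k + (\<i> * s k h + \<i> * (cnj \<i> * s k k))"
    by (simp only: add sc ac_simps distrib_left)
  then have "- \<i> * s h k + \<i> * s k h = 0" by (simp add: s0)
  ultimately have "s h k = 0" by (simp add: complex_eq_iff)
  then show "cinner (blinfun_apply A h) k = cinner h (blinfun_apply A k)" by (simp add: s_def)
qed

lemma positive_op_adj: "positive_op A \<Longrightarrow> adj A = A"
  by (simp add: positive_op_iff adj_eq_if_real)

lemma positive_op_selfadj:
  assumes "A \<in> bops" "adj A = A"
  shows "positive_op A \<longleftrightarrow> (\<forall>h. 0 \<le> Re (cinner (blinfun_apply A h) h))"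
proof -
  have "Im (cinner (blinfun_apply A h) h) = 0" for h
  proof -
    have "cinner (blinfun_apply A h) h = cnj (cinner (blinfun_apply A h) h)"
      using cinner_adj_left[OF assms(1), of h h] assms(2) cinner_commute by metis
    then show ?thesis by (simp add: complex_eq_iff)
  qed
  then show ?thesis using assms by (auto simp: positive_op_iff)
qed

lemma positive_op_add: "positive_op A \<Longrightarrow> positive_op B \<Longrightarrow> positive_op (A + B)"
  by (auto simp: positive_op_iff blinfun.add_left cinner_linear)

lemma positive_op_scaleR: "positive_op A \<Longrightarrow> 0 \<le> r \<Longrightarrow> positive_op (r *\<^sub>R A)"
  by (auto simp: positive_op_iff blinfun.scaleR_left cinner_linear)

lemma positive_op_0 [simp]: "positive_op 0" and positive_op_id [simp]: "positive_op id_blinfun"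
  by (auto simp: positive_op_iff cinner_self)

lemma positive_op_adj_self: "A \<in> bops \<Longrightarrow> positive_op (adj A o\<^sub>L A)"
  by (auto simp: positive_op_iff cinner_adj_left cinner_self)

lemma positive_op_Cauchy_Schwarz:
  assumes "positive_op A"
  shows "(cmod (cinner (blinfun_apply A x) y))\<^sup>2 \<le>
    Re (cinner (blinfun_apply A x) x) * Re (cinner (blinfun_apply A y) y)"
proof (rule psd_Cauchy_Schwarz[where V = UNIV])
  have A: "A \<in> bops" using assms by (rule positive_op_bops)
  show "cinner (blinfun_apply A y) x = cnj (cinner (blinfun_apply A x) y)" for x y
    using cinner_adj_left[OF A, of y x] positive_op_adj[OF assms] cinner_commute by metis
qed (use assms in \<open>auto simp: positive_op_iff blinfun.add_right cinner_linear bopsD\<close>)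

text \<open>Cauchy-Schwarz for the form of \<open>A\<close> at the pair \<open>x\<close>,
  \<open>A x\<close>.\<close>

lemma positive_op_zero:
  assumes "positive_op A" "Re (cinner (blinfun_apply A x) x) = 0" shows "blinfun_apply A x = 0"
proof -
  have "(cmod (cinner (blinfun_apply A x) (blinfun_apply A x)))\<^sup>2 \<le> 0"
    using positive_op_Cauchy_Schwarz[OF assms(1), of x "blinfun_apply A x"] assms(2) by simp
  then show ?thesis by (simp add: cinner_eq_zero_iff)
qed

lemma positive_op_antisym:
  assumes "positive_op (A - B)" "positive_op (B - A)" shows "A = B"
proof (rule blinfun_eqI)
  fix x
  have "Re (cinner (blinfun_apply (A - B) x) x) = 0"
    using assms by (auto simp: positive_op_iff blinfun.diff_left cinner_linear intro!: antisym)
  then have "blinfun_apply (A - B) x = 0" using assms positive_op_zero by blast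
  then show "blinfun_apply A x = blinfun_apply B x" by (simp add: blinfun.diff_left)
qed

text \<open>Cauchy-Schwarz for the form of \<open>A\<close> at \<open>x\<close> and
  \<open>y = A x\<close> gives \<open>|y|^4 \<le> \<langle>A x, x\<rangle> \<langle>A y, y\<rangle>
  \<le> |x|^2 |y|^2\<close>. This norm bound starts the square-root iteration and bounds chains of
  contractions uniformly.\<close>

lemma norm_positive_le_1:
  assumes "positive_op A" "positive_op (id_blinfun - A)" shows "norm A \<le> 1"
proof (rule norm_blinfun_bound)
  fix x
  let ?y = "blinfun_apply A x"
  have le: "Re (cinner (blinfun_apply A z) z) \<le> (norm z)\<^sup>2" for z
    using assms(2) by (auto simp: positive_op_iff blinfun.diff_left cinner_linear Re_cinner_self)
  have "(cmod (cinner ?y ?y))\<^sup>2 \<le> Re (cinner ?y x) * Re (cinner (blinfun_apply A ?y) ?y)"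
    by (rule positive_op_Cauchy_Schwarz[OF assms(1)])
  also have "\<dots> \<le> (norm x)\<^sup>2 * (norm ?y)\<^sup>2"
    using assms(1) by (intro mult_mono le) (auto simp: positive_op_iff)
  finally have *: "(norm ?y)\<^sup>2 * (norm ?y)\<^sup>2 \<le> (norm x)\<^sup>2 * (norm ?y)\<^sup>2"
    unfolding cinner_self norm_of_real by (simp add: power2_eq_square)
  then have "norm ?y \<le> norm x"
  proof (cases "?y = 0")
    case False
    then have "(norm ?y)\<^sup>2 \<le> (norm x)\<^sup>2"
      using * by (metis mult_right_le_imp_le zero_less_norm_iff zero_less_power)
    then show ?thesis by (rule power2_le_imp_le) simp
  qed simp
  then show "norm ?y \<le> 1 * norm x" by simp
qed simp

section \<open>Positive square roots\<close>

text \<open>Membership of the square root of \<open>A\<close> in every such algebra containing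
  \<open>A\<close> stands in for its being a norm limit of polynomials in \<open>A\<close>. It is
  applied to \<open>bops\<close>, to the commutant of one operator, and to von Neumann
  algebras.\<close>

definition norm_closed_algebra :: "('a::complex_hilbert \<Rightarrow>\<^sub>L 'a) set \<Rightarrow> bool" where
  "norm_closed_algebra \<A> \<longleftrightarrow> closed \<A> \<and> id_blinfun \<in> \<A> \<and>
     (\<forall>A\<in>\<A>. \<forall>B\<in>\<A>. A + B \<in> \<A> \<and> A o\<^sub>L B \<in> \<A>) \<and> (\<forall>r. \<forall>A\<in>\<A>. r *\<^sub>R A \<in> \<A>)"

lemma closed_bops: "closed bops"
  unfolding closed_sequential_limits
proof (intro allI impI; elim conjE)
  fix X and l :: "'a \<Rightarrow>\<^sub>L 'b"
  assume X: "\<forall>n. X n \<in> bops" and l: "X \<longlonglongrightarrow> l"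
  show "l \<in> bops" unfolding bops_def
  proof (intro CollectI allI)
    fix c x
    have "(\<lambda>n. blinfun_apply (X n) (c *\<^sub>C x)) \<longlonglongrightarrow> blinfun_apply l (c *\<^sub>C x)"
      by (intro tendsto_intros l)
    moreover have "(\<lambda>n. c *\<^sub>C blinfun_apply (X n) x) \<longlonglongrightarrow> c *\<^sub>C blinfun_apply l x"
      by (intro bounded_linear.tendsto[OF bounded_linear_scaleC] tendsto_intros l)
    ultimately show "blinfun_apply l (c *\<^sub>C x) = c *\<^sub>C blinfun_apply l x"
      using X by (simp add: bopsD) (metis LIMSEQ_unique)
  qed
qed

lemma norm_closed_algebra_bops: "norm_closed_algebra bops"
  by (simp add: norm_closed_algebra_def closed_bops)

lemma norm_closed_algebra_commutant: "norm_closed_algebra {X. X o\<^sub>L B = B o\<^sub>L X}"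
proof -
  have "closed {X. X o\<^sub>L B = B o\<^sub>L X}"
    by (intro closed_Collect_eq continuous_intros bounded_bilinear.continuous_on[OF bounded_bilinear_blinfun_compose])
  then show ?thesis
    by (auto simp: norm_closed_algebra_def blinfun_eqI blinfun_apply_inject[symmetric] fun_eq_iff blinfun.add_left blinfun.add_right
        blinfun.scaleR_left blinfun.scaleR_right)
qed

text \<open>The inequality \<open>(1 - y)^2 \<ge> 0\<close> makes the iterates increase below the
  fixed point 1. They are the majorant for the operator iteration.\<close>

lemma sqrt_iteration_bounds:
  fixes y :: "nat \<Rightarrow> real"
  assumes "y 0 = 0" "\<And>n. y (Suc n) = (1 + (y n)\<^sup>2) / 2"
  shows "0 \<le> y n" "y n \<le> 1" "y n \<le> y (Suc n)" "convergent y"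
proof -
  have b: "0 \<le> y n \<and> y n \<le> 1" for n
    by (induction n) (auto simp: assms abs_square_le_1 power_le_one)
  have m: "y n \<le> y (Suc n)" for n
  proof -
    have "0 \<le> (1 - y n)\<^sup>2" by simp
    then show ?thesis by (simp add: assms power2_diff)
  qed
  show "0 \<le> y n" "y n \<le> 1" "y n \<le> y (Suc n)" using b m by auto
  have "Bseq y" using b by (intro BseqI'[of _ 1]) auto
  moreover have "monoseq y" using m by (intro mono_SucI1) auto
  ultimately show "convergent y" by (rule Bseq_monoseq_convergent)
qed

text \<open>The iteration \<open>Y\<^sub>n\<^sub>+\<^sub>1 = (T + Y\<^sub>n\<^sup>2) / 2\<close>, \<open>T = 1 - A\<close>, converges in norm because its increments
  are dominated by those of the scalar iteration with \<open>T\<close> replaced by \<open>1\<close>.\<close>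

lemma sqrt_exists_contraction:
  fixes A :: "'a::complex_hilbert \<Rightarrow>\<^sub>L 'a"
  assumes A: "positive_op A" and A1: "positive_op (id_blinfun - A)"
  obtains R where "positive_op R" "(R o\<^sub>L R) = A"
    "\<And>\<A>. norm_closed_algebra \<A> \<Longrightarrow> A \<in> \<A> \<Longrightarrow> R \<in> \<A>"
proof -
  define T where "T = id_blinfun - A"
  define Y where "Y = rec_nat (0 :: 'a \<Rightarrow>\<^sub>L 'a) (\<lambda>_ Y. (1/2) *\<^sub>R (T + (Y o\<^sub>L Y)))"
  define y where "y = rec_nat (0 :: real) (\<lambda>_ y. (1 + y\<^sup>2) / 2)"
  have Y0: "Y 0 = 0" and YS: "\<And>n. Y (Suc n) = (1/2) *\<^sub>R (T + (Y n o\<^sub>L Y n))"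
    by (simp_all add: Y_def)
  have y0: "y 0 = 0" and yS: "\<And>n. y (Suc n) = (1 + (y n)\<^sup>2) / 2"
    by (simp_all add: y_def)
  note yb = sqrt_iteration_bounds[of y, OF y0 yS]
  have Tn: "norm T \<le> 1" unfolding T_def
    by (rule norm_positive_le_1) (use A A1 in auto)
  have T: "T \<in> bops" "adj T = T" using A1 by (auto simp: T_def positive_op_bops positive_op_adj)
  have Yn: "norm (Y n) \<le> y n" for n
  proof (induction n)
    case (Suc n)
    have "norm (Y (Suc n)) \<le> (1/2) * (norm T + norm ((Y n o\<^sub>L Y n)))"
      using norm_triangle_ineq[of T "(Y n o\<^sub>L Y n)"] by (simp add: YS)
    also have "\<dots> \<le> (1/2) * (1 + norm (Y n) * norm (Y n))"
      using Tn norm_blinfun_compose[of "Y n" "Y n"] by simp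
    also have "\<dots> \<le> (1/2) * (1 + y n * y n)"
      using Suc yb(1)[of n] by (intro mult_left_mono add_left_mono mult_mono) auto
    finally show ?case by (simp add: yS power2_eq_square)
  qed (simp add: Y0 y0)
  have Yd: "norm (Y (Suc n) - Y n) \<le> y (Suc n) - y n" for n
  proof (induction n)
    case 0
    show ?case using Tn by (simp add: YS Y0 yS y0)
  next
    case (Suc n)
    let ?D = "Y (Suc n) - Y n"
    have "Y (Suc (Suc n)) - Y (Suc n) = (1/2) *\<^sub>R ((Y (Suc n) o\<^sub>L Y (Suc n)) - (Y n o\<^sub>L Y n))"
      by (subst YS, subst (2) YS) (simp add: algebra_simps)
    \<comment> \<open>This splitting of a difference of squares holds without commutativity.\<close>
    also have "(Y (Suc n) o\<^sub>L Y (Suc n)) - (Y n o\<^sub>L Y n) = (Y (Suc n) o\<^sub>L ?D) + (?D o\<^sub>L Y n)"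
      by (rule blinfun_eqI) (simp add: blinfun.diff_left blinfun.add_left blinfun.diff_right)
    finally have "norm (Y (Suc (Suc n)) - Y (Suc n)) \<le>
        (1/2) * (norm (Y (Suc n)) * norm ?D + norm ?D * norm (Y n))"
      using norm_triangle_ineq[of "(Y (Suc n) o\<^sub>L ?D)" "(?D o\<^sub>L Y n)"]
        norm_blinfun_compose[of "Y (Suc n)" ?D] norm_blinfun_compose[of ?D "Y n"] by simp
    also have "\<dots> \<le> (1/2) * (y (Suc n) * (y (Suc n) - y n) + (y (Suc n) - y n) * y n)"
      using Suc Yn[of n] Yn[of "Suc n"] yb(1,3)[of n] yb(1)[of "Suc n"]
      by (intro mult_left_mono add_mono mult_mono) auto
    also have "\<dots> = y (Suc (Suc n)) - y (Suc n)"
      by (subst (4) yS, subst (2) yS[of n]) (simp add: power2_eq_square algebra_simps)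
    finally show ?case .
  qed
  have Ydist: "norm (Y m - Y n) \<le> y m - y n" if "n \<le> m" for m n
    using that
  proof (induction rule: dec_induct)
    case (step m)
    have "norm (Y (Suc m) - Y n) \<le> norm (Y (Suc m) - Y m) + norm (Y m - Y n)"
      using norm_triangle_ineq[of "Y (Suc m) - Y m" "Y m - Y n"] by simp
    then show ?case using step Yd[of m] by linarith
  qed simp
  have "Cauchy Y"
  proof (rule CauchyI)
    fix e :: real assume "0 < e"
    then obtain N where N: "\<And>m n. m \<ge> N \<Longrightarrow> n \<ge> N \<Longrightarrow> norm (y m - y n) < e"
      using CauchyD[OF convergent_Cauchy[OF yb(4)]] by metis
    have "norm (Y m - Y n) < e" if "m \<ge> N" "n \<ge> N" for m n
    proof (cases "n \<le> m")
      case True then show ?thesis using Ydist[OF True] N[OF that] by simp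
    next
      case False
      then show ?thesis using Ydist[of m n] N[OF that] by (simp add: norm_minus_commute)
    qed
    then show "\<exists>M. \<forall>m\<ge>M. \<forall>n\<ge>M. norm (Y m - Y n) < e" by blast
  qed
  then obtain Z where Z: "Y \<longlonglongrightarrow> Z" using Cauchy_convergent convergent_def by blast
  have ZS: "Z = (1/2) *\<^sub>R (T + (Z o\<^sub>L Z))"
  proof (rule LIMSEQ_unique)
    show "(\<lambda>n. Y (Suc n)) \<longlonglongrightarrow> Z" using Z by (rule LIMSEQ_Suc)
    show "(\<lambda>n. Y (Suc n)) \<longlonglongrightarrow> (1/2) *\<^sub>R (T + (Z o\<^sub>L Z))"
      unfolding YS by (intro tendsto_intros bounded_bilinear.tendsto[OF bounded_bilinear_blinfun_compose] Z)
  qed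
  have Zn: "norm Z \<le> 1"
    by (rule LIMSEQ_le_const2[OF tendsto_norm[OF Z]]) (use Yn yb(2) order_trans in blast)
  \<comment> \<open>The fixed point equation reads \<open>2 Z = T + Z^2\<close>, so
    \<open>(1 - Z)^2 = 1 - T = A\<close>; positivity of \<open>1 - Z\<close> comes from
    \<open>norm Z \<le> 1\<close>.\<close>
  define R where "R = id_blinfun - Z"
  have RA: "R \<in> \<A>" if \<A>: "norm_closed_algebra \<A>" and "A \<in> \<A>" for \<A>
  proof -
    have min: "X - W \<in> \<A>" if "X \<in> \<A>" "W \<in> \<A>" for X W
    proof -
      have "X + (-1) *\<^sub>R W \<in> \<A>" using \<A> that unfolding norm_closed_algebra_def by blast
      then show ?thesis by simp
    qed
    have T\<A>: "T \<in> \<A>" unfolding T_def by (rule min) (use that in \<open>auto simp: norm_closed_algebra_def\<close>)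
    have "Y n \<in> \<A>" for n
    proof (induction n)
      case 0
      have "0 *\<^sub>R T \<in> \<A>" using T\<A> \<A> unfolding norm_closed_algebra_def by blast
      then show ?case by (simp add: Y0)
    next
      case (Suc n)
      then show ?case using T\<A> \<A> unfolding norm_closed_algebra_def YS by blast
    qed
    then have "Z \<in> \<A>" using Z \<A> unfolding norm_closed_algebra_def closed_sequential_limits by blast
    then show "R \<in> \<A>" unfolding R_def by (intro min) (use \<A> in \<open>auto simp: norm_closed_algebra_def\<close>)
  qed
  have Rb: "R \<in> bops" using RA[OF norm_closed_algebra_bops] A positive_op_bops by blast
  have Ysa: "Y n \<in> bops \<and> adj (Y n) = Y n" for n
    by (induction n) (simp_all add: Y0 YS adj_scaleR adj_add adj_comp T)
  have Zsa: "cinner (blinfun_apply Z h) k = cinner h (blinfun_apply Z k)" for h k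
  proof (rule LIMSEQ_unique)
    show "(\<lambda>n. cinner (blinfun_apply (Y n) h) k) \<longlonglongrightarrow> cinner (blinfun_apply Z h) k"
      by (intro tendsto_intros Z)
    have "cinner (blinfun_apply (Y n) h) k = cinner h (blinfun_apply (Y n) k)" for n
      using Ysa[of n] cinner_adj_right[of "Y n" h k] by simp
    then show "(\<lambda>n. cinner (blinfun_apply (Y n) h) k) \<longlonglongrightarrow> cinner h (blinfun_apply Z k)"
      by (simp, intro tendsto_intros Z)
  qed
  have Rsa: "adj R = R"
    by (rule adj_unique[OF Rb]) (simp add: R_def blinfun.diff_left cinner_linear Zsa)
  have "0 \<le> Re (cinner (blinfun_apply R h) h)" for h
  proof -
    have "cmod (cinner (blinfun_apply Z h) h) \<le> norm (blinfun_apply Z h) * norm h"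
      by (rule norm_cinner_le)
    also have "\<dots> \<le> (1 * norm h) * norm h"
      using norm_blinfun[of Z h] mult_right_mono[OF Zn norm_ge_zero[of h]] by (intro mult_right_mono) auto
    finally have "cmod (cinner (blinfun_apply Z h) h) \<le> (norm h)\<^sup>2" by (simp add: power2_eq_square)
    then show ?thesis using complex_Re_le_cmod[of "cinner (blinfun_apply Z h) h"]
      by (simp add: R_def blinfun.diff_left cinner_linear Re_cinner_self)
  qed
  then have "positive_op R" by (simp add: positive_op_selfadj[OF Rb Rsa])
  moreover have "(R o\<^sub>L R) = A"
  proof -
    have "2 *\<^sub>R Z = 2 *\<^sub>R ((1/2) *\<^sub>R (T + (Z o\<^sub>L Z)))" using ZS by (rule arg_cong)
    also have "\<dots> = T + (Z o\<^sub>L Z)" by simp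
    finally have *: "2 *\<^sub>R Z = T + (Z o\<^sub>L Z)" .
    have "(R o\<^sub>L R) = id_blinfun - 2 *\<^sub>R Z + (Z o\<^sub>L Z)"
      by (rule blinfun_eqI) (simp add: R_def blinfun.diff_left blinfun.add_left blinfun.diff_right
          blinfun.scaleR_left scaleR_2)
    then show ?thesis unfolding * by (simp add: T_def)
  qed
  ultimately show ?thesis using RA that by blast
qed

lemma Re_cinner_blinfun_le: "Re (cinner (blinfun_apply A x) x) \<le> norm A * (norm x)\<^sup>2"
proof -
  have "Re (cinner (blinfun_apply A x) x) \<le> norm (blinfun_apply A x) * norm x"
    using norm_cinner_le[of "blinfun_apply A x" x] complex_Re_le_cmod order_trans by blast
  also have "\<dots> \<le> (norm A * norm x) * norm x" by (intro mult_right_mono norm_blinfun) auto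
  finally show ?thesis by (simp add: power2_eq_square)
qed

lemma sqrt_exists:
  fixes A :: "'a::complex_hilbert \<Rightarrow>\<^sub>L 'a"
  assumes A: "positive_op A"
  obtains R where "positive_op R" "R o\<^sub>L R = A"
    "\<And>\<A>. norm_closed_algebra \<A> \<Longrightarrow> A \<in> \<A> \<Longrightarrow> R \<in> \<A>"
proof -
  \<comment> \<open>Adding 1 keeps the scaling factor positive when \<open>A = 0\<close>.\<close>
  define c where "c = norm A + 1"
  have c: "c > 0" "norm A \<le> c" by (simp_all add: c_def add_nonneg_pos)
  let ?A = "(1/c) *\<^sub>R A"
  have Ab: "A \<in> bops" using A by (rule positive_op_bops)
  have P: "positive_op ?A" using A c by (intro positive_op_scaleR) auto
  have "adj (id_blinfun - ?A) = id_blinfun - ?A"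
    using positive_op_adj[OF A] Ab by (simp add: adj_diff adj_scaleR)
  moreover have "Re (cinner (blinfun_apply ?A h) h) \<le> (norm h)\<^sup>2" for h
  proof -
    have "Re (cinner (blinfun_apply A h) h) \<le> c * (norm h)\<^sup>2"
      using Re_cinner_blinfun_le[of A h] mult_right_mono[OF c(2), of "(norm h)\<^sup>2"] by simp
    then show ?thesis using c by (simp add: blinfun.scaleR_left cinner_linear field_simps)
  qed
  ultimately have "positive_op (id_blinfun - ?A)"
    using Ab by (subst positive_op_selfadj) (auto simp: blinfun.diff_left cinner_linear Re_cinner_self)
  then obtain R where R: "positive_op R" "R o\<^sub>L R = ?A"
    and RA: "\<And>\<A>. norm_closed_algebra \<A> \<Longrightarrow> ?A \<in> \<A> \<Longrightarrow> R \<in> \<A>"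
    using sqrt_exists_contraction[OF P] by metis
  show ?thesis
  proof (rule that[of "sqrt c *\<^sub>R R"])
    show "positive_op (sqrt c *\<^sub>R R)" using R c by (intro positive_op_scaleR) auto
    have "(sqrt c *\<^sub>R R) o\<^sub>L (sqrt c *\<^sub>R R) = c *\<^sub>R (R o\<^sub>L R)"
      using c by (intro blinfun_eqI) (simp add: blinfun.scaleR_left blinfun.scaleR_right)
    then show "(sqrt c *\<^sub>R R) o\<^sub>L (sqrt c *\<^sub>R R) = A" using c R by simp
    show "sqrt c *\<^sub>R R \<in> \<A>" if "norm_closed_algebra \<A>" "A \<in> \<A>" for \<A>
      using RA[of \<A>] that unfolding norm_closed_algebra_def by blast
  qed
qed

text \<open>\<open>S\<close> commutes with \<open>A = S^2\<close>, so \<open>R\<close>, lying in the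
  commutant of \<open>S\<close>, commutes with \<open>S\<close>. For \<open>y = (R - S) x\<close>
  this gives \<open>(R + S) y = 0\<close>; positivity forces \<open>R y = S y = 0\<close>, and then
  \<open>\<langle>y, y\<rangle> = \<langle>x, (R - S) y\<rangle> = 0\<close>.\<close>

lemma positive_sqrt_unique:
  assumes "positive_op R" "R o\<^sub>L R = A" "positive_op S" "S o\<^sub>L S = A"
    and RA: "\<And>\<A>. norm_closed_algebra \<A> \<Longrightarrow> A \<in> \<A> \<Longrightarrow> R \<in> \<A>"
  shows "S = R"
proof -
  have "A o\<^sub>L S = S o\<^sub>L A" unfolding assms(4)[symmetric] by (rule blinfun_eqI) simp
  then have com: "R o\<^sub>L S = S o\<^sub>L R" using RA[OF norm_closed_algebra_commutant[of S]] by blast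
  have com': "blinfun_apply R (blinfun_apply S x) = blinfun_apply S (blinfun_apply R x)" for x
    using com by (metis blinfun_apply_blinfun_compose)
  have sq: "blinfun_apply R (blinfun_apply R x) = blinfun_apply S (blinfun_apply S x)" for x
    using assms(2,4) by (metis blinfun_apply_blinfun_compose)
  have Db: "R - S \<in> bops" and Dsa: "adj (R - S) = R - S"
    using assms(1,3) by (auto simp: positive_op_bops adj_diff positive_op_adj)
  show ?thesis
  proof (rule blinfun_eqI)
    fix x
    define y where "y = blinfun_apply (R - S) x"
    have "blinfun_apply R y + blinfun_apply S y = 0"
      by (simp add: y_def blinfun.diff_left blinfun.diff_right com' sq)
    then have "cinner (blinfun_apply R y) y + cinner (blinfun_apply S y) y = 0"
      by (metis cinner_add_left cinner_zero_left)
    moreover have "0 \<le> Re (cinner (blinfun_apply R y) y)" "0 \<le> Re (cinner (blinfun_apply S y) y)"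
      using assms by (auto simp: positive_op_iff)
    ultimately have "Re (cinner (blinfun_apply R y) y) = 0" "Re (cinner (blinfun_apply S y) y) = 0"
      by (auto simp: complex_eq_iff)
    then have "blinfun_apply R y = 0" "blinfun_apply S y = 0"
      using positive_op_zero assms by blast+
    then have "blinfun_apply (R - S) y = 0" by (simp add: blinfun.diff_left)
    moreover have "cinner y y = cinner x (blinfun_apply (R - S) y)"
      using cinner_adj_right[OF Db, of x y] Dsa by (simp add: y_def)
    ultimately have "y = 0" by (simp add: cinner_eq_zero_iff)
    then show "blinfun_apply S x = blinfun_apply R x" by (simp add: y_def blinfun.diff_left)
  qed
qed

lemma assumes A: "positive_op A"
  shows sqrt_op_eqI: "\<lbrakk>positive_op S; S o\<^sub>L S = A\<rbrakk> \<Longrightarrow> sqrt_op A = S"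
    and sqrt_op_positive: "positive_op (sqrt_op A)"
    and sqrt_op_square: "sqrt_op A o\<^sub>L sqrt_op A = A"
    and sqrt_op_in: "\<lbrakk>norm_closed_algebra \<A>; A \<in> \<A>\<rbrakk> \<Longrightarrow> sqrt_op A \<in> \<A>"
proof -
  obtain R where R: "positive_op R" "R o\<^sub>L R = A"
    "\<And>\<A>. norm_closed_algebra \<A> \<Longrightarrow> A \<in> \<A> \<Longrightarrow> R \<in> \<A>"
    using sqrt_exists[OF A] by blast
  have u: "S = R" if "positive_op S" "S o\<^sub>L S = A" for S
    using positive_sqrt_unique[OF R(1,2) that] R(3) by blast
  have *: "sqrt_op A = R" unfolding sqrt_op_def
    by (rule the_equality) (use R(1,2) u in blast)+
  show "sqrt_op A = S" if "positive_op S" "S o\<^sub>L S = A" using * u[OF that] by simp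
  show "positive_op (sqrt_op A)" "sqrt_op A o\<^sub>L sqrt_op A = A" using * R(1,2) by auto
  show "\<lbrakk>norm_closed_algebra \<A>; A \<in> \<A>\<rbrakk> \<Longrightarrow> sqrt_op A \<in> \<A>" unfolding * by (rule R(3))
qed

section \<open>The Hilbert space of square-summable sequences\<close>

lemma ell2_iff: "h \<in> ell2 \<longleftrightarrow> summable (\<lambda>n. (norm (h n))\<^sup>2)"
  by (simp add: ell2_def)

lemma norm_add_sq_le: "(norm (x + y))\<^sup>2 \<le> 2 * (norm x)\<^sup>2 + 2 * (norm (y :: 'a::real_normed_vector))\<^sup>2"
proof -
  have "(norm (x + y))\<^sup>2 \<le> (norm x + norm y)\<^sup>2"
    by (intro power_mono norm_triangle_ineq norm_ge_zero)
  also have "\<dots> \<le> 2 * (norm x)\<^sup>2 + 2 * (norm y)\<^sup>2"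
    using sum_squares_bound[of "norm x" "norm y"] by (simp add: power2_sum)
  finally show ?thesis .
qed

lemma ell2_add: assumes "h \<in> ell2" "k \<in> ell2" shows "(\<lambda>n. h n + k n) \<in> ell2"
  unfolding ell2_iff
proof (rule summable_comparison_test')
  show "summable (\<lambda>n. 2 * (norm (h n))\<^sup>2 + 2 * (norm (k n))\<^sup>2)"
    using assms by (intro summable_add summable_mult) (auto simp: ell2_iff)
qed (simp add: norm_add_sq_le)

lemma ell2_scaleC: assumes "h \<in> ell2" shows "(\<lambda>n. c *\<^sub>C h n) \<in> ell2"
  using assms by (simp add: ell2_iff norm_scaleC power_mult_distrib summable_mult)

lemma ell2_zero: "(\<lambda>n. 0) \<in> ell2" by (simp add: ell2_iff)

lemma ell2_blinfun: assumes "h \<in> ell2" shows "(\<lambda>n. blinfun_apply A (h n)) \<in> ell2"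
  unfolding ell2_iff
proof (rule summable_comparison_test')
  show "summable (\<lambda>n. (norm A)\<^sup>2 * (norm (h n))\<^sup>2)"
    using assms by (intro summable_mult) (auto simp: ell2_iff)
  show "norm ((norm (blinfun_apply A (h n)))\<^sup>2) \<le> (norm A)\<^sup>2 * (norm (h n))\<^sup>2" for n
    using norm_blinfun[of A "h n"] by (simp add: power_mult_distrib[symmetric] power_mono)
qed

lemma ell2_cinner_summable:
  assumes "h \<in> ell2" "k \<in> ell2"
  shows "summable (\<lambda>n. cmod (cinner (h n) (k n)))" "summable (\<lambda>n. cinner (h n) (k n))"
proof -
  show "summable (\<lambda>n. cmod (cinner (h n) (k n)))"
  proof (rule summable_comparison_test')
    show "summable (\<lambda>n. (norm (h n))\<^sup>2 + (norm (k n))\<^sup>2)"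
      using assms by (intro summable_add) (auto simp: ell2_iff)
    show "norm (cmod (cinner (h n) (k n))) \<le> (norm (h n))\<^sup>2 + (norm (k n))\<^sup>2" for n
      unfolding real_norm_def abs_norm_cancel
      using norm_cinner_le[of "h n" "k n"] sum_squares_bound[of "norm (h n)" "norm (k n)"]
        mult_nonneg_nonneg[OF norm_ge_zero[of "h n"] norm_ge_zero[of "k n"]] by linarith
  qed
  then show "summable (\<lambda>n. cinner (h n) (k n))" by (rule summable_norm_cancel)
qed

lemma ell2_inner_add_left:
  "\<lbrakk>h \<in> ell2; h' \<in> ell2; k \<in> ell2\<rbrakk> \<Longrightarrow> ell2_inner (\<lambda>n. h n + h' n) k = ell2_inner h k + ell2_inner h' k"
  by (simp add: ell2_inner_def cinner_add_left suminf_add ell2_cinner_summable)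

lemma ell2_inner_scaleC_left:
  "\<lbrakk>h \<in> ell2; k \<in> ell2\<rbrakk> \<Longrightarrow> ell2_inner (\<lambda>n. c *\<^sub>C h n) k = c * ell2_inner h k"
  by (simp add: ell2_inner_def cinner_scaleC_left suminf_mult ell2_cinner_summable)

lemma ell2_inner_commute:
  assumes "h \<in> ell2" "k \<in> ell2" shows "ell2_inner h k = cnj (ell2_inner k h)"
proof -
  have "(\<lambda>n. cnj (cinner (k n) (h n))) sums cnj (\<Sum>n. cinner (k n) (h n))"
    using ell2_cinner_summable(2)[OF assms(2,1)] by (simp add: sums_cnj summable_sums)
  moreover have "(\<lambda>n. cnj (cinner (k n) (h n))) = (\<lambda>n. cinner (h n) (k n))"
    by (rule ext) (metis cinner_commute)
  ultimately show ?thesis by (simp add: ell2_inner_def sums_iff)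
qed

lemma ell2_inner_self: assumes "h \<in> ell2" shows "ell2_inner h h = of_real ((ell2_norm h)\<^sup>2)"
proof -
  have "(\<Sum>n. (norm (h n))\<^sup>2) \<ge> 0" using assms by (intro suminf_nonneg) (auto simp: ell2_iff)
  moreover have "(\<lambda>n. complex_of_real ((norm (h n))\<^sup>2)) sums of_real (\<Sum>n. (norm (h n))\<^sup>2)"
    using assms by (intro sums_of_real summable_sums) (simp add: ell2_iff)
  ultimately show ?thesis
    unfolding ell2_inner_def ell2_norm_def cinner_self
    by (metis sums_unique real_sqrt_pow2)
qed

lemma csubspace_ell2: "csubspace (ell2 :: (nat \<Rightarrow> 'a::complex_hilbert) set)"
  by (auto simp: csubspace_def ell2_add ell2_scaleC ell2_zero zero_fun_def plus_fun_def scaleC_fun_def)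

lemma ell2_Cauchy_Schwarz:
  assumes "h \<in> ell2" "k \<in> ell2" shows "cmod (ell2_inner h k) \<le> ell2_norm h * ell2_norm k"
proof -
  have "(cmod (ell2_inner h k))\<^sup>2 \<le> Re (ell2_inner h h) * Re (ell2_inner k k)"
    by (rule psd_Cauchy_Schwarz[OF csubspace_ell2])
      (use assms in \<open>auto simp: plus_fun_def scaleC_fun_def ell2_inner_add_left ell2_inner_scaleC_left
          ell2_inner_self simp del: of_real_power intro: ell2_inner_commute\<close>)
  also have "\<dots> = (ell2_norm h * ell2_norm k)\<^sup>2"
    using assms by (simp add: ell2_inner_self power_mult_distrib del: of_real_power)
  finally show ?thesis
    by (rule power2_le_imp_le) (simp add: ell2_norm_def suminf_nonneg assms[unfolded ell2_iff])
qed

lemma ell2_norm_sq: "h \<in> ell2 \<Longrightarrow> (ell2_norm h)\<^sup>2 = (\<Sum>n. (norm (h n))\<^sup>2)"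
  by (simp add: ell2_norm_def suminf_nonneg ell2_iff)

lemma ell2_norm_nonneg: "h \<in> ell2 \<Longrightarrow> 0 \<le> ell2_norm h"
  by (simp add: ell2_norm_def suminf_nonneg ell2_iff)

text \<open>As a type, the sequences become an instance of \<open>complex_hilbert\<close>, so Riesz
  representation, Cauchy-Schwarz and uniform boundedness apply to them without being proved
  anew.\<close>

typedef (overloaded) 'a l2seq = "ell2 :: (nat \<Rightarrow> 'a::complex_hilbert) set"
  morphisms l2_nth Abs_l2
  using ell2_zero by blast

lemma l2_nth_ell2 [simp]: "l2_nth x \<in> ell2" by (rule l2_nth)

instantiation l2seq :: (complex_hilbert) complex_vector
begin
definition "0 = Abs_l2 (\<lambda>n. 0)"
definition "x + y = Abs_l2 (\<lambda>n. l2_nth x n + l2_nth y n)"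
definition "- x = Abs_l2 (\<lambda>n. - l2_nth x n)"
definition "x - y = Abs_l2 (\<lambda>n. l2_nth x n - l2_nth y n)"
definition "c *\<^sub>C x = Abs_l2 (\<lambda>n. c *\<^sub>C l2_nth x n)"

lemma l2_nth_ops:
  "l2_nth (0 :: 'a l2seq) n = 0"
  "l2_nth (x + y) n = l2_nth x n + l2_nth y n"
  "l2_nth (- x) n = - l2_nth x n"
  "l2_nth (x - y) n = l2_nth x n - l2_nth y n"
  "l2_nth (c *\<^sub>C x) n = c *\<^sub>C l2_nth x n"
proof -
  have m: "(\<lambda>n. - l2_nth x n) \<in> ell2" for x :: "'a l2seq"
    using l2_nth_ell2[of x] by (simp add: ell2_iff)
  show "l2_nth (0 :: 'a l2seq) n = 0" by (simp add: zero_l2seq_def Abs_l2_inverse ell2_zero)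
  show "l2_nth (x + y) n = l2_nth x n + l2_nth y n"
    by (simp add: plus_l2seq_def Abs_l2_inverse ell2_add)
  show "l2_nth (- x) n = - l2_nth x n" by (simp add: uminus_l2seq_def Abs_l2_inverse m)
  show "l2_nth (x - y) n = l2_nth x n - l2_nth y n"
    using ell2_add[OF l2_nth_ell2[of x] m[of y]] by (simp add: minus_l2seq_def Abs_l2_inverse)
  show "l2_nth (c *\<^sub>C x) n = c *\<^sub>C l2_nth x n"
    by (simp add: scaleC_l2seq_def Abs_l2_inverse ell2_scaleC)
qed

lemma l2_eqI: "(\<And>n. l2_nth x n = l2_nth y n) \<Longrightarrow> x = y"
  by (metis ext l2_nth_inject)

instance
  by standard (rule l2_eqI, simp add: l2_nth_ops scaleC_add_right scaleC_add_left scaleC_scaleC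
      scaleC_one algebra_simps)+
end

instantiation l2seq :: (complex_hilbert) real_normed_vector
begin
definition "scaleR r (x :: 'a l2seq) = complex_of_real r *\<^sub>C x"
definition "norm (x :: 'a l2seq) = ell2_norm (l2_nth x)"
definition "sgn (x :: 'a l2seq) = inverse (norm x) *\<^sub>R x"
definition "dist (x :: 'a l2seq) y = norm (x - y)"
definition "(uniformity :: ('a l2seq \<times> 'a l2seq) filter) = (INF e\<in>{0 <..}. principal {(x, y). dist x y < e})"
definition "open (S :: 'a l2seq set) = (\<forall>x\<in>S. \<forall>\<^sub>F (x', y) in uniformity. x' = x \<longrightarrow> y \<in> S)"

instance
proof
  fix x y :: "'a l2seq" and a b :: real and S :: "'a l2seq set"
  show "dist x y = norm (x - y)" "sgn x = inverse (norm x) *\<^sub>R x"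
    "uniformity = (INF e\<in>{0 <..}. principal {(x :: 'a l2seq, y). dist x y < e})"
    "open S = (\<forall>x\<in>S. \<forall>\<^sub>F (x', y) in uniformity. x' = x \<longrightarrow> y \<in> S)"
    by (simp_all add: dist_l2seq_def sgn_l2seq_def uniformity_l2seq_def open_l2seq_def)
  show "a *\<^sub>R (x + y) = a *\<^sub>R x + a *\<^sub>R y" "(a + b) *\<^sub>R x = a *\<^sub>R x + b *\<^sub>R x"
    "a *\<^sub>R b *\<^sub>R x = (a * b) *\<^sub>R x" "1 *\<^sub>R x = x"
    by (simp_all add: scaleR_l2seq_def scaleC_add_right scaleC_add_left scaleC_scaleC scaleC_one)
  have "(\<Sum>n. (norm (l2_nth x n))\<^sup>2) = 0 \<longleftrightarrow> (\<forall>n. (norm (l2_nth x n))\<^sup>2 = 0)"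
    using l2_nth_ell2[of x] unfolding ell2_iff by (intro suminf_eq_zero_iff) auto
  then show "norm x = 0 \<longleftrightarrow> x = 0"
    by (auto simp: norm_l2seq_def ell2_norm_def l2_nth_ops intro!: l2_eqI)
  have add: "l2_nth (x + y) = (\<lambda>n. l2_nth x n + l2_nth y n)" by (rule ext) (simp add: l2_nth_ops)
  have "(norm (x + y))\<^sup>2 \<le> (norm x + norm y)\<^sup>2"
  proof -
    have "complex_of_real ((norm (x + y))\<^sup>2) = ell2_inner (l2_nth (x + y)) (l2_nth (x + y))"
      by (simp add: norm_l2seq_def ell2_inner_self)
    also have "\<dots> = ell2_inner (l2_nth x) (l2_nth (x + y)) + ell2_inner (l2_nth y) (l2_nth (x + y))"
      by (subst add) (simp add: ell2_inner_add_left)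
    finally have "(norm (x + y))\<^sup>2 = Re (ell2_inner (l2_nth x) (l2_nth (x + y))) + Re (ell2_inner (l2_nth y) (l2_nth (x + y)))"
      by (metis Re_complex_of_real plus_complex.sel(1))
    also have "\<dots> \<le> norm x * norm (x + y) + norm y * norm (x + y)"
      unfolding norm_l2seq_def
      by (intro add_mono order_trans[OF complex_Re_le_cmod] ell2_Cauchy_Schwarz) auto
    finally have "norm (x + y) * norm (x + y) \<le> (norm x + norm y) * norm (x + y)"
      by (simp add: power2_eq_square algebra_simps)
    moreover have "0 \<le> norm (x + y)" "0 \<le> norm x + norm y"
      by (simp_all add: norm_l2seq_def ell2_norm_nonneg)
    ultimately have "norm (x + y) \<le> norm x + norm y"
      by (metis mult_right_le_imp_le order_le_less)
    then show ?thesis using \<open>0 \<le> norm (x + y)\<close> by (rule power_mono)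
  qed
  then show "norm (x + y) \<le> norm x + norm y"
    by (rule power2_le_imp_le) (simp add: norm_l2seq_def ell2_norm_nonneg)
  have "(\<Sum>n. (norm (a *\<^sub>R l2_nth x n))\<^sup>2) = a\<^sup>2 * (\<Sum>n. (norm (l2_nth x n))\<^sup>2)"
    using l2_nth_ell2[of x] unfolding ell2_iff by (simp add: power_mult_distrib suminf_mult)
  then show "norm (a *\<^sub>R x) = \<bar>a\<bar> * norm x"
    by (simp add: norm_l2seq_def ell2_norm_def scaleR_l2seq_def l2_nth_ops scaleR_scaleC[symmetric] real_sqrt_mult)
qed
end

lemma norm_l2_sq: "(norm x)\<^sup>2 = (\<Sum>n. (norm (l2_nth x n))\<^sup>2)"
  by (simp add: norm_l2seq_def ell2_norm_sq)

lemma norm_l2_nth_le: "norm (l2_nth x n) \<le> norm x"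
proof (rule power2_le_imp_le)
  show "(norm (l2_nth x n))\<^sup>2 \<le> (norm x)\<^sup>2"
    unfolding norm_l2_sq
    using l2_nth_ell2[of x] sum_le_suminf[of "\<lambda>n. (norm (l2_nth x n))\<^sup>2" "{n}"] by (simp add: ell2_iff)
qed simp

lemma norm_l2_le:
  assumes "\<And>N. (\<Sum>n<N. (norm (l2_nth x n))\<^sup>2) \<le> e\<^sup>2" "0 \<le> e" shows "norm x \<le> e"
proof (rule power2_le_imp_le)
  show "(norm x)\<^sup>2 \<le> e\<^sup>2" unfolding norm_l2_sq
    using l2_nth_ell2[of x] assms(1) by (intro suminf_le_const) (auto simp: ell2_iff)
qed fact

instance l2seq :: (complex_hilbert) banach
proof
  fix X :: "nat \<Rightarrow> 'a l2seq" assume X: "Cauchy X"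
  have "Cauchy (\<lambda>m. l2_nth (X m) n)" for n
  proof (rule CauchyI)
    fix e :: real assume "0 < e"
    then obtain M where "\<forall>m\<ge>M. \<forall>k\<ge>M. norm (X m - X k) < e" using CauchyD[OF X] by blast
    moreover have "norm (l2_nth (X m) n - l2_nth (X k) n) \<le> norm (X m - X k)" for m k
      using norm_l2_nth_le[of "X m - X k" n] by (simp add: l2_nth_ops)
    ultimately show "\<exists>M. \<forall>m\<ge>M. \<forall>k\<ge>M. norm (l2_nth (X m) n - l2_nth (X k) n) < e"
      by (meson le_less_trans)
  qed
  then have "\<forall>n. \<exists>l. (\<lambda>m. l2_nth (X m) n) \<longlonglongrightarrow> l" using Cauchy_convergent convergent_def by blast
  then obtain x where x: "\<And>n. (\<lambda>m. l2_nth (X m) n) \<longlonglongrightarrow> x n" by metis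
  \<comment> \<open>Only finite partial sums pass to the coordinatewise limit. The bound uniform in
    \<open>N\<close> then yields both membership of \<open>x\<close> in \<open>ell2\<close> and
    convergence in norm.\<close>
  have fin: "\<exists>M. \<forall>m\<ge>M. \<forall>N. (\<Sum>n<N. (norm (l2_nth (X m) n - x n))\<^sup>2) \<le> e\<^sup>2" if e: "0 < e" for e :: real
  proof -
    obtain M where M: "\<And>m k. m \<ge> M \<Longrightarrow> k \<ge> M \<Longrightarrow> norm (X m - X k) < e" using CauchyD[OF X e] by blast
    have "(\<Sum>n<N. (norm (l2_nth (X m) n - x n))\<^sup>2) \<le> e\<^sup>2" if m: "m \<ge> M" for m N
    proof (rule LIMSEQ_le_const2)
      show "(\<lambda>k. \<Sum>n<N. (norm (l2_nth (X m) n - l2_nth (X k) n))\<^sup>2) \<longlonglongrightarrow> (\<Sum>n<N. (norm (l2_nth (X m) n - x n))\<^sup>2)"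
        by (intro tendsto_intros x)
      have "(\<Sum>n<N. (norm (l2_nth (X m) n - l2_nth (X k) n))\<^sup>2) \<le> e\<^sup>2" if k: "k \<ge> M" for k
      proof -
        have "(\<Sum>n<N. (norm (l2_nth (X m - X k) n))\<^sup>2) \<le> (norm (X m - X k))\<^sup>2"
          unfolding norm_l2_sq
          using l2_nth_ell2[of "X m - X k"] by (intro sum_le_suminf) (auto simp: ell2_iff)
        also have "\<dots> \<le> e\<^sup>2" using M[OF m k] by (intro power_mono) auto
        finally show ?thesis by (simp add: l2_nth_ops)
      qed
      then show "\<exists>K. \<forall>k\<ge>K. (\<Sum>n<N. (norm (l2_nth (X m) n - l2_nth (X k) n))\<^sup>2) \<le> e\<^sup>2" by blast
    qed
    then show ?thesis by blast
  qed
  have "x \<in> ell2"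
  proof -
    obtain M where M: "\<And>N. (\<Sum>n<N. (norm (l2_nth (X M) n - x n))\<^sup>2) \<le> 1" using fin[of 1] by auto
    have "(\<lambda>n. l2_nth (X M) n - x n) \<in> ell2" unfolding ell2_iff
      by (rule summableI_nonneg_bounded[of _ 1]) (use M in auto)
    from ell2_add[OF l2_nth_ell2[of "X M"] ell2_scaleC[OF this, of "-1"]]
    show ?thesis by (simp add: scaleC_minus_one)
  qed
  then have nx: "l2_nth (Abs_l2 x) = x" by (rule Abs_l2_inverse)
  have "X \<longlonglongrightarrow> Abs_l2 x"
  proof (rule LIMSEQ_I)
    fix r :: real assume r: "0 < r"
    then obtain M where M: "\<And>m N. m \<ge> M \<Longrightarrow> (\<Sum>n<N. (norm (l2_nth (X m) n - x n))\<^sup>2) \<le> (r/2)\<^sup>2"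
      using fin[of "r/2"] by auto
    have "norm (X m - Abs_l2 x) < r" if "m \<ge> M" for m
    proof -
      have "norm (X m - Abs_l2 x) \<le> r/2"
        by (rule norm_l2_le) (use M[OF that] r in \<open>auto simp: l2_nth_ops nx\<close>)
      then show ?thesis using r by simp
    qed
    then show "\<exists>M. \<forall>m\<ge>M. norm (X m - Abs_l2 x) < r" by blast
  qed
  then show "convergent X" by (auto simp: convergent_def)
qed

instantiation l2seq :: (complex_hilbert) complex_hilbert
begin
definition "cinner (x :: 'a l2seq) y = ell2_inner (l2_nth x) (l2_nth y)"

instance
proof
  fix x y z :: "'a l2seq" and r :: real and c :: complex
  show "r *\<^sub>R x = complex_of_real r *\<^sub>C x" by (rule scaleR_l2seq_def)
  show "cinner x y = cnj (cinner y x)" by (simp add: cinner_l2seq_def ell2_inner_commute[symmetric])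
  have "l2_nth (x + y) = (\<lambda>n. l2_nth x n + l2_nth y n)" "l2_nth (c *\<^sub>C x) = (\<lambda>n. c *\<^sub>C l2_nth x n)"
    by (rule ext, simp add: l2_nth_ops)+
  then show "cinner (x + y) z = cinner x z + cinner y z" "cinner (c *\<^sub>C x) y = c * cinner x y"
    by (simp_all add: cinner_l2seq_def ell2_inner_add_left ell2_inner_scaleC_left)
  have s: "cinner x x = of_real ((norm x)\<^sup>2)" by (simp add: cinner_l2seq_def ell2_inner_self norm_l2seq_def)
  show "0 \<le> Re (cinner x x)" "cinner x x = 0 \<longleftrightarrow> x = 0" "norm x = sqrt (Re (cinner x x))"
    by (simp_all add: s del: of_real_power)
qed
end

text \<open>The direct sum receives \<open>A \<mapsto> (A h, adj A k)\<close> when functionals for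
  the strong-star topologies are represented.\<close>

instantiation prod :: (complex_hilbert, complex_hilbert) complex_hilbert
begin
definition "c *\<^sub>C (x :: 'a \<times> 'b) = (c *\<^sub>C fst x, c *\<^sub>C snd x)"
definition "cinner (x :: 'a \<times> 'b) y = cinner (fst x) (fst y) + cinner (snd x) (snd y)"

instance
proof
  fix x y z :: "'a \<times> 'b" and r :: real and c d :: complex
  show "c *\<^sub>C (x + y) = c *\<^sub>C x + c *\<^sub>C y" "(c + d) *\<^sub>C x = c *\<^sub>C x + d *\<^sub>C x"
    "c *\<^sub>C d *\<^sub>C x = (c * d) *\<^sub>C x" "1 *\<^sub>C x = x" "r *\<^sub>R x = complex_of_real r *\<^sub>C x"
    by (simp_all add: scaleC_prod_def scaleC_add_right scaleC_add_left scaleC_scaleC scaleC_one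
        scaleR_prod_def scaleR_scaleC)
  show "cinner x y = cnj (cinner y x)"
    unfolding cinner_prod_def complex_cnj_add by (metis cinner_commute)
  show "cinner (x + y) z = cinner x z + cinner y z" "cinner (c *\<^sub>C x) y = c * cinner x y"
    by (simp_all add: cinner_prod_def scaleC_prod_def cinner_linear algebra_simps)
  have s: "cinner x x = of_real ((norm x)\<^sup>2)"
    by (simp add: cinner_prod_def cinner_self norm_prod_def)
  show "0 \<le> Re (cinner x x)" "cinner x x = 0 \<longleftrightarrow> x = 0" "norm x = sqrt (Re (cinner x x))"
    by (simp_all add: s del: of_real_power)
qed
end

text \<open>The amplification \<open>A \<otimes> 1\<close>.\<close>

definition ampl :: "('a::complex_hilbert \<Rightarrow>\<^sub>L 'b::complex_hilbert) \<Rightarrow> 'a l2seq \<Rightarrow> 'b l2seq" where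
  "ampl A x = Abs_l2 (\<lambda>n. blinfun_apply A (l2_nth x n))"

lemma l2_nth_ampl [simp]: "l2_nth (ampl A x) = (\<lambda>n. blinfun_apply A (l2_nth x n))"
  by (simp add: ampl_def Abs_l2_inverse ell2_blinfun)

lemma ampl_add_left: "ampl (A + B) x = ampl A x + ampl B x"
  by (rule l2_eqI) (simp add: l2_nth_ops blinfun.add_left)

lemma ampl_diff_left: "ampl (A - B) x = ampl A x - ampl B x"
  by (rule l2_eqI) (simp add: l2_nth_ops blinfun.diff_left)

lemma ampl_scaleC_left: "ampl (c *\<^sub>C A) x = c *\<^sub>C ampl A x"
  by (rule l2_eqI) (simp add: l2_nth_ops scaleC_blinfun_apply)

lemma ampl_scaleR_left: "ampl (r *\<^sub>R A) x = r *\<^sub>R ampl A x"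
  by (simp add: scaleR_blinfun_scaleC scaleR_l2seq_def ampl_scaleC_left)

lemma ampl_comp: "ampl (A o\<^sub>L C) z = ampl A (ampl C z)"
  by (rule l2_eqI) simp

lemma ampl_id [simp]: "ampl id_blinfun w = w"
  by (rule l2_eqI) simp

lemma ampl_add_right: "ampl A (x + y) = ampl A x + ampl A y"
  by (rule l2_eqI) (simp add: l2_nth_ops blinfun.add_right)

lemma l2_nth_scaleR: "l2_nth (r *\<^sub>R x) n = r *\<^sub>R l2_nth x n"
  unfolding scaleR_l2seq_def l2_nth_ops scaleR_scaleC ..

lemma ampl_scaleR_right: "ampl A (r *\<^sub>R x) = r *\<^sub>R ampl A x"
  by (rule l2_eqI) (simp add: l2_nth_scaleR blinfun.scaleR_right)

lemma norm_ampl_le: "norm (ampl A x) \<le> norm A * norm x"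
proof (rule norm_l2_le)
  fix N
  have "(\<Sum>n<N. (norm (l2_nth (ampl A x) n))\<^sup>2) \<le> (\<Sum>n<N. (norm A)\<^sup>2 * (norm (l2_nth x n))\<^sup>2)"
    by (intro sum_mono) (simp add: power_mult_distrib[symmetric] power_mono norm_blinfun)
  also have "\<dots> = (norm A)\<^sup>2 * (\<Sum>n<N. (norm (l2_nth x n))\<^sup>2)" by (simp add: sum_distrib_left)
  also have "\<dots> \<le> (norm A)\<^sup>2 * (norm x)\<^sup>2"
    unfolding norm_l2_sq using l2_nth_ell2[of x]
    by (intro mult_left_mono sum_le_suminf) (auto simp: ell2_iff)
  finally show "(\<Sum>n<N. (norm (l2_nth (ampl A x) n))\<^sup>2) \<le> (norm A * norm x)\<^sup>2"
    by (simp add: power_mult_distrib)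
qed simp

lemma cinner_ampl_adj: "A \<in> bops \<Longrightarrow> cinner (ampl A x) y = cinner x (ampl (adj A) y)"
  by (simp add: cinner_l2seq_def ell2_inner_def cinner_adj_right)

lemma ell2_inner_ampl:
  "h \<in> ell2 \<Longrightarrow> k \<in> ell2 \<Longrightarrow> ell2_inner (\<lambda>n. blinfun_apply A (h n)) k = cinner (ampl A (Abs_l2 h)) (Abs_l2 k)"
  by (simp add: cinner_l2seq_def Abs_l2_inverse)

text \<open>Interleaving two sequences realizes \<open>\<ell>\<^sup>2 \<oplus> \<ell>\<^sup>2 \<cong> \<ell>\<^sup>2\<close>.\<close>

definition interleave :: "'a l2seq \<Rightarrow> 'a l2seq \<Rightarrow> 'a::complex_hilbert l2seq" where
  "interleave x y = Abs_l2 (\<lambda>n. if even n then l2_nth x (n div 2) else l2_nth y ((n - 1) div 2))"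

lemma l2_nth_interleave:
  "l2_nth (interleave x y) = (\<lambda>n. if even n then l2_nth x (n div 2) else l2_nth y ((n - 1) div 2))"
proof -
  have "(\<lambda>n. if even n then (norm (l2_nth x (n div 2)))\<^sup>2 else (norm (l2_nth y ((n - 1) div 2)))\<^sup>2)
     sums ((norm y)\<^sup>2 + (norm x)\<^sup>2)"
    unfolding norm_l2_sq
    by (intro sums_if summable_sums) (use l2_nth_ell2 in \<open>auto simp: ell2_iff\<close>)
  then have "summable (\<lambda>n. (norm (if even n then l2_nth x (n div 2) else l2_nth y ((n - 1) div 2)))\<^sup>2)"
    by (simp add: sums_iff if_distrib[of norm] if_distrib[of "\<lambda>x. x\<^sup>2"] cong: if_cong)
  then show ?thesis unfolding interleave_def by (intro Abs_l2_inverse) (simp add: ell2_iff)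
qed

lemma sums_if_complex:
  fixes f g :: "nat \<Rightarrow> complex"
  assumes "g sums x" "f sums y"
  shows "(\<lambda>n. if even n then f (n div 2) else g ((n - 1) div 2)) sums (x + y)"
proof -
  have "(\<lambda>n. if even n then Re (f (n div 2)) else Re (g ((n - 1) div 2))) sums (Re x + Re y)"
       "(\<lambda>n. if even n then Im (f (n div 2)) else Im (g ((n - 1) div 2))) sums (Im x + Im y)"
    by (rule sums_if; use assms in \<open>simp add: sums_complex_iff\<close>)+
  then show ?thesis by (simp add: sums_complex_iff if_distrib cong: if_cong)
qed

text \<open>Together with \<open>ampl_interleave\<close> this merges a sum of two coefficients into
  one, which is why one pair of vectors suffices for a functional.\<close>

lemma cinner_interleave: "cinner (interleave x y) (interleave x' y') = cinner x x' + cinner y y'"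
proof -
  have "(\<lambda>n. if even n then cinner (l2_nth x (n div 2)) (l2_nth x' (n div 2))
      else cinner (l2_nth y ((n - 1) div 2)) (l2_nth y' ((n - 1) div 2))) sums (cinner y y' + cinner x x')"
    unfolding cinner_l2seq_def ell2_inner_def
    using sums_if_complex[OF summable_sums[OF ell2_cinner_summable(2)[OF l2_nth_ell2[of y] l2_nth_ell2[of y']]]
        summable_sums[OF ell2_cinner_summable(2)[OF l2_nth_ell2[of x] l2_nth_ell2[of x']]]] by simp
  moreover have "cinner (l2_nth (interleave x y) n) (l2_nth (interleave x' y') n) =
     (if even n then cinner (l2_nth x (n div 2)) (l2_nth x' (n div 2))
      else cinner (l2_nth y ((n - 1) div 2)) (l2_nth y' ((n - 1) div 2)))" for n
    by (simp add: l2_nth_interleave)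
  ultimately show ?thesis
    unfolding cinner_l2seq_def[of "interleave x y"] ell2_inner_def by (simp add: sums_iff add.commute)
qed

lemma norm_interleave_sq: "(norm (interleave x y))\<^sup>2 = (norm x)\<^sup>2 + (norm y)\<^sup>2"
  using cinner_interleave[of x y x y] by (simp add: Re_cinner_self[symmetric])

lemma ampl_interleave: "ampl A (interleave x y) = interleave (ampl A x) (ampl A y)"
  by (rule l2_eqI) (simp add: l2_nth_interleave)

section \<open>Topologies generated by seminorms\<close>

text \<open>The laws are demanded on \<open>bops\<close> only, since \<open>adj\<close> is
  controlled only there. Nonemptiness makes the subbasic sets cover \<open>bops\<close>.\<close>

definition seminorms_on_bops ::
  "(('a::complex_hilbert \<Rightarrow>\<^sub>L 'b::complex_hilbert) \<Rightarrow> real) set \<Rightarrow> bool" where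
  "seminorms_on_bops P \<longleftrightarrow> P \<noteq> {} \<and> (\<forall>p\<in>P. (\<forall>A\<in>bops. \<forall>B\<in>bops. p (A + B) \<le> p A + p B) \<and>
     (\<forall>c. \<forall>A\<in>bops. p (c *\<^sub>C A) = cmod c * p A) \<and> (\<forall>A\<in>bops. 0 \<le> p A))"

lemma seminorms_on_bopsD:
  assumes "seminorms_on_bops P" "p \<in> P" "A \<in> bops"
  shows "B \<in> bops \<Longrightarrow> p (A + B) \<le> p A + p B" "p (c *\<^sub>C A) = cmod c * p A" "0 \<le> p A" "p 0 = 0"
proof -
  show "B \<in> bops \<Longrightarrow> p (A + B) \<le> p A + p B" "p (c *\<^sub>C A) = cmod c * p A" "0 \<le> p A"
    using assms by (auto simp: seminorms_on_bops_def)
  have "p (0 *\<^sub>C A) = cmod 0 * p A" using assms unfolding seminorms_on_bops_def by blast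
  then show "p 0 = 0" by simp
qed

lemma topspace_seminorm_topology:
  assumes "seminorms_on_bops P" shows "topspace (seminorm_topology P) = bops"
proof -
  obtain p where p: "p \<in> P" using assms by (auto simp: seminorms_on_bops_def)
  have "A \<in> \<Union>{{B \<in> bops. p (B - A) < e} |p A e. p \<in> P \<and> A \<in> bops \<and> 0 < e}" if A: "A \<in> bops" for A
  proof
    show "A \<in> {B \<in> bops. p (B - A) < 1}" using seminorms_on_bopsD(4)[OF assms p A] A by simp
    show "{B \<in> bops. p (B - A) < 1} \<in> {{B \<in> bops. p (B - A) < e} |p A e. p \<in> P \<and> A \<in> bops \<and> 0 < e}"
      using p A zero_less_one by blast
  qed
  then show ?thesis unfolding seminorm_topology_def topology_generated_by_topspace by auto
qed

text \<open>A subbasic ball about \<open>C\<close> that contains \<open>A\<close> also contains the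
  ball about \<open>A\<close> of radius \<open>e - p (A - C)\<close>. Finite intersections and
  unions preserve the property, so induction over the generation of the topology applies.\<close>

lemma seminorm_topology_nbhd:
  assumes P: "seminorms_on_bops P" and U: "openin (seminorm_topology P) U" and A: "A \<in> U"
  obtains Q \<delta> where "finite Q" "Q \<subseteq> P" "0 < \<delta>"
    "\<And>B. \<lbrakk>B \<in> bops; \<And>p. p \<in> Q \<Longrightarrow> p (B - A) < \<delta>\<rbrakk> \<Longrightarrow> B \<in> U"
proof -
  have "generate_topology_on {{B \<in> bops. p (B - A) < e} |p A e. p \<in> P \<and> A \<in> bops \<and> 0 < e} U"
    using U unfolding seminorm_topology_def by (rule openin_topology_generated_by)
  then have "\<exists>Q \<delta>. finite Q \<and> Q \<subseteq> P \<and> 0 < \<delta> \<and> (\<forall>B\<in>bops. (\<forall>p\<in>Q. p (B - A) < \<delta>) \<longrightarrow> B \<in> U)"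
    using A
  proof (induction)
    case (Int a b)
    then obtain Q \<delta> Q' \<delta>' where
      "finite Q \<and> Q \<subseteq> P \<and> 0 < \<delta> \<and> (\<forall>B\<in>bops. (\<forall>p\<in>Q. p (B - A) < \<delta>) \<longrightarrow> B \<in> a)"
      "finite Q' \<and> Q' \<subseteq> P \<and> 0 < \<delta>' \<and> (\<forall>B\<in>bops. (\<forall>p\<in>Q'. p (B - A) < \<delta>') \<longrightarrow> B \<in> b)" by blast
    then show ?case by (intro exI[of _ "Q \<union> Q'"] exI[of _ "min \<delta> \<delta>'"]) auto
  next
    case (UN K)
    then obtain k where k: "k \<in> K" "A \<in> k" by blast
    then obtain Q \<delta> where
      "finite Q \<and> Q \<subseteq> P \<and> 0 < \<delta> \<and> (\<forall>B\<in>bops. (\<forall>p\<in>Q. p (B - A) < \<delta>) \<longrightarrow> B \<in> k)" using UN.IH[OF k] by (elim exE)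
    then show ?case using k by (intro exI[of _ Q] exI[of _ \<delta>]) blast
  next
    case (Basis s)
    then obtain p C e where s: "s = {B \<in> bops. p (B - C) < e}" "p \<in> P" "C \<in> bops" "0 < e" by blast
    have "B \<in> s" if B: "B \<in> bops" "p (B - A) < e - p (A - C)" for B
    proof -
      have "p ((B - A) + (A - C)) \<le> p (B - A) + p (A - C)"
        using Basis s B by (intro seminorms_on_bopsD(1)[OF P]) auto
      then show ?thesis using s B by simp
    qed
    moreover have "0 < e - p (A - C)" using Basis s by simp
    ultimately show ?case using s(2) by (intro exI[of _ "{p}"] exI[of _ "e - p (A - C)"]) simp
  qed simp
  then obtain Q \<delta> where *: "finite Q \<and> Q \<subseteq> P \<and> 0 < \<delta> \<and> (\<forall>B\<in>bops. (\<forall>p\<in>Q. p (B - A) < \<delta>) \<longrightarrow> B \<in> U)"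
    by (elim exE)
  show ?thesis by (rule that[of Q \<delta>]) (simp_all add: *)
qed

lemma top_dual_seminorm_bound:
  assumes P: "seminorms_on_bops P" and V: "V \<subseteq> bops" "csubspace V"
    and l: "l \<in> top_dual (subtopology (seminorm_topology P) V)"
  obtains Q C where "finite Q" "Q \<subseteq> P" "0 \<le> C" "\<And>A. A \<in> V \<Longrightarrow> cmod (l A) \<le> C * (\<Sum>p\<in>Q. p A)"
proof -
  let ?W = "subtopology (seminorm_topology P) V"
  have ts: "topspace ?W = V" using topspace_seminorm_topology[OF P] V by auto
  have cl: "clinear_on V l" and cont: "continuous_map ?W euclidean l"
    using l unfolding top_dual_def ts by auto
  have "openin ?W {A \<in> topspace ?W. l A \<in> ball 0 1}"
    by (rule openin_continuous_map_preimage[OF cont]) (simp add: open_openin[symmetric])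
  then obtain U where U: "openin (seminorm_topology P) U" and UV: "{A \<in> V. cmod (l A) < 1} = U \<inter> V"
    unfolding ts openin_subtopology by (auto simp: dist_norm)
  have V0: "0 \<in> V" and Vs: "\<And>c A. A \<in> V \<Longrightarrow> c *\<^sub>C A \<in> V" using V by (auto simp: csubspace_def)
  have ls: "\<And>c A. A \<in> V \<Longrightarrow> l (c *\<^sub>C A) = c * l A" using cl by (auto simp: clinear_on_def)
  have "l 0 = 0" using ls[OF V0, of 0] by simp
  then have "0 \<in> {A \<in> V. cmod (l A) < 1}" using V0 by simp
  then have "0 \<in> U" unfolding UV by blast
  then obtain Q \<delta> where Q: "finite Q" "Q \<subseteq> P" "0 < \<delta>"
    and QU: "\<And>B. \<lbrakk>B \<in> bops; \<And>p. p \<in> Q \<Longrightarrow> p (B - 0) < \<delta>\<rbrakk> \<Longrightarrow> B \<in> U"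
    using seminorm_topology_nbhd[OF P U] by metis
  show ?thesis
  proof (rule that[OF Q(1,2)])
    show "0 \<le> 1/\<delta>" using Q by simp
    fix A assume A: "A \<in> V"
    then have Ab: "A \<in> bops" using V by blast
    let ?s = "\<Sum>p\<in>Q. p A"
    have nn: "0 \<le> p A" if "p \<in> Q" for p using seminorms_on_bopsD(3)[OF P _ Ab] Q that by blast
    then have s0: "0 \<le> ?s" by (intro sum_nonneg) auto
    \<comment> \<open>The sum \<open>?s\<close> may be 0, so \<open>A\<close> is rescaled by
      \<open>\<delta> / r\<close> with \<open>r\<close> above it, and \<open>r\<close> decreases to
      \<open>?s\<close> afterwards.\<close>
    have lt: "cmod (l A) < r / \<delta>" if r: "?s < r" for r
    proof -
      have r0: "r > 0" using s0 r by linarith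
      let ?B = "of_real (\<delta> / r) *\<^sub>C A"
      have "p (?B - 0) < \<delta>" if p: "p \<in> Q" for p
      proof -
        have "p A \<le> ?s" using p Q nn by (intro member_le_sum) auto
        then have "p A < r" using r by linarith
        moreover have "p ?B = \<delta> / r * p A"
          using seminorms_on_bopsD(2)[OF P _ Ab, of p "of_real (\<delta> / r)"] p Q r0 by (auto simp: norm_divide)
        moreover have "\<delta> / r * p A < \<delta> / r * r"
          using \<open>p A < r\<close> r0 Q by (intro mult_strict_left_mono) auto
        ultimately show ?thesis using r0 by simp
      qed
      then have "?B \<in> U" using Ab by (intro QU) auto
      then have "cmod (l ?B) < 1" using UV Vs[OF A] by blast
      moreover have "cmod (l ?B) = \<delta> / r * cmod (l A)"
        using r0 Q by (simp add: ls[OF A] norm_mult norm_divide)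
      ultimately have "\<delta> / r * cmod (l A) < 1" by simp
      then show ?thesis using r0 Q by (simp add: field_simps)
    qed
    have "\<delta> * cmod (l A) \<le> ?s"
    proof (rule dense_ge)
      fix r assume "?s < r"
      from lt[OF this] show "\<delta> * cmod (l A) \<le> r" using Q by (simp add: field_simps)
    qed
    then show "cmod (l A) \<le> 1/\<delta> * ?s" using Q by (simp add: field_simps)
  qed
qed

lemma top_dual_seminormI:
  assumes P: "seminorms_on_bops P" and V: "V \<subseteq> bops" "csubspace V" and p: "p \<in> P"
    and l: "clinear_on V l" and bound: "\<And>A. A \<in> V \<Longrightarrow> cmod (l A) \<le> C * p A"
  shows "(\<lambda>A. if A \<in> V then l A else 0) \<in> top_dual (subtopology (seminorm_topology P) V)"
proof -
  let ?W = "subtopology (seminorm_topology P) V"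
  let ?l = "\<lambda>A. if A \<in> V then l A else 0"
  have ts: "topspace ?W = V" using topspace_seminorm_topology[OF P] V by auto
  have "clinear_on V ?l" using l V(2) by (auto simp: clinear_on_def csubspace_def)
  moreover have "continuous_map ?W euclidean ?l"
    unfolding continuous_map
  proof (intro conjI allI impI)
    fix U :: "complex set" assume "openin euclidean U"
    then have U: "open U" by simp
    show "openin ?W {x \<in> topspace ?W. ?l x \<in> U}"
    proof (subst openin_subopen, intro ballI)
      fix A assume "A \<in> {x \<in> topspace ?W. ?l x \<in> U}"
      then have A: "A \<in> V" "l A \<in> U" by (auto simp: ts)
      then have Ab: "A \<in> bops" using V by blast
      obtain e where e: "0 < e" "ball (l A) e \<subseteq> U" using U A openE by blast
      define d where "d = e / (\<bar>C\<bar> + 1)"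
      have d: "d > 0" using e by (simp add: d_def)
      let ?T = "{B \<in> bops. p (B - A) < d} \<inter> V"
      have "openin (seminorm_topology P) {B \<in> bops. p (B - A) < d}"
        unfolding seminorm_topology_def using p Ab d by (intro topology_generated_by_Basis) blast
      then have "openin ?W ?T" by (auto simp: openin_subtopology)
      moreover have "A \<in> ?T" using A Ab d seminorms_on_bopsD(4)[OF P p Ab] by simp
      moreover have "l B \<in> U" if B: "B \<in> bops" "p (B - A) < d" "B \<in> V" for B
      proof -
        have m: "(-1) *\<^sub>C A \<in> V" using V A by (auto simp: csubspace_def)
        have BA: "B - A = B + (-1) *\<^sub>C A" by (simp add: scaleC_minus_one)
        have BV: "B - A \<in> V" unfolding BA using V B m by (auto simp: csubspace_def)
        have "l (B - A) = l B + (-1) * l A" unfolding BA using l B m A by (simp only: clinear_on_def)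
        then have "dist (l A) (l B) = cmod (l (B - A))" by (simp add: dist_norm norm_minus_commute)
        also have "\<dots> \<le> C * p (B - A)" using bound BV by blast
        also have "\<dots> \<le> (\<bar>C\<bar> + 1) * p (B - A)"
          using seminorms_on_bopsD(3)[OF P p, of "B - A"] B Ab by (intro mult_right_mono) auto
        also have "\<dots> < (\<bar>C\<bar> + 1) * d" using B by (intro mult_strict_left_mono) auto
        also have "\<dots> = e" by (simp add: d_def)
        finally show ?thesis using e by auto
      qed
      ultimately show "\<exists>T. openin ?W T \<and> A \<in> T \<and> T \<subseteq> {x \<in> topspace ?W. ?l x \<in> U}"
        unfolding ts by (intro exI[of _ ?T]) auto
    qed
  qed simp
  ultimately show ?thesis unfolding top_dual_def ts by auto
qed

section \<open>The duals of the operator topologies\<close>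

text \<open>The embedding as coordinate 0. Through it every ordinary seminorm is one of the
  \<open>\<sigma>\<close>-seminorms, and coefficients of \<open>A\<close> are coefficients of its
  amplification.\<close>

definition single_l2 :: "'a \<Rightarrow> 'a::complex_hilbert l2seq" where
  "single_l2 h = Abs_l2 (\<lambda>n. if n = 0 then h else 0)"

lemma l2_nth_single: "l2_nth (single_l2 h) = (\<lambda>n. if n = 0 then h else 0)"
  unfolding single_l2_def
proof (rule Abs_l2_inverse)
  have "summable (\<lambda>n. if n \<in> {0} then (norm h)\<^sup>2 else 0)" by (rule summable_If_finite_set) simp
  then show "(\<lambda>n::nat. if n = 0 then h else 0) \<in> ell2"
    by (simp add: ell2_iff if_distrib[of norm] if_distrib[of "\<lambda>x. x\<^sup>2"] cong: if_cong)
qed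

lemma cinner_single: "cinner (single_l2 h) (single_l2 k) = cinner h k"
proof -
  have "cinner (single_l2 h) (single_l2 k) = (\<Sum>n. if n = 0 then cinner h k else 0)"
    unfolding cinner_l2seq_def ell2_inner_def l2_nth_single by (rule arg_cong[where f = suminf]) auto
  then show ?thesis using suminf_finite[of "{0}" "\<lambda>n::nat. if n = 0 then cinner h k else 0"] by simp
qed

lemma norm_single: "norm (single_l2 h) = norm h"
  by (simp add: norm_eq_sqrt_cinner cinner_single)

lemma ampl_single: "ampl A (single_l2 h) = single_l2 (blinfun_apply A h)"
  by (rule l2_eqI) (simp add: l2_nth_single)

lemma ell2_norm_ampl: "h \<in> ell2 \<Longrightarrow> ell2_norm (\<lambda>n. blinfun_apply A (h n)) = norm (ampl A (Abs_l2 h))"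
  by (simp add: norm_l2seq_def Abs_l2_inverse)

lemma sigma_op_seminorms_ampl:
  "sigma_op_seminorms WOT = {\<lambda>A. cmod (cinner (ampl A h) k) |h k. True}"
  "sigma_op_seminorms SOT = {\<lambda>A. norm (ampl A h) |h. True}"
  "sigma_op_seminorms SstarOT = {\<lambda>A. norm (ampl A h) + norm (ampl (adj A) k) |h k. True}"
  unfolding sigma_op_seminorms.simps
proof (safe, goal_cases)
  case (1 _ h k) then show ?case by (intro exI[of _ "Abs_l2 h"] exI[of _ "Abs_l2 k"]) (simp add: ell2_inner_ampl)
next
  case (2 _ h k) then show ?case
    by (intro exI[of _ "l2_nth h"] exI[of _ "l2_nth k"]) (simp add: cinner_l2seq_def)
next
  case (3 _ h) then show ?case by (intro exI[of _ "Abs_l2 h"]) (simp add: ell2_norm_ampl)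
next
  case (4 _ h) then show ?case by (intro exI[of _ "l2_nth h"]) (simp add: norm_l2seq_def)
next
  case (5 _ h k) then show ?case by (intro exI[of _ "Abs_l2 h"] exI[of _ "Abs_l2 k"]) (simp add: ell2_norm_ampl)
next
  case (6 _ h k) then show ?case
    by (intro exI[of _ "l2_nth h"] exI[of _ "l2_nth k"]) (simp add: norm_l2seq_def)
qed

lemma op_seminorms_ampl:
  "op_seminorms WOT = {\<lambda>A. cmod (cinner (ampl A (single_l2 h)) (single_l2 k)) |h k. True}"
  "op_seminorms SOT = {\<lambda>A. norm (ampl A (single_l2 h)) |h. True}"
  "op_seminorms SstarOT = {\<lambda>A. norm (ampl A (single_l2 h)) + norm (ampl (adj A) (single_l2 k)) |h k. True}"
  by (simp_all add: ampl_single cinner_single norm_single)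

lemma op_seminorms_subset: "op_seminorms \<T> \<subseteq> sigma_op_seminorms \<T>"
  by (cases \<T>) (simp_all only: op_seminorms_ampl sigma_op_seminorms_ampl, blast+)

lemma seminorms_sigma_op: "seminorms_on_bops (sigma_op_seminorms \<T>)"
proof (cases \<T>)
  case WOT
  then show ?thesis unfolding WOT sigma_op_seminorms_ampl seminorms_on_bops_def
    by (auto simp: ampl_add_left cinner_linear ampl_scaleC_left norm_mult norm_triangle_ineq)
next
  case SOT
  then show ?thesis unfolding SOT sigma_op_seminorms_ampl seminorms_on_bops_def
    by (auto simp: ampl_add_left ampl_scaleC_left norm_scaleC norm_triangle_ineq)
next
  case SstarOT
  have 1: "norm (a + b) + norm (c + d) \<le> norm a + norm c + (norm b + norm d)"
    for a b :: "'b l2seq" and c d :: "'a l2seq"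
    using norm_triangle_ineq[of a b] norm_triangle_ineq[of c d] by linarith
  show ?thesis unfolding SstarOT sigma_op_seminorms_ampl seminorms_on_bops_def
    by (auto simp: ampl_add_left ampl_scaleC_left norm_scaleC adj_add adj_scaleC distrib_left 1)
qed

lemma seminorms_op: "seminorms_on_bops (op_seminorms \<T>)"
proof -
  have "op_seminorms \<T> \<noteq> {}" by (cases \<T>) (auto simp: op_seminorms_ampl)
  then show ?thesis using seminorms_sigma_op[of \<T>] op_seminorms_subset[of \<T>]
    unfolding seminorms_on_bops_def by blast
qed

lemma topspace_op_topology: "V \<subseteq> bops \<Longrightarrow> topspace (op_topology \<T> V) = V"
  by (auto simp: op_topology_def topspace_seminorm_topology seminorms_op)

lemma topspace_sigma_op_topology: "V \<subseteq> bops \<Longrightarrow> topspace (sigma_op_topology \<T> V) = V"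
  by (auto simp: sigma_op_topology_def topspace_seminorm_topology seminorms_sigma_op)

lemma norm_interleave_ge: "norm x \<le> norm (interleave x y)" "norm y \<le> norm (interleave x y)"
  by (rule power2_le_imp_le; simp add: norm_interleave_sq)+

text \<open>Below, \<open>S\<close> is either everything or the finitely supported sequences; in both cases a finite sum of
  seminorms of the topology is dominated by a single one of strong-star type.\<close>

definition dominated :: "('a::complex_hilbert l2seq \<Rightarrow> bool) \<Rightarrow> ('b::complex_hilbert l2seq \<Rightarrow> bool) \<Rightarrow>
    (('a \<Rightarrow>\<^sub>L 'b) \<Rightarrow> real) \<Rightarrow> bool" where
  "dominated S S' p \<longleftrightarrow> (\<exists>h k C. S h \<and> S' k \<and> 0 \<le> C \<and>
     (\<forall>A\<in>bops. p A \<le> C * (norm (ampl A h) + norm (ampl (adj A) k))))"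

text \<open>An interleaved vector is at least as long as each of its components, also after
  amplification, so the two bounds share one pair of vectors and the constants add.\<close>

lemma dominated_sum:
  assumes "finite Q" and "\<And>p. p \<in> Q \<Longrightarrow> dominated S S' p"
    and "\<And>x y. S x \<Longrightarrow> S y \<Longrightarrow> S (interleave x y)" "\<And>x y. S' x \<Longrightarrow> S' y \<Longrightarrow> S' (interleave x y)"
    and "S 0" "S' 0"
  shows "dominated S S' (\<lambda>A. \<Sum>p\<in>Q. p A)"
  using assms(1,2)
proof (induction)
  case empty
  show ?case using assms(5,6) by (auto simp: dominated_def intro!: exI[of _ 0] )
next
  case (insert p Q)
  obtain h k C where 1: "S h" "S' k" "0 \<le> C"
    "\<And>A. A \<in> bops \<Longrightarrow> p A \<le> C * (norm (ampl A h) + norm (ampl (adj A) k))"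
    using insert.prems[of p] by (auto simp: dominated_def)
  have "dominated S S' (\<lambda>A. \<Sum>p\<in>Q. p A)" using insert by auto
  then obtain h' k' C' where 2: "S h'" "S' k'" "0 \<le> C'"
    "\<And>A. A \<in> bops \<Longrightarrow> (\<Sum>p\<in>Q. p A) \<le> C' * (norm (ampl A h') + norm (ampl (adj A) k'))"
    by (auto simp: dominated_def)
  have "(\<Sum>p\<in>insert p Q. p A) \<le> (C + C') * (norm (ampl A (interleave h h')) + norm (ampl (adj A) (interleave k k')))"
    if A: "A \<in> bops" for A
  proof -
    have "p A \<le> C * (norm (ampl A (interleave h h')) + norm (ampl (adj A) (interleave k k')))"
      using 1(4)[OF A] mult_left_mono[OF add_mono[OF norm_interleave_ge(1) norm_interleave_ge(1)] 1(3)]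
      unfolding ampl_interleave by (rule order_trans)
    moreover have "(\<Sum>p\<in>Q. p A) \<le> C' * (norm (ampl A (interleave h h')) + norm (ampl (adj A) (interleave k k')))"
      using 2(4)[OF A] mult_left_mono[OF add_mono[OF norm_interleave_ge(2) norm_interleave_ge(2)] 2(3)]
      unfolding ampl_interleave by (rule order_trans)
    ultimately show ?thesis using insert.hyps by (simp add: distrib_right)
  qed
  then show ?case unfolding dominated_def using 1 2 assms(3,4) by (meson add_nonneg_nonneg)
qed

lemma dominated_ampl_seminorms:
  assumes "S h" "S' k" "S 0" "S' 0"
  shows "dominated S S' (\<lambda>A. cmod (cinner (ampl A h) g))"
    "dominated S S' (\<lambda>A. norm (ampl A h))" "dominated S S' (\<lambda>A. norm (ampl A h) + norm (ampl (adj A) k))"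
proof -
  have *: "ampl A 0 = 0" for A :: "'e::complex_hilbert \<Rightarrow>\<^sub>L 'f::complex_hilbert" by (rule l2_eqI) (simp add: l2_nth_ops)
  have "cmod (cinner (ampl A h) g) \<le> norm g * (norm (ampl A h) + norm (ampl (adj A) 0))" for A
    using norm_cinner_le[of "ampl A h" g] by (simp add: * mult.commute)
  then show "dominated S S' (\<lambda>A. cmod (cinner (ampl A h) g))"
    unfolding dominated_def using assms norm_ge_zero by blast
  show "dominated S S' (\<lambda>A. norm (ampl A h))"
    unfolding dominated_def using assms by (intro exI[of _ h] exI[of _ 0] exI[of _ 1]) simp
  show "dominated S S' (\<lambda>A. norm (ampl A h) + norm (ampl (adj A) k))"
    unfolding dominated_def using assms by (intro exI[of _ h] exI[of _ k] exI[of _ 1]) simp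
qed

text \<open>The map \<open>A \<mapsto> (ampl A h, ampl (adj A) k)\<close> is only real-linear,
  because \<open>adj\<close> conjugates scalars; hence the real Riesz theorem, applied to
  \<open>Re l\<close>. In the resulting formula the adjoint moves to the other side: up to a
  conjugation that the real part does not see, the second term is a coefficient of \<open>A\<close>
  itself. Two complex-linear functionals with equal real parts agree.\<close>

lemma dominated_functional_rep:
  assumes V: "V \<subseteq> bops" "csubspace V" and l: "clinear_on V l" and C: "0 \<le> C"
    and bound: "\<And>A. A \<in> V \<Longrightarrow> cmod (l A) \<le> C * (norm (ampl A h) + norm (ampl (adj A) k))"
  obtains g g' where "\<And>A. A \<in> V \<Longrightarrow> l A = cinner (ampl A h) g + cinner (ampl A g') k"
proof -
  define L where "L A = (ampl A h, ampl (adj A) k)" for A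
  have Vb: "A \<in> V \<Longrightarrow> A \<in> bops" for A using V by blast
  obtain r where r: "\<And>A. A \<in> V \<Longrightarrow> Re (l A) = Re (cinner (L A) r)"
  proof (rule Riesz_real[OF V(2), of L "\<lambda>A. Re (l A)" "2 * C"])
    show "L (A + B) = L A + L B" if "A \<in> V" "B \<in> V" for A B
      using that by (simp add: L_def ampl_add_left adj_add Vb)
    show "L (of_real t *\<^sub>C A) = t *\<^sub>R L A" if "A \<in> V" for t A
      using that by (simp add: L_def ampl_scaleC_left adj_scaleC Vb scaleR_prod_def scaleR_scaleC)
    show "Re (l (A + B)) = Re (l A) + Re (l B)" if "A \<in> V" "B \<in> V" for A B
      using l that by (simp add: clinear_on_def)
    show "Re (l (of_real t *\<^sub>C A)) = t * Re (l A)" if "A \<in> V" for t A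
      using l that by (simp add: clinear_on_def)
    \<comment> \<open>The factor 2 arises because each of the two norms is at most the norm of the
      pair.\<close>
    show "\<bar>Re (l A)\<bar> \<le> 2 * C * norm (L A)" if A: "A \<in> V" for A
    proof -
      have "\<bar>Re (l A)\<bar> \<le> C * (norm (ampl A h) + norm (ampl (adj A) k))"
        using bound[OF A] abs_Re_le_cmod[of "l A"] by linarith
      also have "\<dots> \<le> C * (norm (L A) + norm (L A))"
        using norm_fst_le[of "ampl A h" "ampl (adj A) k"] norm_snd_le[of "ampl (adj A) k" "ampl A h"]
        by (intro mult_left_mono add_mono C) (auto simp: L_def)
      finally show ?thesis by simp
    qed
  qed (use C in auto)
  define \<phi> where "\<phi> A = cinner (ampl A h) (fst r) + cinner (ampl A (snd r)) k" for A
  have Re_eq: "Re (l A) = Re (\<phi> A)" if A: "A \<in> V" for A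
  proof -
    have "cinner (ampl (adj A) k) (snd r) = cinner k (ampl A (snd r))"
      using cinner_ampl_adj[of "adj A" k "snd r"] Vb[OF A] by simp
    also have "Re \<dots> = Re (cinner (ampl A (snd r)) k)" by (subst cinner_commute) simp
    finally show ?thesis using r[OF A] by (simp add: L_def cinner_prod_def \<phi>_def)
  qed
  have "l A = \<phi> A" if A: "A \<in> V" for A
  proof -
    have "\<i> *\<^sub>C A \<in> V" using V A by (auto simp: csubspace_def)
    moreover have "l (\<i> *\<^sub>C A) = \<i> * l A" using l A by (simp add: clinear_on_def)
    moreover have "\<phi> (\<i> *\<^sub>C A) = \<i> * \<phi> A"
      by (simp add: \<phi>_def ampl_scaleC_left cinner_scaleC_left distrib_left)
    ultimately have "Re (\<i> * l A) = Re (\<i> * \<phi> A)" using Re_eq by metis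
    then show ?thesis using Re_eq[OF A] by (simp add: complex_eq_iff)
  qed
  then show ?thesis using that unfolding \<phi>_def by blast
qed

lemma clinear_on_ampl: "clinear_on V (\<lambda>A. cinner (ampl A h) k)"
  by (simp add: clinear_on_def ampl_add_left ampl_scaleC_left cinner_linear)

text \<open>A continuous functional is dominated by one seminorm of strong-star type, whatever
  \<open>\<T>\<close> is, and a coefficient is dominated by one seminorm of each topology. This
  two-sided estimate is why \<open>\<T>\<close> is absent on the right.\<close>

theorem top_dual_sigma_op_topology:
  assumes V: "V \<subseteq> bops" "csubspace V"
  shows "top_dual (sigma_op_topology \<T> V) = {\<lambda>A. if A \<in> V then cinner (ampl A h) k else 0 |h k. True}"
proof (intro equalityI subsetI)
  fix l assume l: "l \<in> top_dual (sigma_op_topology \<T> V)"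
  have cl: "clinear_on V l" and off: "\<And>A. A \<notin> V \<Longrightarrow> l A = 0"
    using l by (auto simp: top_dual_def topspace_sigma_op_topology[OF V(1)])
  obtain Q C where Q: "finite Q" "Q \<subseteq> sigma_op_seminorms \<T>" "0 \<le> C"
    and lQ: "\<And>A. A \<in> V \<Longrightarrow> cmod (l A) \<le> C * (\<Sum>p\<in>Q. p A)"
    using top_dual_seminorm_bound[OF seminorms_sigma_op V] l unfolding sigma_op_topology_def by metis
  have "dominated (\<lambda>_. True) (\<lambda>_. True) p" if "p \<in> sigma_op_seminorms \<T>" for p
    using that by (cases \<T>) (auto simp only: sigma_op_seminorms_ampl intro!: dominated_ampl_seminorms)
  then have "dominated (\<lambda>_. True) (\<lambda>_. True) (\<lambda>A. \<Sum>p\<in>Q. p A)"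
    using Q by (intro dominated_sum) auto
  then obtain h k D where D: "0 \<le> D" "\<And>A. A \<in> bops \<Longrightarrow> (\<Sum>p\<in>Q. p A) \<le> D * (norm (ampl A h) + norm (ampl (adj A) k))"
    by (auto simp: dominated_def)
  have "cmod (l A) \<le> (C * D) * (norm (ampl A h) + norm (ampl (adj A) k))" if A: "A \<in> V" for A
    using lQ[OF A] mult_left_mono[OF D(2) Q(3), of A] V A by (auto simp: mult.assoc)
  then obtain g g' where "\<And>A. A \<in> V \<Longrightarrow> l A = cinner (ampl A h) g + cinner (ampl A g') k"
    using dominated_functional_rep[OF V cl, of "C * D" h k] Q(3) D(1) by auto
  then have "l = (\<lambda>A. if A \<in> V then cinner (ampl A (interleave h g')) (interleave g k) else 0)"
    using off by (auto simp: ampl_interleave cinner_interleave)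
  then show "l \<in> {\<lambda>A. if A \<in> V then cinner (ampl A h) k else 0 |h k. True}" by blast
next
  fix l assume "l \<in> {\<lambda>A. if A \<in> V then cinner (ampl A h) k else 0 |h k. True}"
  then obtain h k where l: "l = (\<lambda>A. if A \<in> V then cinner (ampl A h) k else 0)" by blast
  obtain p C where p: "p \<in> sigma_op_seminorms \<T>" "\<And>A. A \<in> V \<Longrightarrow> cmod (cinner (ampl A h) k) \<le> C * p A"
  proof (cases \<T>)
    case WOT
    have "(\<lambda>A. cmod (cinner (ampl A h) k)) \<in> sigma_op_seminorms \<T>"
      unfolding WOT sigma_op_seminorms_ampl by blast
    then show ?thesis using that[of _ 1] by simp
  next
    case SOT
    have m: "(\<lambda>A. norm (ampl A h)) \<in> sigma_op_seminorms \<T>"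
      unfolding SOT sigma_op_seminorms_ampl by blast
    have b: "cmod (cinner (ampl A h) k) \<le> norm k * norm (ampl A h)" for A
      using norm_cinner_le[of "ampl A h" k] by (simp add: mult.commute)
    show ?thesis by (rule that[OF m, of "norm k"]) (rule b)
  next
    case SstarOT
    have b: "cmod (cinner (ampl A h) k) \<le> norm k * (norm (ampl A h) + norm (ampl (adj A) 0))" for A
    proof -
      have "cmod (cinner (ampl A h) k) \<le> norm k * norm (ampl A h)"
        using norm_cinner_le[of "ampl A h" k] by (simp add: mult.commute)
      also have "\<dots> \<le> norm k * (norm (ampl A h) + norm (ampl (adj A) 0))"
        by (intro mult_left_mono) auto
      finally show ?thesis .
    qed
    have m: "(\<lambda>A. norm (ampl A h) + norm (ampl (adj A) 0)) \<in> sigma_op_seminorms \<T>"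
      unfolding SstarOT sigma_op_seminorms_ampl by blast
    show ?thesis by (rule that[OF m, of "norm k"]) (rule b)
  qed
  show "l \<in> top_dual (sigma_op_topology \<T> V)"
    unfolding l sigma_op_topology_def
    by (rule top_dual_seminormI[OF seminorms_sigma_op V p(1) clinear_on_ampl p(2)])
qed

section \<open>Functionals for the ordinary topologies\<close>

definition finsupp_l2 :: "'a::complex_hilbert l2seq \<Rightarrow> bool" where
  "finsupp_l2 x \<longleftrightarrow> (\<exists>N. \<forall>n\<ge>N. l2_nth x n = 0)"

lemma finsupp_interleave: "finsupp_l2 x \<Longrightarrow> finsupp_l2 y \<Longrightarrow> finsupp_l2 (interleave x y)"
proof -
  assume "finsupp_l2 x" "finsupp_l2 y"
  then obtain N M where "\<And>n. n \<ge> N \<Longrightarrow> l2_nth x n = 0" "\<And>n. n \<ge> M \<Longrightarrow> l2_nth y n = 0"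
    unfolding finsupp_l2_def by blast
  \<comment> \<open>Beyond this index both halves of the interleaving have left their
    supports.\<close>
  then show ?thesis unfolding finsupp_l2_def
    by (intro exI[of _ "2 * N + 2 * M + 2"]) (auto simp: l2_nth_interleave)
qed

lemma finsupp_single: "finsupp_l2 (single_l2 h)"
  unfolding finsupp_l2_def by (intro exI[of _ 1]) (auto simp: l2_nth_single)

lemma finsupp_0: "finsupp_l2 0" by (auto simp: finsupp_l2_def l2_nth_ops)

lemma cinner_finite_sum:
  assumes "\<And>n. n \<ge> N \<Longrightarrow> cinner (l2_nth x n) (l2_nth y n) = 0"
  shows "cinner x y = (\<Sum>n<N. cinner (l2_nth x n) (l2_nth y n))"
  unfolding cinner_l2seq_def ell2_inner_def
  by (rule suminf_finite) (use assms in auto)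

theorem top_dual_op_topology:
  assumes V: "V \<subseteq> bops" "csubspace V"
  shows "top_dual (op_topology \<T> V) =
    {\<lambda>A. if A \<in> V then (\<Sum>i<N. cinner (blinfun_apply A (h i)) (k i)) else 0 |(N::nat) h k. True}"
proof (intro equalityI subsetI)
  fix l assume l: "l \<in> top_dual (op_topology \<T> V)"
  have cl: "clinear_on V l" and off: "\<And>A. A \<notin> V \<Longrightarrow> l A = 0"
    using l by (auto simp: top_dual_def topspace_op_topology[OF V(1)])
  obtain Q C where Q: "finite Q" "Q \<subseteq> op_seminorms \<T>" "0 \<le> C"
    and lQ: "\<And>A. A \<in> V \<Longrightarrow> cmod (l A) \<le> C * (\<Sum>p\<in>Q. p A)"
    using top_dual_seminorm_bound[OF seminorms_op V] l unfolding op_topology_def by metis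
  have "dominated finsupp_l2 finsupp_l2 p" if "p \<in> op_seminorms \<T>" for p
    using that by (cases \<T>) (auto simp only: op_seminorms_ampl
        intro!: dominated_ampl_seminorms finsupp_single finsupp_0)
  then have "dominated finsupp_l2 finsupp_l2 (\<lambda>A. \<Sum>p\<in>Q. p A)"
    using Q by (intro dominated_sum finsupp_interleave finsupp_0) auto
  then obtain h k D where hk: "finsupp_l2 h" "finsupp_l2 k"
    and D: "0 \<le> D" "\<And>A. A \<in> bops \<Longrightarrow> (\<Sum>p\<in>Q. p A) \<le> D * (norm (ampl A h) + norm (ampl (adj A) k))"
    by (auto simp: dominated_def)
  have "cmod (l A) \<le> (C * D) * (norm (ampl A h) + norm (ampl (adj A) k))" if A: "A \<in> V" for A
    using lQ[OF A] mult_left_mono[OF D(2) Q(3), of A] V A by (auto simp: mult.assoc)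
  then obtain g g' where g: "\<And>A. A \<in> V \<Longrightarrow> l A = cinner (ampl A h) g + cinner (ampl A g') k"
    using dominated_functional_rep[OF V cl, of "C * D" h k] Q(3) D(1) by auto
  obtain N M where N: "\<And>n. n \<ge> N \<Longrightarrow> l2_nth h n = 0" and M: "\<And>n. n \<ge> M \<Longrightarrow> l2_nth k n = 0"
    using hk unfolding finsupp_l2_def by blast
  \<comment> \<open>Only \<open>h\<close> and \<open>k\<close> are known to be finitely supported.
    Even coordinates pair \<open>h\<close> with \<open>g\<close> and odd ones \<open>g'\<close> with
    \<open>k\<close>, so each product still contains a finitely supported factor.\<close>
  define x where "x = interleave h g'"
  define y where "y = interleave g k"
  define n0 where "n0 = 2 * N + 2 * M + 2"
  have z: "cinner (l2_nth (ampl A x) n) (l2_nth y n) = 0" if "n \<ge> n0" for A n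
    using that by (auto simp: n0_def x_def y_def l2_nth_interleave N M)
  have "l A = (\<Sum>i<n0. cinner (blinfun_apply A (l2_nth x i)) (l2_nth y i))" if "A \<in> V" for A
  proof -
    have "l A = cinner (ampl A x) y"
      using g[OF that] by (simp add: x_def y_def ampl_interleave cinner_interleave)
    then show ?thesis using cinner_finite_sum[of n0 "ampl A x" y, OF z] by simp
  qed
  then have "l = (\<lambda>A. if A \<in> V then (\<Sum>i<n0. cinner (blinfun_apply A (l2_nth x i)) (l2_nth y i)) else 0)"
    using off by (intro ext) auto
  then show "l \<in> {\<lambda>A. if A \<in> V then (\<Sum>i<N. cinner (blinfun_apply A (h i)) (k i)) else 0 |(N::nat) h k. True}"
    by blast
next
  fix l assume "l \<in> {\<lambda>A. if A \<in> V then (\<Sum>i<N. cinner (blinfun_apply A (h i)) (k i)) else 0 |(N::nat) h k. True}"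
  then obtain N :: nat and h k where l: "l = (\<lambda>A. if A \<in> V then (\<Sum>i<N. cinner (blinfun_apply A (h i)) (k i)) else 0)" by blast
  have one: "(\<lambda>A. if A \<in> V then cinner (blinfun_apply A h) k else 0) \<in> top_dual (op_topology \<T> V)" for h k
  proof -
    have CS: "cmod (cinner (blinfun_apply A h) k) \<le> norm k * norm (blinfun_apply A h)" for A :: "'a \<Rightarrow>\<^sub>L 'b"
      using norm_cinner_le[of "blinfun_apply A h" k] by (simp add: mult.commute)
    obtain p C where p: "p \<in> op_seminorms \<T>" "\<And>A. A \<in> V \<Longrightarrow> cmod (cinner (blinfun_apply A h) k) \<le> C * p A"
    proof (cases \<T>)
      case WOT
      have "(\<lambda>A. cmod (cinner (blinfun_apply A h) k)) \<in> op_seminorms \<T>"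
        unfolding WOT op_seminorms.simps by blast
      then show ?thesis using that[of _ 1] by simp
    next
      case SOT
      have m: "(\<lambda>A. norm (blinfun_apply A h)) \<in> op_seminorms \<T>"
        unfolding SOT op_seminorms.simps by blast
      show ?thesis by (rule that[OF m, of "norm k"]) (rule CS)
    next
      case SstarOT
      have b: "cmod (cinner (blinfun_apply A h) k) \<le> norm k * (norm (blinfun_apply A h) + norm (blinfun_apply (adj A) 0))"
        for A :: "'a \<Rightarrow>\<^sub>L 'b"
        using CS[of A] by simp
      have m: "(\<lambda>A. norm (blinfun_apply A h) + norm (blinfun_apply (adj A) 0)) \<in> op_seminorms \<T>"
        unfolding SstarOT op_seminorms.simps by blast
      show ?thesis by (rule that[OF m, of "norm k"]) (rule b)
    qed
    show ?thesis
      unfolding op_topology_def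
      by (rule top_dual_seminormI[OF seminorms_op V p(1) _ p(2)])
         (simp add: clinear_on_def blinfun.add_left scaleC_blinfun_apply cinner_linear)
  qed
  have ts: "topspace (op_topology \<T> V) = V" by (rule topspace_op_topology[OF V(1)])
  have "continuous_map (op_topology \<T> V) euclidean
      (\<lambda>A. \<Sum>i<N. if A \<in> V then cinner (blinfun_apply A (h i)) (k i) else 0)"
    using one by (intro continuous_map_sum) (auto simp: top_dual_def)
  moreover have "l = (\<lambda>A. \<Sum>i<N. if A \<in> V then cinner (blinfun_apply A (h i)) (k i) else 0)"
    unfolding l by auto
  moreover have "clinear_on V l"
    using V(2) by (simp add: l clinear_on_def csubspace_def blinfun.add_left scaleC_blinfun_apply
        cinner_linear sum.distrib sum_distrib_left)
  ultimately show "l \<in> top_dual (op_topology \<T> V)" by (auto simp: top_dual_def ts l)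
qed

section \<open>Orthonormal bases, rank-one operators and the trace\<close>

text \<open>Zorn's lemma for orthonormal sets: a nonzero vector orthogonal to a maximal one could be
  normalized and added.\<close>

lemma is_onb_some_onb: "is_onb (some_onb :: 'a::complex_hilbert set)"
proof -
  define \<O> where "\<O> = {E :: 'a set. (\<forall>e\<in>E. norm e = 1) \<and> (\<forall>e\<in>E. \<forall>f\<in>E. e \<noteq> f \<longrightarrow> cinner e f = 0)}"
  have "\<exists>M\<in>\<O>. \<forall>X\<in>\<O>. M \<subseteq> X \<longrightarrow> X = M"
  proof (rule subset_Zorn')
    fix C assume C: "subset.chain \<O> C"
    have sub: "\<And>E. E \<in> C \<Longrightarrow> E \<in> \<O>" and lin: "\<And>E F. E \<in> C \<Longrightarrow> F \<in> C \<Longrightarrow> E \<subseteq> F \<or> F \<subseteq> E"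
      using C by (auto simp: subset_chain_def)
    have "cinner e f = 0" if ef: "e \<in> \<Union>C" "f \<in> \<Union>C" "e \<noteq> f" for e f
    proof -
      obtain E F where E: "E \<in> C" "e \<in> E" and F: "F \<in> C" "f \<in> F" using ef by blast
      show ?thesis
      proof (cases "E \<subseteq> F")
        case True then show ?thesis using sub[OF F(1)] E F ef(3) unfolding \<O>_def by blast
      next
        case False
        then have "F \<subseteq> E" using lin E F by blast
        then show ?thesis using sub[OF E(1)] E F ef(3) unfolding \<O>_def by blast
      qed
    qed
    moreover have "norm e = 1" if "e \<in> \<Union>C" for e using sub that unfolding \<O>_def by blast
    ultimately show "\<Union>C \<in> \<O>" unfolding \<O>_def by blast
  qed
  then obtain M where M: "M \<in> \<O>" and max: "\<And>X. X \<in> \<O> \<Longrightarrow> M \<subseteq> X \<Longrightarrow> X = M" by blast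
  have "x = 0" if x: "\<And>e. e \<in> M \<Longrightarrow> cinner x e = 0" for x
  proof (rule ccontr)
    assume x0: "x \<noteq> 0"
    define u where "u = inverse (norm x) *\<^sub>R x"
    have u: "norm u = 1" "\<And>e. e \<in> M \<Longrightarrow> cinner u e = 0" "\<And>e. e \<in> M \<Longrightarrow> cinner e u = 0"
      using x x0 by (auto simp: u_def cinner_linear) (metis cinner_commute complex_cnj_zero)
    have "insert u M \<in> \<O>" using M u unfolding \<O>_def by auto
    then have "u \<in> M" using max[of "insert u M"] by blast
    then have "cinner u u = 0" by (rule u(2))
    then show False using u(1) by (simp add: cinner_eq_zero_iff)
  qed
  then have "is_onb M" using M unfolding is_onb_def \<O>_def by blast
  then show ?thesis unfolding some_onb_def by (rule someI)
qed

text \<open>\<open>P\<close> is the orthogonal projection of \<open>x\<close> to the span of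
  \<open>F\<close>; \<open>\<langle>P, x\<rangle> = |P|^2\<close> and Cauchy-Schwarz give
  \<open>|P| \<le> |x|\<close>, the source of Bessel's inequality.\<close>

lemma onb_finite_projection:
  fixes x :: "'a::complex_hilbert"
  assumes E: "is_onb E" and F: "finite F" "F \<subseteq> E"
  defines "P \<equiv> (\<Sum>e\<in>F. cinner x e *\<^sub>C e)"
  shows "(norm P)\<^sup>2 = (\<Sum>e\<in>F. (cmod (cinner x e))\<^sup>2)" "norm P \<le> norm x"
    "(\<Sum>e\<in>F. cinner x e * cinner e y) = cinner P y"
proof -
  show cP: "(\<Sum>e\<in>F. cinner x e * cinner e y) = cinner P y" for y
    by (simp add: P_def cinner_sum_left cinner_scaleC_left)
  have ef: "cinner e f = (if e = f then 1 else 0)" if "e \<in> F" "f \<in> F" for e f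
  proof -
    have "e \<in> E" "f \<in> E" using that F by auto
    then show ?thesis using E unfolding is_onb_def by (cases "e = f") (simp add: cinner_self, metis)
  qed
  have Pe: "cinner e P = cnj (cinner x e)" if e: "e \<in> F" for e
  proof -
    have "cinner e P = (\<Sum>f\<in>F. cnj (cinner x f) * cinner e f)"
      by (simp add: P_def cinner_sum_right cinner_scaleC_right)
    also have "\<dots> = (\<Sum>f\<in>F. if f = e then cnj (cinner x e) else 0)"
      using e by (intro sum.cong) (auto simp: ef)
    finally show ?thesis using e F by simp
  qed
  have "cinner P P = (\<Sum>e\<in>F. cinner x e * cinner e P)" by (simp add: cP)
  also have "\<dots> = of_real (\<Sum>e\<in>F. (cmod (cinner x e))\<^sup>2)"
    by (simp add: Pe complex_norm_square del: of_real_power)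
  finally have PP: "cinner P P = of_real (\<Sum>e\<in>F. (cmod (cinner x e))\<^sup>2)" .
  then show n: "(norm P)\<^sup>2 = (\<Sum>e\<in>F. (cmod (cinner x e))\<^sup>2)"
    by (metis Re_cinner_self Re_complex_of_real)
  have "cinner P x = (\<Sum>e\<in>F. cinner x e * cnj (cinner x e))"
    using cP[of x] by (metis (no_types, lifting) cinner_commute sum.cong)
  also have "\<dots> = of_real ((norm P)\<^sup>2)"
    by (simp add: n complex_norm_square del: of_real_power)
  finally have "norm P * norm P \<le> norm P * norm x"
    using norm_cinner_le[of P x] by (simp add: power2_eq_square norm_mult)
  then show "norm P \<le> norm x"
    by (cases "P = 0") auto
qed

lemma onb_Bessel:
  assumes "is_onb E" "finite F" "F \<subseteq> E" shows "(\<Sum>e\<in>F. (cmod (cinner x e))\<^sup>2) \<le> (norm x)\<^sup>2"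
  unfolding onb_finite_projection(1)[OF assms, of x, symmetric]
  by (intro power_mono onb_finite_projection(2)[OF assms]) auto

lemma mult_le_sum_squares:
  fixes a b :: real assumes "0 \<le> a" "0 \<le> b" shows "a * b \<le> a\<^sup>2 + b\<^sup>2"
proof -
  have "2 * (a * b) \<le> a\<^sup>2 + b\<^sup>2" using sum_squares_bound[of a b] by (simp add: mult.assoc)
  moreover have "0 \<le> a * b" using assms by simp
  ultimately show ?thesis by linarith
qed

lemma onb_summable:
  assumes E: "is_onb E"
  shows "(\<lambda>e. (cmod (cinner x e))\<^sup>2) summable_on E" "(\<lambda>e. cinner x e * cinner e y) summable_on E"
proof -
  show s: "(\<lambda>e. (cmod (cinner x e))\<^sup>2) summable_on E" for x
  proof (rule nonneg_bdd_above_summable_on)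
    show "bdd_above (sum (\<lambda>e. (cmod (cinner x e))\<^sup>2) ` {F. F \<subseteq> E \<and> finite F})"
    proof (rule bdd_aboveI2)
      fix F assume "F \<in> {F. F \<subseteq> E \<and> finite F}"
      then show "(\<Sum>e\<in>F. (cmod (cinner x e))\<^sup>2) \<le> (norm x)\<^sup>2" by (intro onb_Bessel[OF E]) auto
    qed
  qed simp
  have "(\<lambda>e. (cmod (cinner x e))\<^sup>2 + (cmod (cinner y e))\<^sup>2) summable_on E"
    by (intro summable_on_add s)
  then have "(\<lambda>e. norm (cinner x e * cinner e y)) summable_on E"
  proof (rule summable_on_comparison_test)
    fix e
    have *: "cmod (cinner e y) = cmod (cinner y e)" by (metis cinner_commute complex_mod_cnj)
    show "norm (cinner x e * cinner e y) \<le> (cmod (cinner x e))\<^sup>2 + (cmod (cinner y e))\<^sup>2"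
      unfolding norm_mult * by (intro mult_le_sum_squares) auto
  qed simp
  then show "(\<lambda>e. cinner x e * cinner e y) summable_on E" by (rule abs_summable_summable)
qed

text \<open>The sum defines a sesquilinear form that is bounded because its partial sums involve
  finite projections, so an operator \<open>R\<close> represents it. \<open>R x - x\<close> is
  orthogonal to the basis, hence 0. This bypasses norm convergence of Fourier expansions.\<close>

lemma Parseval:
  assumes E: "is_onb E"
  shows "(\<Sum>\<^sub>\<infinity>e\<in>E. cinner x e * cinner e y) = cinner x y"
proof -
  define b where "b x y = (\<Sum>\<^sub>\<infinity>e\<in>E. cinner x e * cinner e y)" for x y
  note s = onb_summable(2)[OF E]
  have bd: "cmod (b x y) \<le> 1 * norm x * norm y" for x y
    unfolding b_def
  proof (rule Lim_norm_ubound[OF finite_subsets_at_top_neq_bot infsum_tendsto[OF s]])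
    show "\<forall>\<^sub>F F in finite_subsets_at_top E. norm (\<Sum>e\<in>F. cinner x e * cinner e y) \<le> 1 * norm x * norm y"
    proof (rule eventually_finite_subsets_at_top_weakI)
      fix F assume F: "finite F" "F \<subseteq> E"
      let ?P = "\<Sum>e\<in>F. cinner x e *\<^sub>C e"
      have "norm (\<Sum>e\<in>F. cinner x e * cinner e y) \<le> norm ?P * norm y"
        unfolding onb_finite_projection(3)[OF E F] by (rule norm_cinner_le)
      also have "\<dots> \<le> norm x * norm y"
        by (intro mult_right_mono onb_finite_projection(2)[OF E F]) auto
      finally show "norm (\<Sum>e\<in>F. cinner x e * cinner e y) \<le> 1 * norm x * norm y" by simp
    qed
  qed
  obtain R where R: "\<And>x y. cinner (blinfun_apply R x) y = b x y"
  proof (rule bops_sesquilinear_rep[of b 1])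
    show "b (x + y) k = b x k + b y k" for x y k
      unfolding b_def cinner_add_left distrib_right by (intro infsum_add s)
    show "b h (x + y) = b h x + b h y" for h x y
      unfolding b_def cinner_add_right distrib_left by (intro infsum_add s)
    show "b (c *\<^sub>C x) k = c * b x k" for c x k
      unfolding b_def cinner_scaleC_left mult.assoc by (rule infsum_cmult_right')
    show "b h (c *\<^sub>C x) = cnj c * b h x" for c h x
      unfolding b_def cinner_scaleC_right mult.left_commute[of _ "cnj c"] by (rule infsum_cmult_right')
  qed (use bd in auto)
  have "blinfun_apply R x - x = 0"
  proof -
    have "cinner (blinfun_apply R x - x) e = 0" if e: "e \<in> E" for e
    proof -
      have "b x e = (\<Sum>\<^sub>\<infinity>f\<in>{e}. cinner x f * cinner f e)"
        unfolding b_def using E e by (intro infsum_cong_neutral) (auto simp: is_onb_def)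
      also have "\<dots> = cinner x e" using E e by (simp add: is_onb_def cinner_self)
      finally show ?thesis by (simp add: cinner_diff_left R)
    qed
    then show ?thesis using E unfolding is_onb_def by blast
  qed
  then show ?thesis using R[of x y] by (simp add: b_def)
qed

section \<open>Rank-one and trace class operators\<close>

definition rank1 :: "'h \<Rightarrow> 'k \<Rightarrow> ('k::complex_hilbert \<Rightarrow>\<^sub>L 'h::complex_hilbert)" where
  "rank1 h k = Blinfun (\<lambda>x. cinner x k *\<^sub>C h)"

lemma rank1_apply [simp]: "blinfun_apply (rank1 h k) x = cinner x k *\<^sub>C h"
proof -
  have "bounded_linear (\<lambda>x. cinner x k *\<^sub>C h)"
  proof (rule bounded_linear_intro[where K = "norm k * norm h"])
    show "norm (cinner x k *\<^sub>C h) \<le> norm x * (norm k * norm h)" for x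
      using mult_right_mono[OF norm_cinner_le[of x k], of "norm h"] by (simp add: norm_scaleC mult.assoc)
  qed (simp_all add: cinner_linear scaleC_add_left scaleR_scaleC scaleC_scaleC)
  then show ?thesis unfolding rank1_def by (simp add: bounded_linear_Blinfun_apply)
qed

lemma rank1_bops [simp]: "rank1 h k \<in> bops"
  by (simp add: bops_def cinner_scaleC_left scaleC_scaleC)

lemma adj_rank1: "adj (rank1 h k) = rank1 k h"
proof (rule adj_unique)
  fix x y
  have "cinner h y = cnj (cinner y h)" by (rule cinner_commute)
  then show "cinner (blinfun_apply (rank1 h k) x) y = cinner x (blinfun_apply (rank1 k h) y)"
    by (simp add: cinner_linear mult.commute)
qed simp

lemma rank1_trace_class: "rank1 h k \<in> trace_class"
proof -
  \<comment> \<open>\<open>S\<close> is the absolute value of \<open>rank1 h k\<close>: its square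
    is \<open>|h|^2\<close> times \<open>rank1 k k\<close>. For \<open>k = 0\<close> the quotient is
    0, and both operators vanish.\<close>
  define c where "c = norm h / norm k"
  define S where "S = c *\<^sub>R rank1 k k"
  have Sx: "blinfun_apply S x = of_real c *\<^sub>C cinner x k *\<^sub>C k" for x
    by (simp add: S_def blinfun.scaleR_left scaleR_scaleC)
  have Sq: "cinner (blinfun_apply S x) x = of_real (c * (cmod (cinner x k))\<^sup>2)" for x
  proof -
    have "cinner k x = cnj (cinner x k)" by (rule cinner_commute)
    then show ?thesis unfolding Sx by (simp add: cinner_linear complex_norm_square mult.assoc del: of_real_power)
  qed
  have S: "positive_op S"
    unfolding positive_op_iff Sq by (auto simp: S_def c_def)
  have "S o\<^sub>L S = adj (rank1 h k) o\<^sub>L rank1 h k"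
  proof (cases "k = 0")
    case True
    then show ?thesis by (intro blinfun_eqI) (simp add: Sx adj_rank1)
  next
    case False
    then have hh: "cinner h h = complex_of_real c * (of_real c * cinner k k)"
      by (simp add: c_def cinner_self power2_eq_square)
    show ?thesis
      by (intro blinfun_eqI) (simp add: Sx adj_rank1 cinner_linear scaleC_scaleC hh mult_ac)
  qed
  then have sq: "sqrt_op (adj (rank1 h k) o\<^sub>L rank1 h k) = S"
    by (intro sqrt_op_eqI positive_op_adj_self S) auto
  note E = is_onb_some_onb
  have "trace_pos S \<le> ennreal (c * (norm k)\<^sup>2)"
    unfolding trace_pos_def
  proof (rule infsum_le_finite_sums)
    show "(\<lambda>e. ennreal (Re (cinner (blinfun_apply S e) e))) summable_on some_onb"
      by (rule nonneg_summable_on_complete) simp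
    fix F :: "'a set" assume F: "finite F" "F \<subseteq> some_onb"
    have "(\<Sum>e\<in>F. Re (cinner (blinfun_apply S e) e)) = c * (\<Sum>e\<in>F. (cmod (cinner k e))\<^sup>2)"
    proof -
      have "cmod (cinner e k) = cmod (cinner k e)" for e by (metis cinner_commute complex_mod_cnj)
      then show ?thesis unfolding Sq by (simp add: sum_distrib_left)
    qed
    also have "\<dots> \<le> c * (norm k)\<^sup>2"
      by (intro mult_left_mono onb_Bessel[OF E F]) (simp add: c_def)
    finally show "(\<Sum>e\<in>F. ennreal (Re (cinner (blinfun_apply S e) e))) \<le> ennreal (c * (norm k)\<^sup>2)"
      using S by (subst sum_ennreal) (auto simp: positive_op_iff ennreal_leI)
  qed
  then have "trace_pos S < \<infinity>" using ennreal_less_top le_less_trans infinity_ennreal_def by metis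
  then show ?thesis by (simp add: trace_class_def sq)
qed

text \<open>Parseval evaluates the trace, so every coefficient of \<open>A\<close> is among the
  trace functionals.\<close>

lemma trace_op_comp_rank1:
  assumes "A \<in> bops" shows "trace_op (A o\<^sub>L rank1 h k) = cinner (blinfun_apply A h) k"
proof -
  have "trace_op (A o\<^sub>L rank1 h k) = (\<Sum>\<^sub>\<infinity>e\<in>some_onb. cinner (blinfun_apply A h) e * cinner e k)"
    unfolding trace_op_def
    by (intro infsum_cong) (simp add: bopsD[OF assms] cinner_scaleC_left mult.commute)
  then show ?thesis by (simp add: Parseval[OF is_onb_some_onb])
qed

text \<open>The diagonal of the absolute value \<open>S\<close> of \<open>B\<close> is summable,
  hence zero off a countable set, and a positive operator whose diagonal entry at \<open>e\<close>
  is 0 annihilates \<open>e\<close>. This is what makes trace functionals measurable when the basis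
  is uncountable.\<close>

lemma trace_class_countable:
  assumes B: "B \<in> trace_class"
  shows "countable {e \<in> some_onb. blinfun_apply B e \<noteq> 0}"
proof -
  have Bb: "B \<in> bops" using B by (simp add: trace_class_def)
  define S where "S = sqrt_op (adj B o\<^sub>L B)"
  have pBB: "positive_op (adj B o\<^sub>L B)" using Bb by (rule positive_op_adj_self)
  have S: "positive_op S" "S o\<^sub>L S = adj B o\<^sub>L B"
    unfolding S_def using sqrt_op_positive[OF pBB] sqrt_op_square[OF pBB] by auto
  define f where "f e = Re (cinner (blinfun_apply S e) e)" for e
  have f0: "0 \<le> f e" for e using S(1) by (simp add: f_def positive_op_iff)
  have fin: "trace_pos S < \<infinity>" using B by (simp add: trace_class_def S_def)
  have "f summable_on some_onb"
  proof (rule nonneg_bdd_above_summable_on)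
    show "bdd_above (sum f ` {F. F \<subseteq> some_onb \<and> finite F})"
    proof (rule bdd_aboveI2)
      fix F :: "'a set" assume "F \<in> {F. F \<subseteq> some_onb \<and> finite F}"
      then have F: "finite F" "F \<subseteq> some_onb" by auto
      have "infsum (\<lambda>e. ennreal (f e)) F \<le> infsum (\<lambda>e. ennreal (f e)) some_onb"
        by (rule infsum_mono_neutral) (use F in \<open>auto intro: nonneg_summable_on_complete\<close>)
      then have "ennreal (sum f F) \<le> trace_pos S"
        using F f0 by (simp add: trace_pos_def f_def[symmetric] sum_ennreal)
      then show "sum f F \<le> enn2real (trace_pos S)"
        using fin f0 by (metis enn2real_ennreal enn2real_mono infinity_ennreal_def sum_nonneg)
    qed
  qed (use f0 in auto)
  then have "countable {e \<in> some_onb. f e \<noteq> 0}" by (rule summable_countable_real)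
  moreover have "blinfun_apply B e = 0" if "f e = 0" for e
  proof -
    have "blinfun_apply S e = 0" using positive_op_zero[OF S(1)] that by (simp add: f_def)
    then have "blinfun_apply (adj B o\<^sub>L B) e = 0" unfolding S(2)[symmetric] by simp
    then have "cinner (blinfun_apply B e) (blinfun_apply B e) = 0"
      using cinner_adj_left[OF Bb, of "blinfun_apply B e" e] by simp
    then show ?thesis by (simp add: cinner_eq_zero_iff)
  qed
  then have "{e \<in> some_onb. blinfun_apply B e \<noteq> 0} \<subseteq> {e \<in> some_onb. f e \<noteq> 0}" by blast
  ultimately show ?thesis by (metis countable_subset)
qed

section \<open>The \<open>\<sigma>\<close>-algebras\<close>

text \<open>\<open>infsum\<close> is 0 where the family is not summable, and complex summability is
  absolute. So the sum equals the series on the measurable set of absolute convergence and 0 off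
  it.\<close>

lemma borel_measurable_infsum_nat:
  fixes f :: "nat \<Rightarrow> 'a \<Rightarrow> complex"
  assumes [measurable]: "\<And>n. f n \<in> borel_measurable M"
  shows "(\<lambda>x. \<Sum>\<^sub>\<infinity>n. f n x) \<in> borel_measurable M"
proof -
  have eq: "(\<Sum>\<^sub>\<infinity>n. f n x) = (if (\<Sum>n. ennreal (cmod (f n x))) \<noteq> top then (\<Sum>n. f n x) else 0)" for x
  proof (cases "(\<Sum>n. ennreal (cmod (f n x))) \<noteq> top")
    case True
    then have s: "summable (\<lambda>n. norm (f n x))" by (intro summable_suminf_not_top) auto
    have "((\<lambda>n. f n x) has_sum (\<Sum>n. f n x)) UNIV"
      by (rule norm_summable_imp_has_sum[OF s summable_sums[OF summable_norm_cancel[OF s]]])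
    then show ?thesis using True by (simp add: infsumI)
  next
    case False
    then have ns: "\<not> summable (\<lambda>n. norm (f n x))" using ennreal_suminf_neq_top[of "\<lambda>n. norm (f n x)"] by auto
    have "\<not> (\<lambda>n. f n x) summable_on UNIV"
    proof
      assume "(\<lambda>n. f n x) summable_on UNIV"
      then have "(\<lambda>n. norm (f n x)) summable_on UNIV"
        by (rule iffD1[OF summable_on_iff_abs_summable_on_complex])
      then have "summable (\<lambda>n. norm (f n x))" by (rule summable_on_imp_summable)
      then show False using ns by blast
    qed
    then show ?thesis using False by (simp add: infsum_not_exists)
  qed
  show ?thesis unfolding eq by measurable
qed

lemma borel_measurable_infsum_countable:
  fixes f :: "'i \<Rightarrow> 'a \<Rightarrow> complex"
  assumes I: "countable I" and f: "\<And>i. i \<in> I \<Longrightarrow> f i \<in> borel_measurable M"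
  shows "(\<lambda>x. \<Sum>\<^sub>\<infinity>i\<in>I. f i x) \<in> borel_measurable M"
proof -
  define g where "g n x = (if n \<in> to_nat_on I ` I then f (from_nat_into I n) x else 0)" for n x
  have "g n \<in> borel_measurable M" for n
  proof (cases "n \<in> to_nat_on I ` I")
    case True
    then have "from_nat_into I n \<in> I" using I by auto
    then show ?thesis using True f by (simp add: g_def[abs_def])
  qed (simp add: g_def[abs_def])
  then have "(\<lambda>x. \<Sum>\<^sub>\<infinity>n. g n x) \<in> borel_measurable M" by (rule borel_measurable_infsum_nat)
  moreover have "(\<Sum>\<^sub>\<infinity>n. g n x) = (\<Sum>\<^sub>\<infinity>i\<in>I. f i x)" for x
  proof -
    have "(\<Sum>\<^sub>\<infinity>n. g n x) = (\<Sum>\<^sub>\<infinity>n\<in>to_nat_on I ` I. f (from_nat_into I n) x)"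
      by (intro infsum_cong_neutral) (auto simp: g_def)
    also have "\<dots> = (\<Sum>\<^sub>\<infinity>i\<in>I. ((\<lambda>n. f (from_nat_into I n) x) \<circ> to_nat_on I) i)"
      by (subst infsum_reindex) (use I in \<open>auto simp: inj_on_to_nat_on comp_def\<close>)
    also have "\<dots> = (\<Sum>\<^sub>\<infinity>i\<in>I. f i x)" using I by (intro infsum_cong) simp
    finally show ?thesis .
  qed
  ultimately show ?thesis by (simp only:)
qed

text \<open>Turns the \<open>\<sigma>\<close>-algebra into a measure space, so that the calculus of
  measurable functions applies.\<close>

definition sigma_alg_measure :: "'a set \<Rightarrow> ('a \<Rightarrow> complex) set \<Rightarrow> 'a measure" where
  "sigma_alg_measure V S = sigma V {f -` X \<inter> V |f X. f \<in> S \<and> X \<in> sets borel}"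

lemma sets_sigma_alg_measure: "sets (sigma_alg_measure V S) = sigma_alg V S"
  and space_sigma_alg_measure: "space (sigma_alg_measure V S) = V"
proof -
  have "{f -` X \<inter> V |f X. f \<in> S \<and> X \<in> sets borel} \<subseteq> Pow V" by auto
  then show "sets (sigma_alg_measure V S) = sigma_alg V S" "space (sigma_alg_measure V S) = V"
    by (simp_all add: sigma_alg_measure_def sigma_alg_def space_measure_of_conv)
qed

lemma sigma_alg_measurable: "f \<in> S \<Longrightarrow> f \<in> borel_measurable (sigma_alg_measure V S)"
  by (rule measurableI)
    (auto simp: sets_sigma_alg_measure space_sigma_alg_measure sigma_alg_def intro!: sigma_sets.Basic)

lemma sigma_alg_subset:
  assumes "\<And>f. f \<in> S \<Longrightarrow> f \<in> borel_measurable (sigma_alg_measure V S')"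
  shows "sigma_alg V S \<subseteq> sigma_alg V S'"
proof -
  have "{f -` X \<inter> V |f X. f \<in> S \<and> X \<in> sets borel} \<subseteq> sigma_alg V S'"
    using measurable_sets[OF assms] by (auto simp: sets_sigma_alg_measure space_sigma_alg_measure)
  then show ?thesis unfolding sigma_alg_def by (rule sigma_sets_mono)
qed

lemma measurable_ampl:
  assumes "\<And>h k. (\<lambda>\<sigma>. cinner (blinfun_apply (F \<sigma>) h) k) \<in> borel_measurable M"
  shows "(\<lambda>\<sigma>. cinner (ampl (F \<sigma>) h) k) \<in> borel_measurable M"
  unfolding cinner_l2seq_def ell2_inner_def l2_nth_ampl
  by (intro borel_measurable_suminf assms)

text \<open>The functions in each family are finite or countable sums of coefficients on
  \<open>V\<close>, hence measurable for \<open>\<G>\<close>; conversely, each family contains every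
  coefficient up to values off \<open>V\<close>.\<close>

theorem sigma_algebras_eq:
  assumes V: "V \<subseteq> bops" "csubspace V"
  defines "\<G> \<equiv> sigma_alg V {\<lambda>A. cinner (blinfun_apply A h) k |h k. True}"
  shows "sigma_alg V {\<lambda>A. trace_op (A o\<^sub>L B) |B. B \<in> trace_class} = \<G>"
    "sigma_alg V (top_dual (sigma_op_topology \<T> V)) = \<G>"
    "sigma_alg V (top_dual (op_topology \<T> V)) = \<G>"
proof -
  define M where "M = sigma_alg_measure V {\<lambda>A. cinner (blinfun_apply A h) k |h k. True}"
  have spM: "space M = V" by (simp add: M_def space_sigma_alg_measure)
  have basic: "(\<lambda>A. cinner (blinfun_apply A h) k) \<in> borel_measurable M" for h k
    unfolding M_def by (rule sigma_alg_measurable) blast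
  have sub: "sigma_alg V S \<subseteq> \<G>" if "\<And>f. f \<in> S \<Longrightarrow> f \<in> borel_measurable M" for S
    unfolding \<G>_def using sigma_alg_subset that unfolding M_def by blast
  have sup: "\<G> \<subseteq> sigma_alg V S"
    if "\<And>h k. \<exists>f\<in>S. \<forall>A\<in>V. f A = cinner (blinfun_apply A h) k" for S
    unfolding \<G>_def
  proof (rule sigma_alg_subset, safe)
    fix h k
    obtain f where f: "f \<in> S" "\<And>A. A \<in> V \<Longrightarrow> f A = cinner (blinfun_apply A h) k" using \<open>\<And>h k. \<exists>f\<in>S. \<forall>A\<in>V. f A = cinner (blinfun_apply A h) k\<close> by blast
    show "(\<lambda>A. cinner (blinfun_apply A h) k) \<in> borel_measurable (sigma_alg_measure V S)"
      by (subst measurable_cong[where g = f])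
         (use f sigma_alg_measurable[OF f(1)] in \<open>auto simp: space_sigma_alg_measure\<close>)
  qed
  show "sigma_alg V {\<lambda>A. trace_op (A o\<^sub>L B) |B. B \<in> trace_class} = \<G>"
  proof (intro equalityI sub sup)
    fix f :: "('a \<Rightarrow>\<^sub>L 'b) \<Rightarrow> complex"
    assume "f \<in> {\<lambda>A. trace_op (A o\<^sub>L B) |B. B \<in> trace_class}"
    then obtain B where f: "f = (\<lambda>A. trace_op (A o\<^sub>L B))" and B: "B \<in> trace_class" by blast
    \<comment> \<open>Summands with \<open>B e = 0\<close> vanish, so a possibly uncountable sum
      reduces to a countable one.\<close>
    let ?I = "{e \<in> some_onb. blinfun_apply B e \<noteq> 0}"
    have "(\<lambda>A. \<Sum>\<^sub>\<infinity>e\<in>?I. cinner (blinfun_apply A (blinfun_apply B e)) e) \<in> borel_measurable M"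
      by (intro borel_measurable_infsum_countable trace_class_countable B basic)
    moreover have "f = (\<lambda>A. \<Sum>\<^sub>\<infinity>e\<in>?I. cinner (blinfun_apply A (blinfun_apply B e)) e)"
      unfolding f trace_op_def by (intro ext infsum_cong_neutral) auto
    ultimately show "f \<in> borel_measurable M" by simp
  next
    fix h k
    show "\<exists>f\<in>{\<lambda>A. trace_op (A o\<^sub>L B) |B. B \<in> trace_class}. \<forall>A\<in>V. f A = cinner (blinfun_apply A h) k"
      by (rule bexI[of _ "\<lambda>A. trace_op (A o\<^sub>L rank1 h k)"])
         (use rank1_trace_class[of h k] trace_op_comp_rank1[of _ h k] V(1) in blast)+
  qed
  show "sigma_alg V (top_dual (sigma_op_topology \<T> V)) = \<G>"
  proof (intro equalityI sub sup)
    fix f assume "f \<in> top_dual (sigma_op_topology \<T> V)"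
    then obtain h k where f: "f = (\<lambda>A. if A \<in> V then cinner (ampl A h) k else 0)"
      unfolding top_dual_sigma_op_topology[OF V] by blast
    show "f \<in> borel_measurable M"
      by (subst measurable_cong[where g = "\<lambda>A. cinner (ampl A h) k"])
         (use basic measurable_ampl[of "\<lambda>A. A" M h k] in \<open>auto simp: f spM\<close>)
  next
    fix h k
    show "\<exists>f\<in>top_dual (sigma_op_topology \<T> V). \<forall>A\<in>V. f A = cinner (blinfun_apply A h) k"
      unfolding top_dual_sigma_op_topology[OF V]
      by (rule bexI[of _ "\<lambda>A. if A \<in> V then cinner (ampl A (single_l2 h)) (single_l2 k) else 0"])
         (auto simp: ampl_single cinner_single)
  qed
  show "sigma_alg V (top_dual (op_topology \<T> V)) = \<G>"
  proof (intro equalityI sub sup)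
    fix f assume "f \<in> top_dual (op_topology \<T> V)"
    then obtain N :: nat and h k where f: "f = (\<lambda>A. if A \<in> V then (\<Sum>i<N. cinner (blinfun_apply A (h i)) (k i)) else 0)"
      unfolding top_dual_op_topology[OF V] by blast
    show "f \<in> borel_measurable M"
      by (subst measurable_cong[where g = "\<lambda>A. \<Sum>i<N. cinner (blinfun_apply A (h i)) (k i)"])
         (use basic in \<open>auto simp: f spM\<close>)
  next
    fix h k
    show "\<exists>f\<in>top_dual (op_topology \<T> V). \<forall>A\<in>V. f A = cinner (blinfun_apply A h) k"
    proof (rule bexI)
      show "(\<lambda>A. if A \<in> V then (\<Sum>i<1::nat. cinner (blinfun_apply A ((\<lambda>_. h) i)) ((\<lambda>_. k) i)) else 0)
          \<in> top_dual (op_topology \<T> V)"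
        unfolding top_dual_op_topology[OF V]
        by (rule CollectI, rule exI[of _ "1::nat"], rule exI[of _ "\<lambda>_. h"], rule exI[of _ "\<lambda>_. k"]) simp
    qed simp
  qed
qed

section \<open>Uniform boundedness\<close>

text \<open>Uniform boundedness in Baire form: the closed sublevel sets exhaust the space, so one of
  them has an interior point. It is used for integrals of families and for maps given by
  representing vectors.\<close>

lemma lsc_seminorm_bounded:
  fixes N :: "'x::banach \<Rightarrow> real"
  assumes nn: "\<And>x. 0 \<le> N x" and tri: "\<And>x y. N (x + y) \<le> N x + N y"
    and sc: "\<And>r x. N (r *\<^sub>R x) = \<bar>r\<bar> * N x" and lsc: "\<And>c. closed {x. N x \<le> c}"
  obtains C where "0 \<le> C" "\<And>x. N x \<le> C * norm x"
proof -
  define G where "G n = {x. N x \<le> real n}" for n :: nat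
  have "\<exists>n. interior (G n) \<noteq> {}"
  proof (rule ccontr)
    assume "\<not> ?thesis"
    then have e: "interior (G n) = {}" for n by blast
    have "(euclidean :: 'x topology) interior_of (\<Union>(range G)) = {}"
    proof (rule Baire_category_alt)
      show "completely_metrizable_space (euclidean :: 'x topology) \<or>
          locally_compact_space (euclidean :: 'x topology) \<and> regular_space (euclidean :: 'x topology)"
        using completely_metrizable_space_euclidean by blast
      show "closedin euclidean T \<and> euclidean interior_of T = {}" if "T \<in> range G" for T
        using that lsc e by (auto simp: G_def)
    qed simp
    moreover have "\<Union>(range G) = UNIV" using real_arch_simple by (auto simp: G_def)
    ultimately show False by simp
  qed
  then obtain n x0 where "x0 \<in> interior (G n)" by blast
  then obtain r where r: "r > 0" "ball x0 r \<subseteq> G n" by (meson mem_interior)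
  have x0: "N x0 \<le> real n" using r by (auto simp: G_def subset_iff)
  \<comment> \<open>\<open>y\<close> is the difference of two points of the ball about
    \<open>x0\<close>, which doubles the bound.\<close>
  have small: "N y \<le> 2 * real n" if y: "norm y < r" for y
  proof -
    have "x0 + y \<in> ball x0 r" using y by (simp add: dist_norm)
    then have "N (x0 + y) \<le> real n" using r(2) by (auto simp: G_def)
    moreover have "N ((x0 + y) + (-1) *\<^sub>R x0) \<le> N (x0 + y) + N ((-1) *\<^sub>R x0)" by (rule tri)
    ultimately show ?thesis using x0 unfolding sc by simp
  qed
  \<comment> \<open>Rescaling \<open>x\<close> to norm \<open>r / 2\<close> contributes the second
    factor 2.\<close>
  have "N x \<le> 4 * real n / r * norm x" for x
  proof (cases "x = 0")
    case True
    then show ?thesis using sc[of 0 x] by simp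
  next
    case False
    define t where "t = r / (2 * norm x)"
    have t: "t > 0" using r False by (simp add: t_def)
    have "norm (t *\<^sub>R x) < r" using r False by (simp add: t_def)
    from small[OF this] have "t * N x \<le> 2 * real n" using t by (simp add: sc)
    then have "N x \<le> 2 * real n / t" using t by (simp add: field_simps)
    also have "\<dots> = 4 * real n / r * norm x" using r False by (simp add: t_def)
    finally show ?thesis .
  qed
  then show ?thesis using that[of "4 * real n / r"] r by simp
qed

text \<open>The \<open>L^1\<close> seminorm of the family has closed sublevel sets by Fatou's lemma,
  so integrability for each \<open>x\<close> and continuity in \<open>x\<close> for each
  \<open>\<sigma>\<close> already give a uniform bound.\<close>

lemma integrable_family_bounded:
  fixes f :: "'x::banach \<Rightarrow> 's \<Rightarrow> complex"
  assumes int: "\<And>x. integrable M (f x)"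
    and tri: "\<And>x y \<sigma>. \<sigma> \<in> space M \<Longrightarrow> cmod (f (x + y) \<sigma>) \<le> cmod (f x \<sigma>) + cmod (f y \<sigma>)"
    and sc: "\<And>r x \<sigma>. \<sigma> \<in> space M \<Longrightarrow> cmod (f (r *\<^sub>R x) \<sigma>) = \<bar>r\<bar> * cmod (f x \<sigma>)"
    and cont: "\<And>X x \<sigma>. \<lbrakk>\<sigma> \<in> space M; X \<longlonglongrightarrow> x\<rbrakk> \<Longrightarrow> (\<lambda>n. f (X n) \<sigma>) \<longlonglongrightarrow> f x \<sigma>"
  obtains C where "0 \<le> C" "\<And>x. (\<integral>\<sigma>. cmod (f x \<sigma>) \<partial>M) \<le> C * norm x"
proof (rule lsc_seminorm_bounded[of "\<lambda>x. \<integral>\<sigma>. cmod (f x \<sigma>) \<partial>M"])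
  have int': "integrable M (\<lambda>\<sigma>. cmod (f x \<sigma>))" for x using int by simp
  show "(\<integral>\<sigma>. cmod (f (x + y) \<sigma>) \<partial>M) \<le> (\<integral>\<sigma>. cmod (f x \<sigma>) \<partial>M) + (\<integral>\<sigma>. cmod (f y \<sigma>) \<partial>M)" for x y
  proof -
    have "(\<integral>\<sigma>. cmod (f (x + y) \<sigma>) \<partial>M) \<le> (\<integral>\<sigma>. cmod (f x \<sigma>) + cmod (f y \<sigma>) \<partial>M)"
      by (intro integral_mono Bochner_Integration.integrable_add int' tri)
    then show ?thesis by (simp add: Bochner_Integration.integral_add[OF int' int'])
  qed
  show "(\<integral>\<sigma>. cmod (f (r *\<^sub>R x) \<sigma>) \<partial>M) = \<bar>r\<bar> * (\<integral>\<sigma>. cmod (f x \<sigma>) \<partial>M)" for r x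
  proof -
    have "(\<integral>\<sigma>. cmod (f (r *\<^sub>R x) \<sigma>) \<partial>M) = (\<integral>\<sigma>. \<bar>r\<bar> * cmod (f x \<sigma>) \<partial>M)"
      by (rule Bochner_Integration.integral_cong) (auto simp: sc)
    then show ?thesis by simp
  qed
  have eq: "ennreal (\<integral>\<sigma>. cmod (f x \<sigma>) \<partial>M) = (\<integral>\<^sup>+\<sigma>. ennreal (cmod (f x \<sigma>)) \<partial>M)" for x
    using int' by (subst nn_integral_eq_integral) auto
  show "closed {x. (\<integral>\<sigma>. cmod (f x \<sigma>) \<partial>M) \<le> c}" for c
    unfolding closed_sequential_limits
  proof (intro allI impI, elim conjE)
    fix X l assume X: "\<forall>n. X n \<in> {x. (\<integral>\<sigma>. cmod (f x \<sigma>) \<partial>M) \<le> c}" and l: "X \<longlonglongrightarrow> l"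
    have c0: "0 \<le> c"
    proof -
      have "0 \<le> (\<integral>\<sigma>. cmod (f (X 0) \<sigma>) \<partial>M)" by simp
      then show ?thesis using X order_trans by blast
    qed
    have [measurable]: "f x \<in> borel_measurable M" for x using int by auto
    have "(\<integral>\<^sup>+\<sigma>. ennreal (cmod (f l \<sigma>)) \<partial>M) = (\<integral>\<^sup>+\<sigma>. liminf (\<lambda>n. ennreal (cmod (f (X n) \<sigma>))) \<partial>M)"
    proof (rule nn_integral_cong)
      fix \<sigma> assume "\<sigma> \<in> space M"
      then have "(\<lambda>n. ennreal (cmod (f (X n) \<sigma>))) \<longlonglongrightarrow> ennreal (cmod (f l \<sigma>))"
        by (intro tendsto_ennrealI tendsto_norm cont l)
      then show "ennreal (cmod (f l \<sigma>)) = liminf (\<lambda>n. ennreal (cmod (f (X n) \<sigma>)))"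
        by (metis lim_imp_Liminf sequentially_bot)
    qed
    also have "\<dots> \<le> liminf (\<lambda>n. \<integral>\<^sup>+\<sigma>. ennreal (cmod (f (X n) \<sigma>)) \<partial>M)"
      by (rule nn_integral_liminf) simp
    also have "\<dots> \<le> liminf (\<lambda>n. ennreal c)"
      by (rule Liminf_mono) (use X in \<open>simp add: eq[symmetric] ennreal_leI\<close>)
    also have "\<dots> = ennreal c" by (simp add: Liminf_const)
    finally show "l \<in> {x. (\<integral>\<sigma>. cmod (f x \<sigma>) \<partial>M) \<le> c}" using c0 by (simp add: eq[symmetric])
  qed
qed (use that in auto)

text \<open>Boundedness in each variable implies joint boundedness: for fixed \<open>k\<close> the
  form is represented by a vector \<open>T k\<close>, and the sublevel sets of
  \<open>norm (T k)\<close> are closed by continuity in the other variable.\<close>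

lemma separately_bounded_sesquilinear_rep:
  fixes b :: "'h::complex_hilbert \<Rightarrow> 'k::complex_hilbert \<Rightarrow> complex"
  assumes lin: "\<And>x y k. b (x + y) k = b x k + b y k" "\<And>c x k. b (c *\<^sub>C x) k = c * b x k"
    "\<And>h x y. b h (x + y) = b h x + b h y" "\<And>h c x. b h (c *\<^sub>C x) = cnj c * b h x"
    and bl: "\<And>k. \<exists>C\<ge>0. \<forall>h. cmod (b h k) \<le> C * norm h"
    and br: "\<And>h. \<exists>C\<ge>0. \<forall>k. cmod (b h k) \<le> C * norm k"
  obtains R where "R \<in> bops" "\<And>h k. cinner (blinfun_apply R h) k = b h k"
proof -
  have "\<exists>t. \<forall>h. b h k = cinner h t" for k
  proof -
    obtain C where C: "0 \<le> C" "\<And>h. cmod (b h k) \<le> C * norm h" using bl by blast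
    obtain t where "\<And>h. b h k = cinner h t"
      by (rule Riesz_complex[of UNIV "\<lambda>x. x" "\<lambda>h. b h k" C])
         (use C lin in \<open>auto simp: clinear_on_def\<close>)
    then show ?thesis by blast
  qed
  then obtain T where T: "\<And>h k. b h k = cinner h (T k)" by metis
  have T_add: "T (x + y) = T x + T y" for x y
  proof (rule cinner_eqI)
    fix z show "cinner (T (x + y)) z = cinner (T x + T y) z"
      using T[of z "x + y"] T[of z x] T[of z y] lin(3)[of z x y]
      by (metis cinner_add_right cinner_commute)
  qed
  have T_sc: "T (c *\<^sub>C x) = c *\<^sub>C T x" for c x
  proof (rule cinner_eqI)
    fix z show "cinner (T (c *\<^sub>C x)) z = cinner (c *\<^sub>C T x) z"
      using T[of z "c *\<^sub>C x"] T[of z x] lin(4)[of z c x]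
      by (metis cinner_scaleC_right cinner_commute)
  qed
  obtain C where C: "0 \<le> C" "\<And>k. norm (T k) \<le> C * norm k"
  proof (rule lsc_seminorm_bounded[of "\<lambda>k. norm (T k)"])
    show "norm (T (x + y)) \<le> norm (T x) + norm (T y)" for x y by (simp add: T_add norm_triangle_ineq)
    show "norm (T (r *\<^sub>R x)) = \<bar>r\<bar> * norm (T x)" for r x by (simp add: scaleR_scaleC T_sc norm_scaleC)
    show "closed {x. norm (T x) \<le> c}" for c
      unfolding closed_sequential_limits
    proof (intro allI impI, elim conjE)
      fix X l assume X: "\<forall>n. X n \<in> {x. norm (T x) \<le> c}" and l: "X \<longlonglongrightarrow> l"
      \<comment> \<open>The limit point is tested against its own image: \<open>|T l|^2\<close> is
        the limit of \<open>|b (T l) (X n)|\<close>, which is at most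
        \<open>|T l| c\<close>.\<close>
      define h where "h = T l"
      obtain D where D: "0 \<le> D" "\<And>k. cmod (b h k) \<le> D * norm k" using br by blast
      have "(\<lambda>n. b h (X n)) \<longlonglongrightarrow> b h l"
      proof (rule Lim_transform_bound[THEN LIM_zero_cancel])
        show "\<forall>\<^sub>F n in sequentially. norm (b h (X n) - b h l) \<le> norm (D * norm (X n - l))"
        proof (intro always_eventually allI)
          fix n
          have "b h (X n - l) = b h (X n) - b h l"
            using lin(3)[of h "X n - l" l] by simp
          then show "norm (b h (X n) - b h l) \<le> norm (D * norm (X n - l))"
            using D(2)[of "X n - l"] D(1) by simp
        qed
        show "(\<lambda>n. D * norm (X n - l)) \<longlonglongrightarrow> 0"
          using tendsto_mult_right_zero[OF tendsto_norm_zero[OF LIM_zero[OF l]]] .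
      qed
      then have "(\<lambda>n. cmod (b h (X n))) \<longlonglongrightarrow> cmod (b h l)" by (rule tendsto_norm)
      then have "cmod (b h l) \<le> norm h * c"
      proof (rule LIMSEQ_le_const2)
        have "cmod (b h (X n)) \<le> norm h * c" for n
          using norm_cinner_le[of h "T (X n)"] X mult_left_mono[of "norm (T (X n))" c "norm h"]
          by (simp add: T)
        then show "\<exists>N. \<forall>n\<ge>N. cmod (b h (X n)) \<le> norm h * c" by blast
      qed
      then have "norm h * norm h \<le> norm h * c"
        by (simp add: T h_def cinner_self power2_eq_square norm_mult)
      moreover have "0 \<le> c" using X norm_ge_zero[of "T (X 0)"] order_trans by blast
      ultimately have "norm h \<le> c" by (metis mult_left_le_imp_le norm_ge_zero order_le_less)
      then show "l \<in> {x. norm (T x) \<le> c}" by (simp add: h_def)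
    qed
  qed auto
  have bd: "cmod (b h k) \<le> C * norm h * norm k" for h k
    using norm_cinner_le[of h "T k"] mult_left_mono[OF C(2), of "norm h" k]
    by (simp add: T mult_ac)
  show ?thesis
    by (rule bops_sesquilinear_rep[of b C]) (use lin bd C that in auto)
qed

section \<open>The pointwise Pettis integral\<close>

lemma integrable_complex_iff:
  "integrable M f \<longleftrightarrow> f \<in> borel_measurable M \<and> (\<integral>\<^sup>+\<sigma>. ennreal (cmod (f \<sigma>)) \<partial>M) < \<infinity>"
  for f :: "'s \<Rightarrow> complex"
  by (rule integrable_iff_bounded)

lemma pw_Pettis_integrable_iff:
  "pw_Pettis_integrable M F \<longleftrightarrow> (\<forall>h k. integrable M (\<lambda>\<sigma>. cinner (blinfun_apply (F \<sigma>) h) k))"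
  by (auto simp: pw_Pettis_integrable_def pw_weakly_measurable_def integrable_complex_iff)

lemma LINT_add:
  fixes f g :: "'s \<Rightarrow> complex"
  assumes "integrable M f" "integrable M g" "S \<in> sets M"
  shows "(LINT \<sigma>:S|M. f \<sigma> + g \<sigma>) = (LINT \<sigma>:S|M. f \<sigma>) + (LINT \<sigma>:S|M. g \<sigma>)"
  using assms by (intro set_integral_add(2)) (auto simp: set_integrable_def intro: integrable_mult_indicator)

lemma LINT_diff:
  fixes f g :: "'s \<Rightarrow> complex"
  assumes "integrable M f" "integrable M g" "S \<in> sets M"
  shows "(LINT \<sigma>:S|M. f \<sigma> - g \<sigma>) = (LINT \<sigma>:S|M. f \<sigma>) - (LINT \<sigma>:S|M. g \<sigma>)"
  using assms by (intro set_integral_diff(2)) (auto simp: set_integrable_def intro: integrable_mult_indicator)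

lemma LINT_sum:
  fixes f :: "'i \<Rightarrow> 's \<Rightarrow> complex"
  assumes "\<And>i. i \<in> I \<Longrightarrow> integrable M (f i)" "S \<in> sets M"
  shows "(LINT \<sigma>:S|M. \<Sum>i\<in>I. f i \<sigma>) = (\<Sum>i\<in>I. LINT \<sigma>:S|M. f i \<sigma>)"
  unfolding set_lebesgue_integral_def scaleR_sum_right
  using assms by (intro Bochner_Integration.integral_sum integrable_mult_indicator) auto

lemma LINT_cong_space:
  assumes "S \<in> sets M" "\<And>\<sigma>. \<sigma> \<in> space M \<Longrightarrow> f \<sigma> = g \<sigma>"
  shows "(LINT \<sigma>:S|M. f \<sigma>) = (LINT \<sigma>:S|M. g \<sigma>)"
  using assms sets.sets_into_space by (intro set_lebesgue_integral_cong) auto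

lemma cmod_LINT_le:
  fixes f :: "'s \<Rightarrow> complex"
  assumes "integrable M f" "S \<in> sets M"
  shows "cmod (LINT \<sigma>:S|M. f \<sigma>) \<le> (\<integral>\<sigma>. cmod (f \<sigma>) \<partial>M)"
proof -
  have "cmod (LINT \<sigma>:S|M. f \<sigma>) \<le> (\<integral>\<sigma>. norm (indicator S \<sigma> *\<^sub>R f \<sigma>) \<partial>M)"
    unfolding set_lebesgue_integral_def by (rule integral_norm_bound)
  also have "\<dots> \<le> (\<integral>\<sigma>. cmod (f \<sigma>) \<partial>M)"
    using assms by (intro integral_mono integrable_norm integrable_mult_indicator) (auto simp: indicator_def)
  finally show ?thesis .
qed

lemma pw_Pettis_integral_eqI:
  assumes "R \<in> bops" "\<And>h k. cinner (blinfun_apply R h) k = (LINT \<sigma>:S|M. cinner (blinfun_apply (F \<sigma>) h) k)"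
  shows "pw_Pettis_integral M F S = R"
  unfolding pw_Pettis_integral_def
  by (rule the_equality) (use assms in \<open>auto intro: bops_eqI\<close>)

text \<open>The function \<open>norm (F \<sigma>)\<close> may be neither measurable nor integrable,
  so no direct norm estimate is available. The integrated form is bounded in each variable
  separately, by uniform boundedness for the family of integrands, and that already yields an
  operator.\<close>

lemma pw_Pettis_integral:
  assumes F: "pw_Pettis_integrable M F" "F \<in> space M \<rightarrow> bops" and S: "S \<in> sets M"
  shows "pw_Pettis_integral M F S \<in> bops"
    "cinner (blinfun_apply (pw_Pettis_integral M F S) h) k = (LINT \<sigma>:S|M. cinner (blinfun_apply (F \<sigma>) h) k)"
proof -
  have int: "integrable M (\<lambda>\<sigma>. cinner (blinfun_apply (F \<sigma>) h) k)" for h k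
    using F(1) by (simp add: pw_Pettis_integrable_iff)
  have Fb: "F \<sigma> \<in> bops" if "\<sigma> \<in> space M" for \<sigma> using F(2) that by auto
  define b where "b h k = (LINT \<sigma>:S|M. cinner (blinfun_apply (F \<sigma>) h) k)" for h k
  obtain R where R: "R \<in> bops" "\<And>h k. cinner (blinfun_apply R h) k = b h k"
  proof (rule separately_bounded_sesquilinear_rep[of b])
    show "b (x + y) k = b x k + b y k" for x y k
      unfolding b_def by (simp add: blinfun.add_right cinner_add_left LINT_add int S)
    show "b h (x + y) = b h x + b h y" for h x y
      unfolding b_def by (simp add: cinner_add_right LINT_add int S)
    show "b (c *\<^sub>C x) k = c * b x k" for c x k
    proof -
      have "b (c *\<^sub>C x) k = (LINT \<sigma>:S|M. c * cinner (blinfun_apply (F \<sigma>) x) k)"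
        unfolding b_def by (rule LINT_cong_space[OF S]) (simp add: bopsD[OF Fb] cinner_scaleC_left)
      then show ?thesis by (simp add: b_def)
    qed
    show "b h (c *\<^sub>C x) = cnj c * b h x" for c h x
      unfolding b_def by (simp add: cinner_scaleC_right)
    show "\<exists>C\<ge>0. \<forall>h. cmod (b h k) \<le> C * norm h" for k
    proof -
      obtain C where C: "0 \<le> C" "\<And>h. (\<integral>\<sigma>. cmod (cinner (blinfun_apply (F \<sigma>) h) k) \<partial>M) \<le> C * norm h"
      proof (rule integrable_family_bounded[of M "\<lambda>h \<sigma>. cinner (blinfun_apply (F \<sigma>) h) k"])
        show "cmod (cinner (blinfun_apply (F \<sigma>) (x + y)) k) \<le> cmod (cinner (blinfun_apply (F \<sigma>) x) k) + cmod (cinner (blinfun_apply (F \<sigma>) y) k)" for x y \<sigma>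
          by (simp add: blinfun.add_right cinner_add_left norm_triangle_ineq)
        show "(\<lambda>n. cinner (blinfun_apply (F \<sigma>) (X n)) k) \<longlonglongrightarrow> cinner (blinfun_apply (F \<sigma>) x) k"
          if "X \<longlonglongrightarrow> x" for X x \<sigma> by (intro tendsto_intros that)
      qed (auto simp: int blinfun.scaleR_right cinner_scaleR_left norm_mult)
      then show ?thesis using cmod_LINT_le[OF int S] unfolding b_def by (meson order_trans)
    qed
    show "\<exists>C\<ge>0. \<forall>k. cmod (b h k) \<le> C * norm k" for h
    proof -
      obtain C where C: "0 \<le> C" "\<And>k. (\<integral>\<sigma>. cmod (cinner (blinfun_apply (F \<sigma>) h) k) \<partial>M) \<le> C * norm k"
      proof (rule integrable_family_bounded[of M "\<lambda>k \<sigma>. cinner (blinfun_apply (F \<sigma>) h) k"])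
        show "cmod (cinner (blinfun_apply (F \<sigma>) h) (x + y)) \<le> cmod (cinner (blinfun_apply (F \<sigma>) h) x) + cmod (cinner (blinfun_apply (F \<sigma>) h) y)" for x y \<sigma>
          by (simp add: cinner_add_right norm_triangle_ineq)
        show "(\<lambda>n. cinner (blinfun_apply (F \<sigma>) h) (X n)) \<longlonglongrightarrow> cinner (blinfun_apply (F \<sigma>) h) x"
          if "X \<longlonglongrightarrow> x" for X x \<sigma> by (intro tendsto_intros that)
      qed (auto simp: int cinner_scaleR_right norm_mult)
      then show ?thesis using cmod_LINT_le[OF int S] unfolding b_def by (meson order_trans)
    qed
  qed (rule that)
  have "pw_Pettis_integral M F S = R"
    by (rule pw_Pettis_integral_eqI) (use R in \<open>auto simp: b_def\<close>)
  then show "pw_Pettis_integral M F S \<in> bops"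
    "cinner (blinfun_apply (pw_Pettis_integral M F S) h) k = (LINT \<sigma>:S|M. cinner (blinfun_apply (F \<sigma>) h) k)"
    using R by (auto simp: b_def)
qed

section \<open>Gelfand-Pettis integrals in the operator topologies\<close>

context
  fixes V :: "('h::complex_hilbert \<Rightarrow>\<^sub>L 'k::complex_hilbert) set"
  assumes V: "V \<subseteq> bops" "csubspace V"
begin

lemma top_dual_op_cases:
  assumes "l \<in> top_dual (op_topology \<T> V)"
  obtains N :: nat and h k where "\<And>A. A \<in> V \<Longrightarrow> l A = (\<Sum>i<N. cinner (blinfun_apply A (h i)) (k i))"
  using assms unfolding top_dual_op_topology[OF V] by auto

lemma top_dual_opI:
  "(\<lambda>A. if A \<in> V then cinner (blinfun_apply A h) k else 0) \<in> top_dual (op_topology \<T> V)"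
  unfolding top_dual_op_topology[OF V]
  by (rule CollectI, rule exI[of _ "Suc 0"], rule exI[of _ "\<lambda>_. h"], rule exI[of _ "\<lambda>_. k"]) (simp add: fun_eq_iff)

lemma top_dual_sigma_cases:
  assumes "l \<in> top_dual (sigma_op_topology \<T> V)"
  obtains h k where "\<And>A. A \<in> V \<Longrightarrow> l A = cinner (ampl A h) k"
  using assms unfolding top_dual_sigma_op_topology[OF V] by auto

lemma top_dual_sigmaI:
  "(\<lambda>A. if A \<in> V then cinner (ampl A h) k else 0) \<in> top_dual (sigma_op_topology \<T> V)"
  unfolding top_dual_sigma_op_topology[OF V] by blast

text \<open>The explicit form of the predual enters twice: it is closed under addition by
  interleaving, and coefficients are bounded on the unit ball, so that the supremum in
  \<open>functional_norm\<close> is a genuine one.\<close>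

lemma predual_eval_normed_dual:
  assumes A: "A \<in> V" shows "predual_eval V A \<in> normed_dual (predual V) (functional_norm V)"
proof -
  have pre: "predual V = {\<lambda>A. if A \<in> V then cinner (ampl A h) k else 0 |h k. True}"
    unfolding predual_def by (rule top_dual_sigma_op_topology[OF V])
  have cl: "\<And>l l'. \<lbrakk>l \<in> predual V; l' \<in> predual V\<rbrakk> \<Longrightarrow> l + l' \<in> predual V"
  proof -
    fix l l' assume "l \<in> predual V" "l' \<in> predual V"
    then obtain h k h' k' where "l = (\<lambda>A. if A \<in> V then cinner (ampl A h) k else 0)"
      "l' = (\<lambda>A. if A \<in> V then cinner (ampl A h') k' else 0)" unfolding pre by blast
    then have "l + l' = (\<lambda>A. if A \<in> V then cinner (ampl A (interleave h h')) (interleave k k') else 0)"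
      by (auto simp: fun_eq_iff ampl_interleave cinner_interleave)
    then show "l + l' \<in> predual V" unfolding pre by blast
  qed
  have cs: "\<And>c l. l \<in> predual V \<Longrightarrow> c *\<^sub>C l \<in> predual V"
  proof -
    fix c l assume "l \<in> predual V"
    then obtain h k where l: "l = (\<lambda>A. if A \<in> V then cinner (ampl A h) k else 0)" unfolding pre by blast
    have "c *\<^sub>C l = (\<lambda>A. if A \<in> V then cinner (ampl A h) (cnj c *\<^sub>C k) else 0)"
      by (auto simp: l fun_eq_iff scaleC_fun_def scaleC_complex_def cinner_scaleC_right)
    then show "c *\<^sub>C l \<in> predual V" unfolding pre by blast
  qed
  have bound: "cmod (l A) \<le> norm A * functional_norm V l" if l: "l \<in> predual V" for l
  proof -
    obtain h k where l: "l = (\<lambda>A. if A \<in> V then cinner (ampl A h) k else 0)" using l unfolding pre by blast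
    have bdd: "bdd_above ((\<lambda>A. cmod (l A)) ` {A \<in> V. norm A \<le> 1})"
    proof (rule bdd_aboveI2)
      fix B assume B: "B \<in> {A \<in> V. norm A \<le> 1}"
      have "cmod (l B) \<le> norm (ampl B h) * norm k" using B norm_cinner_le by (simp add: l)
      also have "\<dots> \<le> (norm B * norm h) * norm k" by (intro mult_right_mono norm_ampl_le) auto
      also have "\<dots> \<le> (1 * norm h) * norm k" using B by (intro mult_right_mono) auto
      finally show "cmod (l B) \<le> norm h * norm k" by simp
    qed
    show ?thesis
    proof (cases "A = 0")
      case True
      then show ?thesis using A by (simp add: l) (metis ampl_scaleC_left cinner_scaleC_left mult_zero_left scaleC_zero_left)
    next
      case False
      define B where "B = complex_of_real (inverse (norm A)) *\<^sub>C A"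
      have B: "B \<in> V" "norm B \<le> 1"
        using V(2) A False by (auto simp: B_def csubspace_def norm_scaleC_blinfun norm_inverse)
      have "cmod (l B) \<le> functional_norm V l"
        unfolding functional_norm_def by (rule cSUP_upper[OF _ bdd]) (use B in auto)
      moreover have "cmod (l B) = cmod (l A) / norm A"
        using A B(1) by (simp add: l B_def ampl_scaleC_left cinner_scaleC_left norm_mult norm_inverse divide_inverse)
      ultimately show ?thesis using False by (simp add: field_simps)
    qed
  qed
  show ?thesis
    unfolding normed_dual_def
  proof (intro CollectI conjI)
    show "clinear_on (predual V) (predual_eval V A)"
      unfolding clinear_on_def predual_eval_def
      using cl cs by (auto simp: scaleC_fun_def scaleC_complex_def)
    show "\<exists>C. \<forall>w\<in>predual V. cmod (predual_eval V A w) \<le> C * functional_norm V w"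
      using bound by (intro exI[of _ "norm A"]) (simp add: predual_eval_def)
  qed (simp add: predual_eval_def)
qed

end

context
  fixes V :: "('h::complex_hilbert \<Rightarrow>\<^sub>L 'k::complex_hilbert) set" and M :: "'s measure"
    and F :: "'s \<Rightarrow> 'h \<Rightarrow>\<^sub>L 'k"
  assumes V: "V \<subseteq> bops" "csubspace V" and F: "F \<in> space M \<rightarrow> V"
begin

lemma F_in_V: "\<sigma> \<in> space M \<Longrightarrow> F \<sigma> \<in> V"
  using F by auto

lemma weakly_measurable_op_iff:
  "weakly_measurable M (op_topology \<T> V) F \<longleftrightarrow> pw_weakly_measurable M F"
proof
  assume w: "weakly_measurable M (op_topology \<T> V) F"
  show "pw_weakly_measurable M F"
    unfolding pw_weakly_measurable_def
  proof (intro allI)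
    fix h k
    have "(\<lambda>\<sigma>. if F \<sigma> \<in> V then cinner (blinfun_apply (F \<sigma>) h) k else 0) \<in> borel_measurable M"
      using w[unfolded weakly_measurable_def, THEN conjunct2, THEN bspec, OF top_dual_opI[OF V, of h k]] .
    then show "(\<lambda>\<sigma>. cinner (blinfun_apply (F \<sigma>) h) k) \<in> borel_measurable M"
      by (subst (asm) measurable_cong) (auto simp: F_in_V)
  qed
next
  assume w: "pw_weakly_measurable M F"
  show "weakly_measurable M (op_topology \<T> V) F"
    unfolding weakly_measurable_def topspace_op_topology[OF V(1)]
  proof (intro conjI ballI F)
    fix l assume "l \<in> top_dual (op_topology \<T> V)"
    then obtain N :: nat and h k where l: "\<And>A. A \<in> V \<Longrightarrow> l A = (\<Sum>i<N. cinner (blinfun_apply A (h i)) (k i))"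
      using top_dual_op_cases[OF V] by blast
    have "(\<lambda>\<sigma>. \<Sum>i<N. cinner (blinfun_apply (F \<sigma>) (h i)) (k i)) \<in> borel_measurable M"
      using w unfolding pw_weakly_measurable_def by (intro borel_measurable_sum) auto
    then show "(\<lambda>\<sigma>. l (F \<sigma>)) \<in> borel_measurable M"
      by (subst measurable_cong) (auto simp: l F_in_V)
  qed
qed

lemma weakly_measurable_sigma_iff:
  "weakly_measurable M (sigma_op_topology \<T> V) F \<longleftrightarrow> pw_weakly_measurable M F"
proof
  assume w: "weakly_measurable M (sigma_op_topology \<T> V) F"
  show "pw_weakly_measurable M F"
    unfolding pw_weakly_measurable_def
  proof (intro allI)
    fix h k
    have "(\<lambda>\<sigma>. if F \<sigma> \<in> V then cinner (ampl (F \<sigma>) (single_l2 h)) (single_l2 k) else 0) \<in> borel_measurable M"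
      using w[unfolded weakly_measurable_def, THEN conjunct2, THEN bspec, OF top_dual_sigmaI[OF V, of "single_l2 h" "single_l2 k"]] .
    then show "(\<lambda>\<sigma>. cinner (blinfun_apply (F \<sigma>) h) k) \<in> borel_measurable M"
      by (subst (asm) measurable_cong) (auto simp: F_in_V ampl_single cinner_single)
  qed
next
  assume w: "pw_weakly_measurable M F"
  show "weakly_measurable M (sigma_op_topology \<T> V) F"
    unfolding weakly_measurable_def topspace_sigma_op_topology[OF V(1)]
  proof (intro conjI ballI F)
    fix l assume "l \<in> top_dual (sigma_op_topology \<T> V)"
    then obtain h k where l: "\<And>A. A \<in> V \<Longrightarrow> l A = cinner (ampl A h) k"
      using top_dual_sigma_cases[OF V] by blast
    have "(\<lambda>\<sigma>. cinner (ampl (F \<sigma>) h) k) \<in> borel_measurable M"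
      using w unfolding pw_weakly_measurable_def by (intro measurable_ampl) auto
    then show "(\<lambda>\<sigma>. l (F \<sigma>)) \<in> borel_measurable M"
      by (subst measurable_cong) (auto simp: l F_in_V)
  qed
qed

text \<open>Functionals on \<open>V\<close> are finite sums of coefficients, and integrability of
  the coefficients lets the integral be split accordingly.\<close>

lemma is_GP_integral_op_iff:
  assumes "pw_Pettis_integrable M F" "S \<in> sets M"
  shows "is_GP_integral M (op_topology \<T> V) F S I \<longleftrightarrow> I \<in> V \<and>
    (\<forall>h k. cinner (blinfun_apply I h) k = (LINT \<sigma>:S|M. cinner (blinfun_apply (F \<sigma>) h) k))"
proof
  assume g: "is_GP_integral M (op_topology \<T> V) F S I"
  then have I: "I \<in> V" by (simp add: is_GP_integral_def topspace_op_topology[OF V(1)])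
  have "cinner (blinfun_apply I h) k = (LINT \<sigma>:S|M. cinner (blinfun_apply (F \<sigma>) h) k)" for h k
  proof -
    have "(if I \<in> V then cinner (blinfun_apply I h) k else 0)
        = (LINT \<sigma>:S|M. if F \<sigma> \<in> V then cinner (blinfun_apply (F \<sigma>) h) k else 0)"
      using g[unfolded is_GP_integral_def, THEN conjunct2, THEN bspec, OF top_dual_opI[OF V, of h k]] .
    also have "\<dots> = (LINT \<sigma>:S|M. cinner (blinfun_apply (F \<sigma>) h) k)"
      by (rule LINT_cong_space[OF assms(2)]) (simp add: F_in_V)
    finally show ?thesis using I by simp
  qed
  then show "I \<in> V \<and> (\<forall>h k. cinner (blinfun_apply I h) k = (LINT \<sigma>:S|M. cinner (blinfun_apply (F \<sigma>) h) k))"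
    using I by blast
next
  assume R: "I \<in> V \<and> (\<forall>h k. cinner (blinfun_apply I h) k = (LINT \<sigma>:S|M. cinner (blinfun_apply (F \<sigma>) h) k))"
  show "is_GP_integral M (op_topology \<T> V) F S I"
    unfolding is_GP_integral_def topspace_op_topology[OF V(1)]
  proof (intro conjI ballI)
    fix l assume "l \<in> top_dual (op_topology \<T> V)"
    then obtain N :: nat and h k where l: "\<And>A. A \<in> V \<Longrightarrow> l A = (\<Sum>i<N. cinner (blinfun_apply A (h i)) (k i))"
      using top_dual_op_cases[OF V] by blast
    have "(LINT \<sigma>:S|M. l (F \<sigma>)) = (LINT \<sigma>:S|M. \<Sum>i<N. cinner (blinfun_apply (F \<sigma>) (h i)) (k i))"
      by (rule LINT_cong_space[OF assms(2)]) (simp add: l F_in_V)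
    also have "\<dots> = (\<Sum>i<N. LINT \<sigma>:S|M. cinner (blinfun_apply (F \<sigma>) (h i)) (k i))"
      using assms by (intro LINT_sum) (auto simp: pw_Pettis_integrable_iff)
    finally show "l I = (LINT \<sigma>:S|M. l (F \<sigma>))" using R l by simp
  qed (use R in blast)
qed

lemma is_GP_integral_sigma_iff:
  assumes S: "S \<in> sets M"
  shows "is_GP_integral M (sigma_op_topology \<T> V) F S I \<longleftrightarrow> I \<in> V \<and>
    (\<forall>h k. cinner (ampl I h) k = (LINT \<sigma>:S|M. cinner (ampl (F \<sigma>) h) k))"
proof
  assume g: "is_GP_integral M (sigma_op_topology \<T> V) F S I"
  then have I: "I \<in> V" by (simp add: is_GP_integral_def topspace_sigma_op_topology[OF V(1)])
  have "cinner (ampl I h) k = (LINT \<sigma>:S|M. cinner (ampl (F \<sigma>) h) k)" for h k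
  proof -
    have "(if I \<in> V then cinner (ampl I h) k else 0)
        = (LINT \<sigma>:S|M. if F \<sigma> \<in> V then cinner (ampl (F \<sigma>) h) k else 0)"
      using g[unfolded is_GP_integral_def, THEN conjunct2, THEN bspec, OF top_dual_sigmaI[OF V, of h k]] .
    also have "\<dots> = (LINT \<sigma>:S|M. cinner (ampl (F \<sigma>) h) k)"
      by (rule LINT_cong_space[OF S]) (simp add: F_in_V)
    finally show ?thesis using I by simp
  qed
  then show "I \<in> V \<and> (\<forall>h k. cinner (ampl I h) k = (LINT \<sigma>:S|M. cinner (ampl (F \<sigma>) h) k))"
    using I by blast
next
  assume R: "I \<in> V \<and> (\<forall>h k. cinner (ampl I h) k = (LINT \<sigma>:S|M. cinner (ampl (F \<sigma>) h) k))"
  show "is_GP_integral M (sigma_op_topology \<T> V) F S I"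
    unfolding is_GP_integral_def topspace_sigma_op_topology[OF V(1)]
  proof (intro conjI ballI)
    fix l assume "l \<in> top_dual (sigma_op_topology \<T> V)"
    then obtain h k where l: "\<And>A. A \<in> V \<Longrightarrow> l A = cinner (ampl A h) k"
      using top_dual_sigma_cases[OF V] by blast
    have "(LINT \<sigma>:S|M. l (F \<sigma>)) = (LINT \<sigma>:S|M. cinner (ampl (F \<sigma>) h) k)"
      by (rule LINT_cong_space[OF S]) (simp add: l F_in_V)
    then show "l I = (LINT \<sigma>:S|M. l (F \<sigma>))" using R l by simp
  qed (use R in blast)
qed

text \<open>Coefficients at the vectors \<open>single_l2 h\<close> already determine an operator,
  which gives uniqueness.\<close>

lemma GP_integral_sigma_eqI:
  assumes S: "S \<in> sets M" and I: "is_GP_integral M (sigma_op_topology \<T> V) F S I"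
  shows "GP_integral M (sigma_op_topology \<T> V) F S = I"
  unfolding GP_integral_def
proof (rule the_equality)
  show "is_GP_integral M (sigma_op_topology \<T> V) F S I" by (rule I)
  fix J assume "is_GP_integral M (sigma_op_topology \<T> V) F S J"
  then have "cinner (ampl J (single_l2 h)) (single_l2 k) = cinner (ampl I (single_l2 h)) (single_l2 k)" for h k
    using I unfolding is_GP_integral_sigma_iff[OF S] by simp
  then show "J = I" unfolding ampl_single cinner_single by (rule bops_eqI)
qed

lemma GP_integrable_op_iff:
  "GP_integrable M (op_topology \<T> V) F \<longleftrightarrow> pw_Pettis_integrable_in M V F"
proof
  assume G: "GP_integrable M (op_topology \<T> V) F"
  have pwm: "pw_weakly_measurable M F"
    using G weakly_measurable_op_iff unfolding GP_integrable_def by blast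
  have "(\<integral>\<^sup>+\<sigma>. ennreal (cmod (cinner (blinfun_apply (F \<sigma>) h) k)) \<partial>M) < \<infinity>" for h k
  proof -
    have "(\<integral>\<^sup>+\<sigma>. ennreal (cmod (if F \<sigma> \<in> V then cinner (blinfun_apply (F \<sigma>) h) k else 0)) \<partial>M) < \<infinity>"
      using G[unfolded GP_integrable_def, THEN conjunct2, THEN conjunct1, THEN bspec, OF top_dual_opI[OF V, of h k]] .
    moreover have "(\<integral>\<^sup>+\<sigma>. ennreal (cmod (if F \<sigma> \<in> V then cinner (blinfun_apply (F \<sigma>) h) k else 0)) \<partial>M)
        = (\<integral>\<^sup>+\<sigma>. ennreal (cmod (cinner (blinfun_apply (F \<sigma>) h) k)) \<partial>M)"
      by (rule nn_integral_cong) (simp add: F_in_V)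
    ultimately show ?thesis by simp
  qed
  then have pw: "pw_Pettis_integrable M F" using pwm by (simp add: pw_Pettis_integrable_def)
  have "pw_Pettis_integral M F S \<in> V" if S: "S \<in> sets M" for S
  proof -
    obtain I where "is_GP_integral M (op_topology \<T> V) F S I"
      using G S unfolding GP_integrable_def by blast
    then have I: "I \<in> V" "\<And>h k. cinner (blinfun_apply I h) k = (LINT \<sigma>:S|M. cinner (blinfun_apply (F \<sigma>) h) k)"
      unfolding is_GP_integral_op_iff[OF pw S] by auto
    then have "pw_Pettis_integral M F S = I" using V by (intro pw_Pettis_integral_eqI) auto
    then show ?thesis using I by simp
  qed
  then show "pw_Pettis_integrable_in M V F" using pw F by (simp add: pw_Pettis_integrable_in_def)
next
  assume P: "pw_Pettis_integrable_in M V F"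
  then have pw: "pw_Pettis_integrable M F" by (simp add: pw_Pettis_integrable_in_def)
  show "GP_integrable M (op_topology \<T> V) F"
    unfolding GP_integrable_def
  proof (intro conjI ballI)
    show "weakly_measurable M (op_topology \<T> V) F"
      using pw by (simp add: weakly_measurable_op_iff pw_Pettis_integrable_def)
    fix l assume "l \<in> top_dual (op_topology \<T> V)"
    then obtain N :: nat and h k where l: "\<And>A. A \<in> V \<Longrightarrow> l A = (\<Sum>i<N. cinner (blinfun_apply A (h i)) (k i))"
      using top_dual_op_cases[OF V] by blast
    have "integrable M (\<lambda>\<sigma>. \<Sum>i<N. cinner (blinfun_apply (F \<sigma>) (h i)) (k i))"
      using pw by (intro Bochner_Integration.integrable_sum) (auto simp: pw_Pettis_integrable_iff)
    then have "(\<integral>\<^sup>+\<sigma>. ennreal (cmod (\<Sum>i<N. cinner (blinfun_apply (F \<sigma>) (h i)) (k i))) \<partial>M) < \<infinity>"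
      unfolding integrable_complex_iff by blast
    moreover have "(\<integral>\<^sup>+\<sigma>. ennreal (cmod (l (F \<sigma>))) \<partial>M)
        = (\<integral>\<^sup>+\<sigma>. ennreal (cmod (\<Sum>i<N. cinner (blinfun_apply (F \<sigma>) (h i)) (k i))) \<partial>M)"
      by (rule nn_integral_cong) (simp add: F_in_V l)
    ultimately show "(\<integral>\<^sup>+\<sigma>. ennreal (cmod (l (F \<sigma>))) \<partial>M) < \<infinity>" by simp
  next
    fix S assume S: "S \<in> sets M"
    have "F \<in> space M \<rightarrow> bops" using F V by auto
    then have "is_GP_integral M (op_topology \<T> V) F S (pw_Pettis_integral M F S)"
      unfolding is_GP_integral_op_iff[OF pw S]
      using P S pw_Pettis_integral(2)[OF pw _ S] by (auto simp: pw_Pettis_integrable_in_def)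
    then show "\<exists>I. is_GP_integral M (op_topology \<T> V) F S I" by blast
  qed
qed

lemma GP_integral_op_eq:
  assumes P: "pw_Pettis_integrable_in M V F" and S: "S \<in> sets M"
  shows "GP_integral M (op_topology \<T> V) F S = pw_Pettis_integral M F S"
proof -
  have pw: "pw_Pettis_integrable M F" using P by (simp add: pw_Pettis_integrable_in_def)
  have Fb: "F \<in> space M \<rightarrow> bops" using F V by auto
  show ?thesis unfolding GP_integral_def
  proof (rule the_equality)
    show "is_GP_integral M (op_topology \<T> V) F S (pw_Pettis_integral M F S)"
      unfolding is_GP_integral_op_iff[OF pw S]
      using P S pw_Pettis_integral(2)[OF pw Fb S] by (auto simp: pw_Pettis_integrable_in_def)
    fix J assume "is_GP_integral M (op_topology \<T> V) F S J"
    then show "J = pw_Pettis_integral M F S"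
      unfolding is_GP_integral_op_iff[OF pw S]
      by (intro bops_eqI) (simp add: pw_Pettis_integral(2)[OF pw Fb S])
  qed
qed

text \<open>The norm of \<open>F\<close> may fail to be measurable, but for \<open>h\<close> and
  \<open>k\<close> in the unit ball the measurable function
  \<open>|\<langle>F h, k\<rangle>|\<close> lies below it and competes in the lower integral. The
  norm of the integral is a supremum of such coefficients.\<close>

lemma norm_pw_Pettis_integral_le:
  assumes pw: "pw_Pettis_integrable M F"
  shows "ennreal (norm (pw_Pettis_integral M F (space M))) \<le> lower_integral M (\<lambda>\<sigma>. ennreal (norm (F \<sigma>)))"
proof -
  have Fb: "F \<in> space M \<rightarrow> bops" using F V by auto
  define R where "R = pw_Pettis_integral M F (space M)"
  define L where "L = lower_integral M (\<lambda>\<sigma>. ennreal (norm (F \<sigma>)))"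
  have int: "integrable M (\<lambda>\<sigma>. cinner (blinfun_apply (F \<sigma>) h) k)" for h k
    using pw by (simp add: pw_Pettis_integrable_iff)
  have unit: "ennreal (cmod (cinner (blinfun_apply R h) k)) \<le> L" if h: "norm h \<le> 1" and k: "norm k \<le> 1" for h k
  proof -
    have "cinner (blinfun_apply R h) k = (\<integral>\<sigma>. cinner (blinfun_apply (F \<sigma>) h) k \<partial>M)"
      using pw_Pettis_integral(2)[OF pw Fb, of "space M" h k] by (simp add: R_def set_integral_space int)
    then have "ennreal (cmod (cinner (blinfun_apply R h) k)) \<le> (\<integral>\<^sup>+\<sigma>. ennreal (cmod (cinner (blinfun_apply (F \<sigma>) h) k)) \<partial>M)"
      using integral_norm_bound_ennreal[OF int] by simp
    also have "\<dots> \<le> L"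
      unfolding L_def lower_integral_def
    proof (rule Sup_upper, rule CollectI, intro exI conjI)
      show "(\<lambda>\<sigma>. ennreal (cmod (cinner (blinfun_apply (F \<sigma>) h) k))) \<in> borel_measurable M"
        using int[of h k] by (auto dest: borel_measurable_integrable)
      show "AE \<sigma> in M. ennreal (cmod (cinner (blinfun_apply (F \<sigma>) h) k)) \<le> ennreal (norm (F \<sigma>))"
      proof (intro always_eventually allI ennreal_leI)
        fix \<sigma>
        have "cmod (cinner (blinfun_apply (F \<sigma>) h) k) \<le> norm (blinfun_apply (F \<sigma>) h) * norm k" by (rule norm_cinner_le)
        also have "\<dots> \<le> (norm (F \<sigma>) * norm h) * norm k" by (intro mult_right_mono norm_blinfun) auto
        also have "\<dots> \<le> (norm (F \<sigma>) * 1) * 1" using h k by (intro mult_mono) auto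
        finally show "cmod (cinner (blinfun_apply (F \<sigma>) h) k) \<le> norm (F \<sigma>)" by simp
      qed
    qed simp
    finally show ?thesis .
  qed
  show ?thesis
  proof (cases "L = \<infinity>")
    case False
    then obtain c where c: "L = ennreal c" "0 \<le> c" by (cases L) auto
    have "norm R \<le> c"
    proof (rule norm_blinfun_bound[OF c(2)])
      fix x
      let ?y = "blinfun_apply R x"
      show "norm ?y \<le> c * norm x"
      proof (cases "x = 0 \<or> ?y = 0")
        case False
        \<comment> \<open>Unit vectors at which the coefficient equals
          \<open>norm ?y / norm x\<close>.\<close>
        define h where "h = inverse (norm x) *\<^sub>R x"
        define k where "k = inverse (norm ?y) *\<^sub>R ?y"
        have "norm h = 1" "norm k = 1" using False by (auto simp: h_def k_def)
        then have "cmod (cinner (blinfun_apply R h) k) \<le> c" using unit[of h k] c by simp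
        moreover have "cinner (blinfun_apply R h) k = of_real (inverse (norm x) * norm ?y)"
          using False by (simp add: h_def k_def blinfun.scaleR_right cinner_scaleR_left cinner_scaleR_right
              cinner_self power2_eq_square)
        ultimately have "inverse (norm x) * norm ?y \<le> c" by (simp only: norm_of_real)
        then show ?thesis using False by (simp add: field_simps)
      qed (use c in auto)
    qed
    then show ?thesis unfolding R_def[symmetric] L_def[symmetric] c(1) by (rule ennreal_leI)
  qed (simp add: L_def)
qed

end

section \<open>Gelfand-Pettis integrals in the \<open>\<sigma>\<close>-topologies\<close>

lemma l2_nth_finite:
  "l2_nth (Abs_l2 (\<lambda>i. if i < n then f i else 0)) = (\<lambda>i. if i < n then f i else 0)"
proof (rule Abs_l2_inverse)
  have "summable (\<lambda>i. if i \<in> {..<n} then (norm (f i))\<^sup>2 else 0)" by (rule summable_If_finite_set) simp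
  then show "(\<lambda>i. if i < n then f i else 0) \<in> ell2"
    by (simp add: ell2_iff if_distrib[of norm] if_distrib[of "\<lambda>x. x\<^sup>2"] cong: if_cong)
qed

definition trunc_l2 :: "nat \<Rightarrow> 'a::complex_hilbert l2seq \<Rightarrow> 'a l2seq" where
  "trunc_l2 N x = Abs_l2 (\<lambda>n. if n < N then l2_nth x n else 0)"

lemma l2_nth_trunc: "l2_nth (trunc_l2 N x) = (\<lambda>n. if n < N then l2_nth x n else 0)"
  unfolding trunc_l2_def by (rule l2_nth_finite)

lemma trunc_l2_tendsto: "(\<lambda>N. trunc_l2 N x) \<longlonglongrightarrow> x"
proof -
  define a where "a n = (norm (l2_nth x n))\<^sup>2" for n
  have a: "summable a" using l2_nth_ell2[of x] by (simp add: a_def[abs_def] ell2_iff)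
  have "(norm (trunc_l2 N x - x))\<^sup>2 = suminf a - (\<Sum>n<N. a n)" for N
  proof -
    have t: "(norm (l2_nth (trunc_l2 N x - x) n))\<^sup>2 = a n - (if n \<in> {..<N} then a n else 0)" for n
      by (simp add: l2_nth_ops l2_nth_trunc a_def)
    have f: "(\<lambda>n. if n \<in> {..<N} then a n else 0) sums (\<Sum>n<N. a n)" by (rule sums_If_finite_set) simp
    show ?thesis unfolding norm_l2_sq t
      using suminf_diff[OF a sums_summable[OF f]] f by (simp add: sums_iff)
  qed
  moreover have "(\<lambda>N. suminf a - (\<Sum>n<N. a n)) \<longlonglongrightarrow> suminf a - suminf a"
    by (intro tendsto_intros summable_LIMSEQ a)
  ultimately have "(\<lambda>N. (norm (trunc_l2 N x - x))\<^sup>2) \<longlonglongrightarrow> 0" by simp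
  then have "(\<lambda>N. sqrt ((norm (trunc_l2 N x - x))\<^sup>2)) \<longlonglongrightarrow> sqrt 0" by (rule tendsto_real_sqrt)
  then have "(\<lambda>N. norm (trunc_l2 N x - x)) \<longlonglongrightarrow> 0" by simp
  then show ?thesis by (simp add: LIM_zero_iff tendsto_norm_zero_iff)
qed

lemma tendsto_ampl:
  assumes "(X \<longlongrightarrow> x) F" shows "((\<lambda>n. ampl A (X n)) \<longlongrightarrow> ampl A x) F"
proof -
  have "bounded_linear (ampl A)"
  proof (rule bounded_linear_intro[of _ "norm A"])
    show "norm (ampl A x) \<le> norm x * norm A" for x using norm_ampl_le[of A x] by (simp add: mult.commute)
  qed (simp_all add: ampl_add_right ampl_scaleR_right)
  then show ?thesis using assms by (rule bounded_linear.tendsto)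
qed

lemma cinner_ampl_trunc:
  "cinner (ampl A (trunc_l2 N h)) k = (\<Sum>n<N. cinner (blinfun_apply A (l2_nth h n)) (l2_nth k n))"
  by (subst cinner_finite_sum[of N]) (auto simp: l2_nth_trunc)

text \<open>Interchange of sum and integral: by uniform boundedness on \<open>\<ell>\<^sup>2\<close> the truncations converge
  in \<open>L\<^sup>1\<close>.\<close>

lemma cinner_ampl_pw_Pettis_integral:
  assumes int: "\<And>h k. integrable M (\<lambda>\<sigma>. cinner (ampl (F \<sigma>) h) k)"
    and S: "S \<in> sets M"
    and R: "\<And>h k. cinner (blinfun_apply R h) k = (LINT \<sigma>:S|M. cinner (blinfun_apply (F \<sigma>) h) k)"
  shows "cinner (ampl R h) k = (LINT \<sigma>:S|M. cinner (ampl (F \<sigma>) h) k)"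
proof -
  have int1: "integrable M (\<lambda>\<sigma>. cinner (blinfun_apply (F \<sigma>) h) k)" for h k
    using int[of "single_l2 h" "single_l2 k"] by (simp add: ampl_single cinner_single)
  obtain C where C: "0 \<le> C" "\<And>h. (\<integral>\<sigma>. cmod (cinner (ampl (F \<sigma>) h) k) \<partial>M) \<le> C * norm h"
  proof (rule integrable_family_bounded[of M "\<lambda>h \<sigma>. cinner (ampl (F \<sigma>) h) k"])
    show "cmod (cinner (ampl (F \<sigma>) (x + y)) k) \<le> cmod (cinner (ampl (F \<sigma>) x) k) + cmod (cinner (ampl (F \<sigma>) y) k)" for x y \<sigma>
      by (simp add: ampl_add_right cinner_add_left norm_triangle_ineq)
    show "(\<lambda>n. cinner (ampl (F \<sigma>) (X n)) k) \<longlonglongrightarrow> cinner (ampl (F \<sigma>) x) k"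
      if "X \<longlonglongrightarrow> x" for X x \<sigma> by (intro tendsto_intros tendsto_ampl that)
  qed (auto simp: int ampl_scaleR_right cinner_scaleR_left norm_mult)
  have fin: "cinner (ampl R (trunc_l2 N h)) k = (LINT \<sigma>:S|M. cinner (ampl (F \<sigma>) (trunc_l2 N h)) k)" for N
    unfolding cinner_ampl_trunc R by (rule LINT_sum[symmetric, OF int1 S])
  have "(\<lambda>N. LINT \<sigma>:S|M. cinner (ampl (F \<sigma>) (trunc_l2 N h)) k) \<longlonglongrightarrow> (LINT \<sigma>:S|M. cinner (ampl (F \<sigma>) h) k)"
  proof (rule LIM_zero_cancel, rule Lim_null_comparison)
    show "(\<lambda>N. C * norm (trunc_l2 N h - h)) \<longlonglongrightarrow> 0"
      by (intro tendsto_mult_right_zero tendsto_norm_zero LIM_zero trunc_l2_tendsto)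
    show "\<forall>\<^sub>F N in sequentially. norm ((LINT \<sigma>:S|M. cinner (ampl (F \<sigma>) (trunc_l2 N h)) k) - (LINT \<sigma>:S|M. cinner (ampl (F \<sigma>) h) k))
        \<le> C * norm (trunc_l2 N h - h)"
    proof (intro always_eventually allI)
      fix N
      have "ampl (F \<sigma>) (trunc_l2 N h - h) + ampl (F \<sigma>) h = ampl (F \<sigma>) (trunc_l2 N h)" for \<sigma>
        by (simp add: ampl_add_right[symmetric])
      then have *: "cinner (ampl (F \<sigma>) (trunc_l2 N h)) k - cinner (ampl (F \<sigma>) h) k = cinner (ampl (F \<sigma>) (trunc_l2 N h - h)) k" for \<sigma>
        by (metis add_diff_cancel_right' cinner_diff_left)
      have "(LINT \<sigma>:S|M. cinner (ampl (F \<sigma>) (trunc_l2 N h)) k) - (LINT \<sigma>:S|M. cinner (ampl (F \<sigma>) h) k)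
          = (LINT \<sigma>:S|M. cinner (ampl (F \<sigma>) (trunc_l2 N h - h)) k)"
        unfolding LINT_diff[OF int int S, symmetric] * ..
      then show "norm ((LINT \<sigma>:S|M. cinner (ampl (F \<sigma>) (trunc_l2 N h)) k) - (LINT \<sigma>:S|M. cinner (ampl (F \<sigma>) h) k))
          \<le> C * norm (trunc_l2 N h - h)"
        using order_trans[OF cmod_LINT_le[OF int S] C(2)] by (simp only:)
    qed
  qed
  moreover have "(\<lambda>N. cinner (ampl R (trunc_l2 N h)) k) \<longlonglongrightarrow> cinner (ampl R h) k"
    by (rule tendsto_cinner[OF tendsto_ampl[OF trunc_l2_tendsto] tendsto_const])
  ultimately show ?thesis unfolding fin by (rule LIMSEQ_unique[rotated])
qed

text \<open>Separation of a point from a \<open>\<sigma>\<close>-weakly closed subspace by a \<open>\<sigma>\<close>-weakly continuous functional,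
  obtained from the orthogonal projection in the finite-dimensional space of the finitely many
  functionals that describe a separating neighbourhood.\<close>

lemma sigma_closed_separation:
  assumes V: "csubspace V" "V \<subseteq> bops" and cl: "closedin (sigma_op_topology WOT bops) V"
    and R: "R \<in> bops" "R \<notin> V"
  obtains n :: nat and h k where "\<And>A. A \<in> V \<Longrightarrow> (\<Sum>i<n. cinner (ampl A (h i)) (k i)) = 0"
    "(\<Sum>i<n. cinner (ampl R (h i)) (k i)) \<noteq> 0"
proof -
  let ?P = "sigma_op_seminorms WOT :: (('a \<Rightarrow>\<^sub>L 'b) \<Rightarrow> real) set"
  have "openin (sigma_op_topology WOT bops) (bops - V)"
    using cl by (simp add: closedin_def topspace_sigma_op_topology)
  then obtain U where U: "openin (seminorm_topology ?P) U" "bops - V = U \<inter> bops"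
    unfolding sigma_op_topology_def openin_subtopology by blast
  then have "R \<in> U" using R by blast
  then obtain Q \<delta> where Q: "finite Q" "Q \<subseteq> ?P" "0 < \<delta>"
    and QU: "\<And>B. \<lbrakk>B \<in> bops; \<And>p. p \<in> Q \<Longrightarrow> p (B - R) < \<delta>\<rbrakk> \<Longrightarrow> B \<in> U"
    using seminorm_topology_nbhd[OF seminorms_sigma_op U(1)] by metis
  obtain e where e: "bij_betw e {..<card Q} Q" using ex_bij_betw_nat_finite[OF Q(1)] by (auto simp: atLeast0LessThan)
  define n where "n = card Q"
  have "\<exists>h k. e i = (\<lambda>A. cmod (cinner (ampl A h) k))" if "i < n" for i
  proof -
    have "e i \<in> Q" using e that by (auto simp: bij_betw_def n_def)
    then have "e i \<in> ?P" using Q(2) by blast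
    then show ?thesis unfolding sigma_op_seminorms_ampl by blast
  qed
  then obtain h k where hk: "\<And>i. i < n \<Longrightarrow> e i = (\<lambda>A. cmod (cinner (ampl A (h i)) (k i)))" by metis
  \<comment> \<open>\<open>L A\<close> lists the finitely many coefficients of \<open>A\<close>,
    padded by zeros; sequences thus serve as a Hilbert space of \<open>n\<close>-tuples.\<close>
  define L :: "('a \<Rightarrow>\<^sub>L 'b) \<Rightarrow> complex l2seq" where
    "L A = Abs_l2 (\<lambda>i. if i < n then cinner (ampl A (h i)) (k i) else 0)" for A
  have Ln: "l2_nth (L A) = (\<lambda>i. if i < n then cinner (ampl A (h i)) (k i) else 0)" for A
    unfolding L_def by (rule l2_nth_finite)
  have L_add: "L (A + B) = L A + L B" for A B
    by (rule l2_eqI) (simp add: Ln l2_nth_ops ampl_add_left cinner_add_left)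
  have L_sc: "L (c *\<^sub>C A) = c *\<^sub>C L A" for c A
    by (rule l2_eqI) (simp add: Ln l2_nth_ops ampl_scaleC_left cinner_scaleC_left scaleC_complex_def)
  have L_diff: "L (A - B) = L A - L B" for A B
    by (rule l2_eqI) (simp add: Ln l2_nth_ops ampl_diff_left cinner_diff_left)
  \<comment> \<open>The vector \<open>r\<close> representing
    \<open>\<langle>L A, L R\<rangle>\<close> is the projection of \<open>L R\<close> to the closure
    of \<open>L\<close> applied to \<open>V\<close>; \<open>c\<close> below is the orthogonal
    remainder.\<close>
  obtain r where r: "r \<in> closure (L ` V)" "\<And>A. A \<in> V \<Longrightarrow> cinner (L A) (L R) = cinner (L A) r"
  proof (rule Riesz_complex[OF V(1), of L "\<lambda>A. cinner (L A) (L R)" "norm (L R)"])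
    show "cmod (cinner (L v) (L R)) \<le> norm (L R) * norm (L v)" for v
      using norm_cinner_le[of "L v" "L R"] by (simp add: mult.commute)
  qed (auto simp: L_add L_sc clinear_on_def cinner_linear)
  define c where "c = L R - r"
  have orth: "cinner (L A) c = 0" if "A \<in> V" for A using r(2)[OF that] by (simp add: c_def cinner_diff_right)
  have fin: "cinner (L A) c = (\<Sum>i<n. cinner (ampl A (h i)) (l2_nth c i *\<^sub>C k i))" for A
    by (subst cinner_finite_sum[of n]) (auto simp: Ln cinner_complex_def cinner_scaleC_right mult.commute)
  have "cinner (L R) c \<noteq> 0"
  proof
    assume 0: "cinner (L R) c = 0"
    have "cinner r c = 0"
    proof -
      have "closed {x. cinner x c = 0}"
        by (intro closed_Collect_eq bounded_bilinear.continuous_on[OF bounded_bilinear_cinner] continuous_intros)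
      moreover have "L ` V \<subseteq> {x. cinner x c = 0}" using orth by auto
      ultimately show ?thesis using r(1) closure_minimal by blast
    qed
    then have "cinner c c = 0" using 0 by (simp add: c_def cinner_diff_left)
    \<comment> \<open>A zero remainder puts \<open>L R\<close> in the closure, so some
      \<open>B\<close> in \<open>V\<close> would lie in the neighbourhood of \<open>R\<close> that
      avoids \<open>V\<close>.\<close>
    then have "L R \<in> closure (L ` V)" using r(1) by (simp add: cinner_eq_zero_iff c_def)
    then obtain B where B: "B \<in> V" "dist (L B) (L R) < \<delta>"
      using Q(3) unfolding closure_approachable by blast
    have "p (B - R) < \<delta>" if "p \<in> Q" for p
    proof -
      have "p \<in> e ` {..<n}" using e that by (simp add: bij_betw_def n_def)
      then obtain i where i: "i < n" "p = e i" by blast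
      have "p (B - R) = norm (l2_nth (L (B - R)) i)" using i by (simp add: hk Ln)
      also have "\<dots> \<le> norm (L (B - R))" by (rule norm_l2_nth_le)
      also have "\<dots> < \<delta>" using B(2) by (simp add: L_diff dist_norm)
      finally show ?thesis .
    qed
    then have "B \<in> U" using B V by (intro QU) auto
    then show False using U(2) B V by blast
  qed
  then have nz: "(\<Sum>i<n. cinner (ampl R (h i)) (l2_nth c i *\<^sub>C k i)) \<noteq> 0" unfolding fin .
  have z: "(\<Sum>i<n. cinner (ampl A (h i)) (l2_nth c i *\<^sub>C k i)) = 0" if "A \<in> V" for A
    using orth[OF that] unfolding fin .
  show ?thesis by (rule that[OF z nz])
qed

context
  fixes V :: "('h::complex_hilbert \<Rightarrow>\<^sub>L 'k::complex_hilbert) set" and M :: "'s measure"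
    and F :: "'s \<Rightarrow> 'h \<Rightarrow>\<^sub>L 'k"
  assumes V: "V \<subseteq> bops" "csubspace V" and F: "F \<in> space M \<rightarrow> V"
begin

lemma sigma_integrable_imp_pw:
  assumes "\<And>h k. integrable M (\<lambda>\<sigma>. cinner (ampl (F \<sigma>) h) k)"
  shows "pw_Pettis_integrable M F"
  unfolding pw_Pettis_integrable_iff
proof (intro allI)
  fix h k show "integrable M (\<lambda>\<sigma>. cinner (blinfun_apply (F \<sigma>) h) k)"
    using assms[of "single_l2 h" "single_l2 k"] by (simp add: ampl_single cinner_single)
qed

lemma pw_Pettis_integral_in_closed:
  assumes cl: "closedin (sigma_op_topology WOT bops) V"
    and int: "\<And>h k. integrable M (\<lambda>\<sigma>. cinner (ampl (F \<sigma>) h) k)" and S: "S \<in> sets M"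
  shows "pw_Pettis_integral M F S \<in> V"
    "cinner (ampl (pw_Pettis_integral M F S) h) k = (LINT \<sigma>:S|M. cinner (ampl (F \<sigma>) h) k)"
proof -
  let ?R = "pw_Pettis_integral M F S"
  have Fb: "F \<in> space M \<rightarrow> bops" using F V by auto
  note R = pw_Pettis_integral[OF sigma_integrable_imp_pw[OF int] Fb S]
  show A: "cinner (ampl ?R h) k = (LINT \<sigma>:S|M. cinner (ampl (F \<sigma>) h) k)" for h k
    by (rule cinner_ampl_pw_Pettis_integral[OF int S R(2)])
  show "?R \<in> V"
  proof (rule ccontr)
    assume "?R \<notin> V"
    then obtain n :: nat and h k where z: "\<And>A. A \<in> V \<Longrightarrow> (\<Sum>i<n. cinner (ampl A (h i)) (k i)) = 0"
      and nz: "(\<Sum>i<n. cinner (ampl ?R (h i)) (k i)) \<noteq> 0"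
      using sigma_closed_separation[OF V(2,1) cl R(1)] by metis
    have "(\<Sum>i<n. cinner (ampl ?R (h i)) (k i)) = (LINT \<sigma>:S|M. \<Sum>i<n. cinner (ampl (F \<sigma>) (h i)) (k i))"
      unfolding A by (rule LINT_sum[symmetric, OF int S])
    also have "\<dots> = (LINT \<sigma>:S|M. 0)" by (rule LINT_cong_space[OF S]) (use z F in auto)
    finally show False using nz by (simp add: set_lebesgue_integral_def)
  qed
qed

lemma GP_integrable_sigma_imp:
  assumes "GP_integrable M (sigma_op_topology \<T> V) F"
  shows "integrable M (\<lambda>\<sigma>. cinner (ampl (F \<sigma>) h) k)"
proof -
  have w: "pw_weakly_measurable M F"
    using assms weakly_measurable_sigma_iff[OF V F] unfolding GP_integrable_def by blast
  have m: "(\<lambda>\<sigma>. cinner (ampl (F \<sigma>) h) k) \<in> borel_measurable M"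
    using w unfolding pw_weakly_measurable_def by (intro measurable_ampl) auto
  have "(\<integral>\<^sup>+\<sigma>. ennreal (cmod (if F \<sigma> \<in> V then cinner (ampl (F \<sigma>) h) k else 0)) \<partial>M) < \<infinity>"
    using assms[unfolded GP_integrable_def, THEN conjunct2, THEN conjunct1, THEN bspec,
        OF top_dual_sigmaI[OF V, of h k]] .
  moreover have "(\<integral>\<^sup>+\<sigma>. ennreal (cmod (if F \<sigma> \<in> V then cinner (ampl (F \<sigma>) h) k else 0)) \<partial>M)
      = (\<integral>\<^sup>+\<sigma>. ennreal (cmod (cinner (ampl (F \<sigma>) h) k)) \<partial>M)"
    by (rule nn_integral_cong) (use F in auto)
  ultimately show ?thesis using m by (simp add: integrable_complex_iff)
qed

lemma GP_integrable_sigmaI: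
  assumes int: "\<And>h k. integrable M (\<lambda>\<sigma>. cinner (ampl (F \<sigma>) h) k)"
    and ex: "\<And>S. S \<in> sets M \<Longrightarrow> \<exists>I\<in>V. \<forall>h k. cinner (ampl I h) k = (LINT \<sigma>:S|M. cinner (ampl (F \<sigma>) h) k)"
  shows "GP_integrable M (sigma_op_topology \<T> V) F"
  unfolding GP_integrable_def
proof (intro conjI ballI)
  show "weakly_measurable M (sigma_op_topology \<T> V) F"
    unfolding weakly_measurable_sigma_iff[OF V F]
    using sigma_integrable_imp_pw[OF int] by (simp add: pw_Pettis_integrable_def)
  fix l assume "l \<in> top_dual (sigma_op_topology \<T> V)"
  then obtain h k where l: "\<And>A. A \<in> V \<Longrightarrow> l A = cinner (ampl A h) k"
    using top_dual_sigma_cases[OF V] by blast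
  have "(\<integral>\<^sup>+\<sigma>. ennreal (cmod (l (F \<sigma>))) \<partial>M) = (\<integral>\<^sup>+\<sigma>. ennreal (cmod (cinner (ampl (F \<sigma>) h) k)) \<partial>M)"
    by (rule nn_integral_cong) (simp add: l F_in_V[OF V F])
  then show "(\<integral>\<^sup>+\<sigma>. ennreal (cmod (l (F \<sigma>))) \<partial>M) < \<infinity>"
    using int[of h k] unfolding integrable_complex_iff by simp
next
  fix S assume S: "S \<in> sets M"
  show "\<exists>I. is_GP_integral M (sigma_op_topology \<T> V) F S I"
    unfolding is_GP_integral_sigma_iff[OF V F S] using ex[OF S] by blast
qed

lemma sigma_integrable_iff:
  "(\<forall>h k. integrable M (\<lambda>\<sigma>. cinner (ampl (F \<sigma>) h) k)) \<longleftrightarrow> pw_weakly_measurable M F \<and>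
     (\<forall>h\<in>ell2. \<forall>k\<in>ell2.
        (\<integral>\<^sup>+\<sigma>. ennreal (cmod (ell2_inner (\<lambda>n. blinfun_apply (F \<sigma>) (h n)) k)) \<partial>M) < \<infinity>)"
proof (intro iffI conjI ballI allI)
  assume int: "\<forall>h k. integrable M (\<lambda>\<sigma>. cinner (ampl (F \<sigma>) h) k)"
  then show "pw_weakly_measurable M F" using sigma_integrable_imp_pw by (auto simp: pw_Pettis_integrable_def)
  fix h :: "nat \<Rightarrow> 'h" and k :: "nat \<Rightarrow> 'k" assume "h \<in> ell2" "k \<in> ell2"
  then show "(\<integral>\<^sup>+\<sigma>. ennreal (cmod (ell2_inner (\<lambda>n. blinfun_apply (F \<sigma>) (h n)) k)) \<partial>M) < \<infinity>"
    using int by (simp add: ell2_inner_ampl integrable_complex_iff)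
next
  fix h k
  assume a: "pw_weakly_measurable M F \<and>
     (\<forall>h\<in>ell2. \<forall>k\<in>ell2.
        (\<integral>\<^sup>+\<sigma>. ennreal (cmod (ell2_inner (\<lambda>n. blinfun_apply (F \<sigma>) (h n)) k)) \<partial>M) < \<infinity>)"
  have "(\<lambda>\<sigma>. cinner (ampl (F \<sigma>) h) k) \<in> borel_measurable M"
    using a unfolding pw_weakly_measurable_def by (intro measurable_ampl) auto
  moreover have "(\<integral>\<^sup>+\<sigma>. ennreal (cmod (ell2_inner (\<lambda>n. blinfun_apply (F \<sigma>) (l2_nth h n)) (l2_nth k))) \<partial>M) < \<infinity>"
    by (rule a[THEN conjunct2, THEN bspec, OF l2_nth_ell2, THEN bspec, OF l2_nth_ell2])
  ultimately show "integrable M (\<lambda>\<sigma>. cinner (ampl (F \<sigma>) h) k)"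
    by (simp add: integrable_complex_iff cinner_l2seq_def)
qed

lemma weakstar_integrable_iff:
  "weakstar_integrable M (predual V) (functional_norm V) (\<lambda>\<sigma>. predual_eval V (F \<sigma>)) \<longleftrightarrow>
     (\<forall>h k. integrable M (\<lambda>\<sigma>. cinner (ampl (F \<sigma>) h) k))"
proof -
  have pre: "predual V = {\<lambda>A. if A \<in> V then cinner (ampl A h) k else 0 |h k. True}"
    unfolding predual_def by (rule top_dual_sigma_op_topology[OF V])
  have "weakstar_integrable M (predual V) (functional_norm V) (\<lambda>\<sigma>. predual_eval V (F \<sigma>)) \<longleftrightarrow>
      (\<forall>w\<in>predual V. integrable M (\<lambda>\<sigma>. predual_eval V (F \<sigma>) w))"
    using predual_eval_normed_dual[OF V] F unfolding weakstar_integrable_def integrable_complex_iff by auto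
  also have "\<dots> \<longleftrightarrow> (\<forall>w\<in>predual V. integrable M (\<lambda>\<sigma>. w (F \<sigma>)))"
    by (simp add: predual_eval_def)
  also have "\<dots> \<longleftrightarrow> (\<forall>h k. integrable M (\<lambda>\<sigma>. if F \<sigma> \<in> V then cinner (ampl (F \<sigma>) h) k else 0))"
  proof -
    have gen: "(\<forall>w\<in>{g h k |h k. True}. P w) \<longleftrightarrow> (\<forall>h k. P (g h k))"
      for g :: "'h l2seq \<Rightarrow> 'k l2seq \<Rightarrow> ('h \<Rightarrow>\<^sub>L 'k) \<Rightarrow> complex" and P by blast
    show ?thesis unfolding pre by (rule gen)
  qed
  also have "\<dots> \<longleftrightarrow> (\<forall>h k. integrable M (\<lambda>\<sigma>. cinner (ampl (F \<sigma>) h) k))"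
  proof -
    have "integrable M (\<lambda>\<sigma>. if F \<sigma> \<in> V then cinner (ampl (F \<sigma>) h) k else 0)
        = integrable M (\<lambda>\<sigma>. cinner (ampl (F \<sigma>) h) k)" for h k
      by (rule Bochner_Integration.integrable_cong) (use F in auto)
    then show ?thesis by simp
  qed
  finally show ?thesis .
qed

lemma GP_integrable_sigma_iff:
  assumes cl: "closedin (sigma_op_topology WOT bops) V"
  shows "GP_integrable M (sigma_op_topology \<T> V) F \<longleftrightarrow> (\<forall>h k. integrable M (\<lambda>\<sigma>. cinner (ampl (F \<sigma>) h) k))"
  using GP_integrable_sigma_imp GP_integrable_sigmaI pw_Pettis_integral_in_closed[OF cl] by blast

lemma GP_integral_sigma_closed:
  assumes cl: "closedin (sigma_op_topology WOT bops) V"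
    and G: "GP_integrable M (sigma_op_topology \<T> V) F"
  shows "pw_Pettis_integrable_in M V F"
    "S \<in> sets M \<Longrightarrow> pw_Pettis_integral M F S = GP_integral M (sigma_op_topology \<T> V) F S"
    "S \<in> sets M \<Longrightarrow> weakstar_integral M (predual V) (\<lambda>\<sigma>. predual_eval V (F \<sigma>)) S =
       predual_eval V (GP_integral M (sigma_op_topology \<T> V) F S)"
proof -
  note int = GP_integrable_sigma_imp[OF G]
  note R = pw_Pettis_integral_in_closed[OF cl int]
  show "pw_Pettis_integrable_in M V F"
    using sigma_integrable_imp_pw[OF int] F R(1) by (simp add: pw_Pettis_integrable_in_def)
  assume S: "S \<in> sets M"
  \<comment> \<open>Proved for all topologies at once: the predual is the dual for
    \<open>WOT\<close>, whichever \<open>\<T>\<close> is fixed.\<close>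
  have I: "is_GP_integral M (sigma_op_topology \<T> V) F S (pw_Pettis_integral M F S)" for \<T>
    unfolding is_GP_integral_sigma_iff[OF V F S] using R S by blast
  then show eq: "pw_Pettis_integral M F S = GP_integral M (sigma_op_topology \<T> V) F S"
    using GP_integral_sigma_eqI[OF V F S] by metis
  show "weakstar_integral M (predual V) (\<lambda>\<sigma>. predual_eval V (F \<sigma>)) S =
       predual_eval V (GP_integral M (sigma_op_topology \<T> V) F S)"
  proof (rule ext)
    fix w
    show "weakstar_integral M (predual V) (\<lambda>\<sigma>. predual_eval V (F \<sigma>)) S w =
       predual_eval V (GP_integral M (sigma_op_topology \<T> V) F S) w"
      using I[of WOT] unfolding eq weakstar_integral_def predual_eval_def is_GP_integral_def predual_def
      by simp
  qed
qed

end

section \<open>Suprema of chains of positive contractions\<close>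

definition op_le :: "('a::complex_hilbert \<Rightarrow>\<^sub>L 'a) \<Rightarrow> ('a \<Rightarrow>\<^sub>L 'a) \<Rightarrow> bool" where
  "op_le A B \<longleftrightarrow> positive_op (B - A)"

lemma op_le_refl [simp]: "op_le A A" by (simp add: op_le_def)

lemma op_le_antisym: "op_le A B \<Longrightarrow> op_le B A \<Longrightarrow> A = B"
  unfolding op_le_def by (rule positive_op_antisym)

lemma op_le_trans: "op_le A B \<Longrightarrow> op_le B C \<Longrightarrow> op_le A C"
  unfolding op_le_def using positive_op_add[of "C - B" "B - A"] by simp

lemma op_leD: "op_le A B \<Longrightarrow> Re (cinner (blinfun_apply A h) h) \<le> Re (cinner (blinfun_apply B h) h)"
  by (simp add: op_le_def positive_op_iff blinfun.diff_left cinner_diff_left)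

lemma op_leI:
  assumes "positive_op A" "positive_op B"
    "\<And>h. Re (cinner (blinfun_apply A h) h) \<le> Re (cinner (blinfun_apply B h) h)"
  shows "op_le A B"
  using assms by (simp add: op_le_def positive_op_iff blinfun.diff_left cinner_diff_left)

text \<open>Filters take the role of nets here, so that norm-convergent sequences and chains of
  contractions are both instances.\<close>

lemma WOT_closed_limit:
  assumes cl: "closedin (op_topology WOT bops) \<M>" and F: "F \<noteq> bot"
    and ev: "\<forall>\<^sub>F x in F. f x \<in> \<M>" and T: "T \<in> bops"
    and lim: "\<And>h k. ((\<lambda>x. cinner (blinfun_apply (f x) h) k) \<longlongrightarrow> cinner (blinfun_apply T h) k) F"
  shows "T \<in> \<M>"
proof (rule ccontr)
  assume nT: "T \<notin> \<M>"
  have Mb: "\<M> \<subseteq> bops" using closedin_subset[OF cl] by (simp add: topspace_op_topology)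
  have "openin (op_topology WOT bops) (bops - \<M>)"
    using cl by (simp add: closedin_def topspace_op_topology)
  then obtain U where U: "openin (seminorm_topology (op_seminorms WOT)) U" "bops - \<M> = U \<inter> bops"
    unfolding op_topology_def openin_subtopology by blast
  then have "T \<in> U" using T nT by blast
  then obtain Q \<delta> where Q: "finite Q" "Q \<subseteq> op_seminorms WOT" "0 < \<delta>"
    and QU: "\<And>B. \<lbrakk>B \<in> bops; \<And>p. p \<in> Q \<Longrightarrow> p (B - T) < \<delta>\<rbrakk> \<Longrightarrow> B \<in> U"
    using seminorm_topology_nbhd[OF seminorms_op U(1)] by metis
  have "\<forall>\<^sub>F x in F. p (f x - T) < \<delta>" if "p \<in> Q" for p
  proof -
    have "p \<in> op_seminorms WOT" using Q(2) that by blast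
    then obtain h k where p: "p = (\<lambda>A. cmod (cinner (blinfun_apply A h) k))" by auto
    have "((\<lambda>x. cmod (cinner (blinfun_apply (f x) h) k - cinner (blinfun_apply T h) k)) \<longlongrightarrow> 0) F"
      using lim by (intro tendsto_norm_zero LIM_zero)
    then have "\<forall>\<^sub>F x in F. cmod (cinner (blinfun_apply (f x) h) k - cinner (blinfun_apply T h) k) < \<delta>"
      using Q(3) by (rule order_tendstoD)
    then show ?thesis by (simp add: p blinfun.diff_left cinner_diff_left)
  qed
  then have "\<forall>\<^sub>F x in F. \<forall>p\<in>Q. p (f x - T) < \<delta>" using Q(1) by (intro eventually_ball_finite) auto
  with ev have "\<forall>\<^sub>F x in F. False"
  proof eventually_elim
    case (elim x)
    then have "f x \<in> U" using Mb by (intro QU) auto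
    then show False using U(2) elim Mb by blast
  qed
  then show False using F by (simp add: eventually_False)
qed

section \<open>Weak limits of increasing chains\<close>

lemma polarization:
  assumes "A \<in> bops"
  shows "4 * cinner (blinfun_apply A h) k =
    cinner (blinfun_apply A (h + k)) (h + k) - cinner (blinfun_apply A (h - k)) (h - k)
    + \<i> * cinner (blinfun_apply A (h + \<i> *\<^sub>C k)) (h + \<i> *\<^sub>C k)
    - \<i> * cinner (blinfun_apply A (h - \<i> *\<^sub>C k)) (h - \<i> *\<^sub>C k)"
  by (simp add: blinfun.add_right blinfun.diff_right bopsD[OF assms] cinner_linear algebra_simps)

text \<open>The filter of tails: convergence along it is convergence of the chain as an increasing
  net.\<close>

definition chain_filter :: "('a::complex_hilbert \<Rightarrow>\<^sub>L 'a) set \<Rightarrow> ('a \<Rightarrow>\<^sub>L 'a) filter" where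
  "chain_filter \<C> = (INF A\<in>\<C>. principal {B \<in> \<C>. op_le A B})"

definition contraction_chain :: "('a::complex_hilbert \<Rightarrow>\<^sub>L 'a) set \<Rightarrow> bool" where
  "contraction_chain \<C> \<longleftrightarrow> \<C> \<noteq> {} \<and> (\<forall>A\<in>\<C>. positive_op A \<and> op_le A id_blinfun) \<and>
     (\<forall>A\<in>\<C>. \<forall>B\<in>\<C>. op_le A B \<or> op_le B A)"

lemma eventually_chain_filter:
  assumes "contraction_chain \<C>"
  shows "eventually P (chain_filter \<C>) \<longleftrightarrow> (\<exists>A\<in>\<C>. \<forall>B\<in>\<C>. op_le A B \<longrightarrow> P B)"
proof -
  have ne: "\<C> \<noteq> {}" and lin: "\<And>A B. A \<in> \<C> \<Longrightarrow> B \<in> \<C> \<Longrightarrow> op_le A B \<or> op_le B A"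
    using assms by (auto simp: contraction_chain_def)
  have "eventually P (chain_filter \<C>) \<longleftrightarrow> (\<exists>A\<in>\<C>. eventually P (principal {B \<in> \<C>. op_le A B}))"
    unfolding chain_filter_def
  proof (rule eventually_INF_base[OF ne])
    fix A B assume AB: "A \<in> \<C>" "B \<in> \<C>"
    show "\<exists>x\<in>\<C>. principal {B \<in> \<C>. op_le x B} \<le> inf (principal {B \<in> \<C>. op_le A B}) (principal {Ba \<in> \<C>. op_le B Ba})"
    proof (cases "op_le A B")
      case True
      then show ?thesis using AB op_le_trans by (intro bexI[of _ B]) auto
    next
      case False
      then have "op_le B A" using lin AB by blast
      then show ?thesis using AB op_le_trans by (intro bexI[of _ A]) auto
    qed
  qed
  then show ?thesis by (auto simp: eventually_principal)
qed

lemma chain_filter_facts: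
  assumes C: "contraction_chain \<C>"
  shows "chain_filter \<C> \<noteq> bot" "\<forall>\<^sub>F B in chain_filter \<C>. B \<in> \<C>"
    "A \<in> \<C> \<Longrightarrow> \<forall>\<^sub>F B in chain_filter \<C>. op_le A B"
proof -
  show "\<forall>\<^sub>F B in chain_filter \<C>. B \<in> \<C>"
    using C unfolding eventually_chain_filter[OF C] by (auto simp: contraction_chain_def)
  show "A \<in> \<C> \<Longrightarrow> \<forall>\<^sub>F B in chain_filter \<C>. op_le A B"
    unfolding eventually_chain_filter[OF C] by blast
  have "\<not> eventually (\<lambda>_. False) (chain_filter \<C>)"
    unfolding eventually_chain_filter[OF C] using op_le_refl by blast
  then show "chain_filter \<C> \<noteq> bot" by (simp add: eventually_False)
qed

lemma contraction_bound:
  assumes "positive_op A" "op_le A id_blinfun"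
  shows "A \<in> bops" "norm A \<le> 1" "cmod (cinner (blinfun_apply A h) k) \<le> norm h * norm k"
proof -
  show "A \<in> bops" using assms by (simp add: positive_op_bops)
  show n: "norm A \<le> 1" using assms by (intro norm_positive_le_1) (auto simp: op_le_def)
  have "cmod (cinner (blinfun_apply A h) k) \<le> norm (blinfun_apply A h) * norm k" by (rule norm_cinner_le)
  also have "\<dots> \<le> (norm A * norm h) * norm k" by (intro mult_right_mono norm_blinfun) auto
  also have "\<dots> \<le> (1 * norm h) * norm k" using n by (intro mult_right_mono) auto
  finally show "cmod (cinner (blinfun_apply A h) k) \<le> norm h * norm k" by simp
qed

text \<open>The quadratic forms increase to their pointwise supremum \<open>q\<close>; polarization
  carries convergence over to all coefficients, and the limit form is represented by
  \<open>T\<close>. Since \<open>q\<close> is a pointwise supremum, \<open>T\<close> is also least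
  among the positive upper bounds.\<close>

theorem chain_sup:
  assumes C: "contraction_chain \<C>"
  obtains T where "positive_op T" "op_le T id_blinfun" "\<And>A. A \<in> \<C> \<Longrightarrow> op_le A T"
    "\<And>h k. ((\<lambda>B. cinner (blinfun_apply B h) k) \<longlongrightarrow> cinner (blinfun_apply T h) k) (chain_filter \<C>)"
    "\<And>S. \<lbrakk>positive_op S; \<And>A. A \<in> \<C> \<Longrightarrow> op_le A S\<rbrakk> \<Longrightarrow> op_le T S"
proof -
  let ?F = "chain_filter \<C>"
  note F = chain_filter_facts[OF C]
  have Cp: "\<And>A. A \<in> \<C> \<Longrightarrow> positive_op A" and C1: "\<And>A. A \<in> \<C> \<Longrightarrow> op_le A id_blinfun"
    using C by (auto simp: contraction_chain_def)
  have evb: "\<forall>\<^sub>F B in ?F. B \<in> bops" using F(2) by (rule eventually_mono) (use Cp positive_op_bops in auto)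
  define q where "q h = (SUP A\<in>\<C>. Re (cinner (blinfun_apply A h) h))" for h
  have bdd: "bdd_above ((\<lambda>A. Re (cinner (blinfun_apply A h) h)) ` \<C>)" for h
  proof (rule bdd_aboveI2)
    fix A assume "A \<in> \<C>"
    then show "Re (cinner (blinfun_apply A h) h) \<le> Re (cinner (blinfun_apply id_blinfun h) h)"
      using C1 by (intro op_leD) auto
  qed
  have ne: "\<C> \<noteq> {}" using C by (simp add: contraction_chain_def)
  have q_lim: "((\<lambda>B. cinner (blinfun_apply B h) h) \<longlongrightarrow> of_real (q h)) ?F" for h
  proof -
    have "((\<lambda>B. Re (cinner (blinfun_apply B h) h)) \<longlongrightarrow> q h) ?F"
    proof (rule order_tendstoI)
      fix a assume "a < q h"
      then obtain A where A: "A \<in> \<C>" "a < Re (cinner (blinfun_apply A h) h)"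
        unfolding q_def using less_cSUP_iff[OF ne bdd] by blast
      show "\<forall>\<^sub>F B in ?F. a < Re (cinner (blinfun_apply B h) h)"
        using F(3)[OF A(1)] by (rule eventually_mono) (use A(2) op_leD less_le_trans in blast)
    next
      fix a assume a: "q h < a"
      show "\<forall>\<^sub>F B in ?F. Re (cinner (blinfun_apply B h) h) < a"
        using F(2)
      proof (rule eventually_mono)
        fix B assume "B \<in> \<C>"
        then have "Re (cinner (blinfun_apply B h) h) \<le> q h" unfolding q_def by (intro cSUP_upper bdd)
        then show "Re (cinner (blinfun_apply B h) h) < a" using a by linarith
      qed
    qed
    then have "((\<lambda>B. complex_of_real (Re (cinner (blinfun_apply B h) h))) \<longlongrightarrow> of_real (q h)) ?F"
      by (rule tendsto_of_real)
    then show ?thesis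
    proof (rule Lim_transform_eventually)
      show "\<forall>\<^sub>F B in ?F. complex_of_real (Re (cinner (blinfun_apply B h) h)) = cinner (blinfun_apply B h) h"
        using F(2) by (rule eventually_mono) (use Cp in \<open>auto simp: positive_op_iff complex_eq_iff\<close>)
    qed
  qed
  define b where "b h k = (of_real (q (h + k)) - of_real (q (h - k)) + \<i> * of_real (q (h + \<i> *\<^sub>C k))
      - \<i> * of_real (q (h - \<i> *\<^sub>C k))) / 4" for h k
  have b_lim: "((\<lambda>B. cinner (blinfun_apply B h) k) \<longlongrightarrow> b h k) ?F" for h k
  proof -
    have "((\<lambda>B. (cinner (blinfun_apply B (h + k)) (h + k) - cinner (blinfun_apply B (h - k)) (h - k)
        + \<i> * cinner (blinfun_apply B (h + \<i> *\<^sub>C k)) (h + \<i> *\<^sub>C k)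
        - \<i> * cinner (blinfun_apply B (h - \<i> *\<^sub>C k)) (h - \<i> *\<^sub>C k)) / 4) \<longlongrightarrow> b h k) ?F"
      unfolding b_def by (intro tendsto_divide tendsto_add tendsto_diff tendsto_mult tendsto_const q_lim) simp
    then show ?thesis
    proof (rule Lim_transform_eventually)
      show "\<forall>\<^sub>F B in ?F. (cinner (blinfun_apply B (h + k)) (h + k) - cinner (blinfun_apply B (h - k)) (h - k)
        + \<i> * cinner (blinfun_apply B (h + \<i> *\<^sub>C k)) (h + \<i> *\<^sub>C k)
        - \<i> * cinner (blinfun_apply B (h - \<i> *\<^sub>C k)) (h - \<i> *\<^sub>C k)) / 4 = cinner (blinfun_apply B h) k"
        using evb by (rule eventually_mono) (simp add: polarization[symmetric])
    qed
  qed
  \<comment> \<open>Through uniqueness of limits the algebraic laws of \<open>b\<close> are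
    inherited from the operators in the chain.\<close>
  have b_cong: "b h k = x" if "\<forall>\<^sub>F B in ?F. cinner (blinfun_apply B h) k = f B" "(f \<longlongrightarrow> x) ?F" for h k f x
  proof -
    have "(f \<longlongrightarrow> b h k) ?F" using b_lim that(1) by (rule Lim_transform_eventually)
    then show ?thesis using that(2) F(1) tendsto_unique by blast
  qed
  obtain T where T: "T \<in> bops" "norm T \<le> 1" "\<And>h k. cinner (blinfun_apply T h) k = b h k"
  proof (rule bops_sesquilinear_rep[of b 1])
    show "b (x + y) k = b x k + b y k" for x y k
      by (rule b_cong[OF _ tendsto_add[OF b_lim b_lim]]) (simp add: blinfun.add_right cinner_add_left)
    show "b h (x + y) = b h x + b h y" for h x y
      by (rule b_cong[OF _ tendsto_add[OF b_lim b_lim]]) (simp add: cinner_add_right)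
    show "b (c *\<^sub>C x) k = c * b x k" for c x k
      by (rule b_cong[OF _ tendsto_mult[OF tendsto_const b_lim]])
         (rule eventually_mono[OF evb], simp add: bopsD cinner_scaleC_left)
    show "b h (c *\<^sub>C x) = cnj c * b h x" for c h x
      by (rule b_cong[OF _ tendsto_mult[OF tendsto_const b_lim]]) (simp add: cinner_scaleC_right)
    show "cmod (b h k) \<le> 1 * norm h * norm k" for h k
    proof (rule tendsto_upperbound[OF tendsto_norm[OF b_lim]])
      show "\<forall>\<^sub>F B in ?F. norm (cinner (blinfun_apply B h) k) \<le> 1 * norm h * norm k"
        using F(2) by (rule eventually_mono) (simp add: contraction_bound(3)[OF Cp C1])
    qed (rule F(1))
  qed auto
  have lim: "((\<lambda>B. cinner (blinfun_apply B h) k) \<longlongrightarrow> cinner (blinfun_apply T h) k) ?F" for h k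
    unfolding T(3) by (rule b_lim)
  have Tq: "cinner (blinfun_apply T h) h = of_real (q h)" for h
    using lim[of h h] q_lim[of h] F(1) tendsto_unique by blast
  have up: "Re (cinner (blinfun_apply A h) h) \<le> q h" if "A \<in> \<C>" for A h
    unfolding q_def by (rule cSUP_upper[OF that bdd])
  have least: "q h \<le> x" if "\<And>A. A \<in> \<C> \<Longrightarrow> Re (cinner (blinfun_apply A h) h) \<le> x" for h x
    unfolding q_def by (rule cSUP_least[OF ne that])
  have Tp: "positive_op T"
  proof -
    obtain A where "A \<in> \<C>" using ne by blast
    then have "0 \<le> q h" for h using up[of A h] Cp[of A] unfolding positive_op_iff by (meson order_trans)
    then show ?thesis unfolding positive_op_iff Tq using T(1) by simp
  qed
  have le: "op_le T S" if "positive_op S" "\<And>A. A \<in> \<C> \<Longrightarrow> op_le A S" for S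
    by (rule op_leI[OF Tp that(1)]) (simp add: Tq, rule least, rule op_leD, rule that(2))
  show ?thesis
  proof (rule that[OF Tp _ _ lim le])
    show "op_le T id_blinfun" by (rule le) (use C1 in auto)
    show "op_le A T" if "A \<in> \<C>" for A
      using op_leI[OF Cp[OF that] Tp] up[OF that] by (simp add: Tq)
  qed
qed

text \<open>All operators concerned have norm at most 1, so cutting \<open>x\<close> off at a large
  index changes the coefficients uniformly little; what remains is a finite sum of convergent
  coefficients.\<close>

lemma chain_sup_ampl_tendsto:
  assumes C: "contraction_chain \<C>" and T: "norm T \<le> 1"
    and lim: "\<And>h k. ((\<lambda>B. cinner (blinfun_apply B h) k) \<longlongrightarrow> cinner (blinfun_apply T h) k) (chain_filter \<C>)"
  shows "((\<lambda>B. cinner (ampl B x) y) \<longlongrightarrow> cinner (ampl T x) y) (chain_filter \<C>)"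
proof (rule tendstoI)
  fix e :: real assume e: "0 < e"
  let ?F = "chain_filter \<C>"
  have small: "norm (cinner (ampl B (x - z)) y) \<le> norm (x - z) * norm y" if "norm B \<le> 1" for B z
  proof -
    have "norm (cinner (ampl B (x - z)) y) \<le> norm (ampl B (x - z)) * norm y" by (rule norm_cinner_le)
    also have "\<dots> \<le> (norm B * norm (x - z)) * norm y" by (intro mult_right_mono norm_ampl_le) auto
    also have "\<dots> \<le> (1 * norm (x - z)) * norm y" using that by (intro mult_right_mono) auto
    finally show ?thesis by simp
  qed
  have "(\<lambda>N. norm (trunc_l2 N x - x) * norm y) \<longlonglongrightarrow> 0"
    by (intro tendsto_mult_left_zero tendsto_norm_zero LIM_zero trunc_l2_tendsto)
  then have "\<forall>\<^sub>F N in sequentially. norm (trunc_l2 N x - x) * norm y < e / 3"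
    by (rule order_tendstoD) (use e in simp)
  then obtain N where N: "norm (x - trunc_l2 N x) * norm y < e / 3"
    by (auto simp: eventually_sequentially norm_minus_commute)
  let ?z = "trunc_l2 N x"
  have split: "cinner (ampl B x) y = cinner (ampl B (x - ?z)) y + cinner (ampl B ?z) y" for B :: "'a \<Rightarrow>\<^sub>L 'a"
    by (simp add: ampl_add_right[symmetric] cinner_add_left[symmetric])
  have "((\<lambda>B. cinner (ampl B ?z) y) \<longlongrightarrow> cinner (ampl T ?z) y) ?F"
    unfolding cinner_ampl_trunc by (intro tendsto_sum lim)
  then have "\<forall>\<^sub>F B in ?F. dist (cinner (ampl B ?z) y) (cinner (ampl T ?z) y) < e / 3"
    by (rule tendstoD) (use e in simp)
  with chain_filter_facts(2)[OF C] show "\<forall>\<^sub>F B in ?F. dist (cinner (ampl B x) y) (cinner (ampl T x) y) < e"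
  proof eventually_elim
    case (elim B)
    then have "norm B \<le> 1" using C contraction_bound(2) by (auto simp: contraction_chain_def)
    then have "norm (cinner (ampl B (x - ?z)) y) < e / 3" "norm (cinner (ampl T (x - ?z)) y) < e / 3"
      using small[of B ?z] small[OF T, of ?z] N by linarith+
    moreover have "dist (cinner (ampl B x) y) (cinner (ampl T x) y) \<le>
        norm (cinner (ampl B (x - ?z)) y) + norm (cinner (ampl T (x - ?z)) y)
        + dist (cinner (ampl B ?z) y) (cinner (ampl T ?z) y)"
      unfolding split[of B] split[of T] dist_norm
      using norm_triangle_ineq4[of "cinner (ampl B (x - ?z)) y" "cinner (ampl T (x - ?z)) y"]
        norm_diff_triangle_ineq[of "cinner (ampl B (x - ?z)) y" "cinner (ampl B ?z) y"
          "cinner (ampl T (x - ?z)) y" "cinner (ampl T ?z) y"] by linarith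
    ultimately show ?case using elim by linarith
  qed
qed

text \<open>\<open>\<ell>\<^sup>2(\<nat>, \<ell>\<^sup>2) \<cong> \<ell>\<^sup>2\<close> through the pairing function.\<close>

lemma l2_combine:
  fixes x :: "nat \<Rightarrow> 'a::complex_hilbert l2seq"
  assumes "summable (\<lambda>m. (norm (x m))\<^sup>2)"
  obtains z :: "'a l2seq" where
    "\<And>(A :: 'a \<Rightarrow>\<^sub>L 'a) N. (\<Sum>m<N. (norm (ampl A (x m)))\<^sup>2) \<le> (norm (ampl A z))\<^sup>2"
proof -
  define g where "g i = l2_nth (x (fst (prod_decode i))) (snd (prod_decode i))" for i
  have part: "(\<Sum>n<K. (norm (l2_nth y n))\<^sup>2) \<le> (norm y)\<^sup>2" for y :: "'a l2seq" and K
    unfolding norm_l2_sq using l2_nth_ell2[of y] by (intro sum_le_suminf) (auto simp: ell2_iff)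
  have "g \<in> ell2"
    unfolding ell2_iff
  proof (rule summableI_nonneg_bounded)
    fix K
    \<comment> \<open>Both components of a pair are bounded by its code, so an initial segment of
      codes lies in a square.\<close>
    have sub: "prod_decode ` {..<K} \<subseteq> {..<K} \<times> {..<K}"
    proof
      fix p assume "p \<in> prod_decode ` {..<K}"
      then obtain i where i: "p = prod_decode i" "i < K" by auto
      then have "prod_encode p = i" by simp
      then have "fst p \<le> i" "snd p \<le> i"
        using le_prod_encode_1[of "fst p" "snd p"] le_prod_encode_2[of "snd p" "fst p"] by auto
      then show "p \<in> {..<K} \<times> {..<K}" using i(2) by (cases p) auto
    qed
    have "(\<Sum>i<K. (norm (g i))\<^sup>2) = (\<Sum>p\<in>prod_decode ` {..<K}. (norm (l2_nth (x (fst p)) (snd p)))\<^sup>2)"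
      by (subst sum.reindex) (auto simp: g_def intro: inj_on_subset[OF inj_prod_decode])
    also have "\<dots> \<le> (\<Sum>p\<in>{..<K} \<times> {..<K}. (norm (l2_nth (x (fst p)) (snd p)))\<^sup>2)"
      by (rule sum_mono2[OF _ sub]) auto
    also have "\<dots> = (\<Sum>m<K. \<Sum>n<K. (norm (l2_nth (x m) n))\<^sup>2)"
      by (simp add: sum.cartesian_product case_prod_unfold)
    also have "\<dots> \<le> (\<Sum>m<K. (norm (x m))\<^sup>2)" by (intro sum_mono part)
    also have "\<dots> \<le> (\<Sum>m. (norm (x m))\<^sup>2)" by (intro sum_le_suminf assms) auto
    finally show "(\<Sum>i<K. (norm (g i))\<^sup>2) \<le> (\<Sum>m. (norm (x m))\<^sup>2)" .
  qed simp
  then have z: "l2_nth (Abs_l2 g) = g" by (rule Abs_l2_inverse)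
  show ?thesis
  proof (rule that[of "Abs_l2 g"])
    fix A :: "'a \<Rightarrow>\<^sub>L 'a" and N
    let ?z = "ampl A (Abs_l2 g)"
    \<comment> \<open>A rectangle of indices is a finite set of codes, so its sum is part of the
      series for the square of \<open>norm ?z\<close>.\<close>
    have "(\<Sum>m<N. \<Sum>n<K. (norm (l2_nth (ampl A (x m)) n))\<^sup>2) \<le> (norm ?z)\<^sup>2" for K
    proof -
      have "(\<Sum>m<N. \<Sum>n<K. (norm (l2_nth (ampl A (x m)) n))\<^sup>2)
          = (\<Sum>p\<in>{..<N} \<times> {..<K}. (norm (l2_nth (ampl A (x (fst p))) (snd p)))\<^sup>2)"
        by (simp add: sum.cartesian_product case_prod_unfold)
      also have "\<dots> = (\<Sum>i\<in>prod_encode ` ({..<N} \<times> {..<K}). (norm (l2_nth ?z i))\<^sup>2)"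
        by (subst sum.reindex) (auto simp: z g_def intro: inj_on_subset[OF inj_prod_encode])
      also have "\<dots> \<le> (norm ?z)\<^sup>2"
        unfolding norm_l2_sq[of ?z] using l2_nth_ell2[of ?z] by (intro sum_le_suminf) (auto simp: ell2_iff)
      finally show ?thesis .
    qed
    moreover have "(\<lambda>K. \<Sum>m<N. \<Sum>n<K. (norm (l2_nth (ampl A (x m)) n))\<^sup>2) \<longlonglongrightarrow> (\<Sum>m<N. (norm (ampl A (x m)))\<^sup>2)"
      unfolding norm_l2_sq
      by (intro tendsto_sum summable_LIMSEQ) (use l2_nth_ell2 ell2_iff in blast)
    ultimately show "(\<Sum>m<N. (norm (ampl A (x m)))\<^sup>2) \<le> (norm ?z)\<^sup>2"
      by (intro LIMSEQ_le_const2) auto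
  qed
qed

section \<open>Normality of \<open>*\<close>-isomorphisms\<close>

lemma id_blinfun_compose [simp]: "id_blinfun o\<^sub>L A = A"
  and blinfun_compose_id [simp]: "A o\<^sub>L id_blinfun = A"
  by (rule blinfun_eqI; simp)+

lemma von_neumann_algebraD:
  assumes "von_neumann_algebra \<M>"
  shows "\<M> \<subseteq> bops" "csubspace \<M>" "id_blinfun \<in> \<M>" "closedin (op_topology WOT bops) \<M>"
    "A \<in> \<M> \<Longrightarrow> A \<in> bops" "A \<in> \<M> \<Longrightarrow> B \<in> \<M> \<Longrightarrow> A o\<^sub>L B \<in> \<M>" "A \<in> \<M> \<Longrightarrow> adj A \<in> \<M>"
    "A \<in> \<M> \<Longrightarrow> B \<in> \<M> \<Longrightarrow> A + B \<in> \<M>" "A \<in> \<M> \<Longrightarrow> B \<in> \<M> \<Longrightarrow> A - B \<in> \<M>"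
    "A \<in> \<M> \<Longrightarrow> r *\<^sub>R A \<in> \<M>" "A \<in> \<M> \<Longrightarrow> c *\<^sub>C A \<in> \<M>" "0 \<in> \<M>"
proof -
  note vn = assms[unfolded von_neumann_algebra_def]
  show s: "\<M> \<subseteq> bops" "csubspace \<M>" "id_blinfun \<in> \<M>" "closedin (op_topology WOT bops) \<M>"
    using vn by blast+
  show "A \<in> \<M> \<Longrightarrow> A \<in> bops" using s(1) by blast
  show "A \<in> \<M> \<Longrightarrow> B \<in> \<M> \<Longrightarrow> A o\<^sub>L B \<in> \<M>" "A \<in> \<M> \<Longrightarrow> adj A \<in> \<M>" using vn by blast+
  show add: "A \<in> \<M> \<Longrightarrow> B \<in> \<M> \<Longrightarrow> A + B \<in> \<M>" for A B using s(2) by (auto simp: csubspace_def)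
  show sc: "A \<in> \<M> \<Longrightarrow> c *\<^sub>C A \<in> \<M>" for A c using s(2) by (auto simp: csubspace_def)
  show "A \<in> \<M> \<Longrightarrow> r *\<^sub>R A \<in> \<M>" using sc by (simp add: scaleR_blinfun_scaleC)
  show "A \<in> \<M> \<Longrightarrow> B \<in> \<M> \<Longrightarrow> A - B \<in> \<M>" using add[of A "(-1) *\<^sub>C B"] sc[of B "-1"] by (simp add: scaleC_minus_one)
  show "0 \<in> \<M>" using s(2) by (auto simp: csubspace_def)
qed

text \<open>Norm limits are weak operator limits; consequently square roots stay in the von Neumann
  algebra.\<close>

lemma norm_closed_algebra_von_neumann:
  assumes "von_neumann_algebra \<M>" shows "norm_closed_algebra \<M>"
proof -
  note M = von_neumann_algebraD[OF assms]
  have "closed \<M>"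
    unfolding closed_sequential_limits
  proof (intro allI impI, elim conjE)
    fix X l assume X: "\<forall>n. X n \<in> \<M>" and l: "X \<longlonglongrightarrow> l"
    have "l \<in> bops" using closed_bops X l M(5) unfolding closed_sequential_limits by blast
    then show "l \<in> \<M>"
      by (intro WOT_closed_limit[OF M(4) sequentially_bot, of X])
         (use X in \<open>auto intro!: tendsto_intros l\<close>)
  qed
  then show ?thesis
    unfolding norm_closed_algebra_def by (intro conjI ballI allI M(3) M(6) M(8) M(10))
qed

lemma von_neumann_sqrt:
  assumes "von_neumann_algebra \<M>" "A \<in> \<M>" "positive_op A" shows "sqrt_op A \<in> \<M>"
  using sqrt_op_in[OF assms(3) norm_closed_algebra_von_neumann[OF assms(1)] assms(2)] .

lemma chain_sup_von_neumann:
  assumes vn: "von_neumann_algebra \<M>" and C: "contraction_chain \<C>" "\<C> \<subseteq> \<M>"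
  obtains T where "T \<in> \<M>" "positive_op T" "op_le T id_blinfun" "\<And>A. A \<in> \<C> \<Longrightarrow> op_le A T"
    "\<And>h k. ((\<lambda>B. cinner (blinfun_apply B h) k) \<longlongrightarrow> cinner (blinfun_apply T h) k) (chain_filter \<C>)"
    "\<And>S. \<lbrakk>positive_op S; \<And>A. A \<in> \<C> \<Longrightarrow> op_le A S\<rbrakk> \<Longrightarrow> op_le T S"
proof -
  obtain T where T: "positive_op T" "op_le T id_blinfun" "\<And>A. A \<in> \<C> \<Longrightarrow> op_le A T"
    "\<And>h k. ((\<lambda>B. cinner (blinfun_apply B h) k) \<longlongrightarrow> cinner (blinfun_apply T h) k) (chain_filter \<C>)"
    "\<And>S. \<lbrakk>positive_op S; \<And>A. A \<in> \<C> \<Longrightarrow> op_le A S\<rbrakk> \<Longrightarrow> op_le T S"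
    using chain_sup[OF C(1)] by metis
  have "\<forall>\<^sub>F B in chain_filter \<C>. B \<in> \<M>"
    using chain_filter_facts(2)[OF C(1)] by (rule eventually_mono) (use C(2) in blast)
  then have "T \<in> \<M>"
    using WOT_closed_limit[OF von_neumann_algebraD(4)[OF vn] chain_filter_facts(1)[OF C(1)], of "\<lambda>B. B" T]
      T(1,4) positive_op_bops by blast
  then show ?thesis using that T by blast
qed

text \<open>The factor \<open>sqrt 2\<close> comes from
  \<open>(p + q)^2 \<le> 2 p^2 + 2 q^2\<close>. This replaces a sum of two dominating seminorms by
  one.\<close>

lemma add_le_interleave:
  assumes "0 \<le> p" "0 \<le> q" "p \<le> norm x" "q \<le> norm y"
  shows "p + q \<le> norm (sqrt 2 *\<^sub>R interleave x y)"
proof (rule power2_le_imp_le)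
  have "(p + q)\<^sup>2 \<le> 2 * p\<^sup>2 + 2 * q\<^sup>2" using norm_add_sq_le[of p q] by simp
  also have "\<dots> \<le> 2 * (norm x)\<^sup>2 + 2 * (norm y)\<^sup>2"
    using assms by (intro add_mono mult_left_mono power_mono) auto
  also have "\<dots> = (norm (sqrt 2 *\<^sub>R interleave x y))\<^sup>2" by (simp add: power_mult_distrib norm_interleave_sq)
  finally show "(p + q)\<^sup>2 \<le> (norm (sqrt 2 *\<^sub>R interleave x y))\<^sup>2" .
qed simp

text \<open>With \<open>S\<close> the square root of \<open>B - A\<close>, the difference of the two
  sides is the square of \<open>norm (ampl S x)\<close>.\<close>

lemma ampl_le: "op_le A B \<Longrightarrow> Re (cinner (ampl A x) x) \<le> Re (cinner (ampl B x) x)"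
proof -
  assume "op_le A B"
  then have p: "positive_op (B - A)" by (simp add: op_le_def)
  let ?S = "sqrt_op (B - A)"
  have S: "positive_op ?S" "?S o\<^sub>L ?S = B - A" using sqrt_op_positive[OF p] sqrt_op_square[OF p] by auto
  have "cinner (ampl ?S (ampl ?S x)) x = cinner (ampl ?S x) (ampl ?S x)"
    using cinner_ampl_adj[OF positive_op_bops[OF S(1)], of "ampl ?S x" x]
    unfolding positive_op_adj[OF S(1)] .
  then have "cinner (ampl (B - A) x) x = cinner (ampl ?S x) (ampl ?S x)"
    unfolding ampl_comp[symmetric] S(2) .
  then have "0 \<le> Re (cinner (ampl (B - A) x) x)" by (simp add: cinner_ge_zero)
  then show ?thesis by (simp add: ampl_diff_left cinner_diff_left)
qed

text \<open>Cauchy-Schwarz for the form of \<open>X\<close> at \<open>h\<close> and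
  \<open>y = X h\<close> gives \<open>|y|^4 \<le> \<langle>y, h\<rangle> \<langle>X y, y\<rangle>
  \<le> \<langle>y, h\<rangle> |y|^2\<close>. Writing the square as \<open>adj X\<close> times
  \<open>X\<close> matches \<open>norm_gns_sq\<close>.\<close>

lemma positive_square_le:
  assumes "positive_op X" "op_le X id_blinfun" shows "op_le (adj X o\<^sub>L X) X"
proof (rule op_leI)
  note X = contraction_bound(1)[OF assms] positive_op_adj[OF assms(1)]
  show "positive_op (adj X o\<^sub>L X)" by (rule positive_op_adj_self[OF X(1)])
  fix h
  let ?y = "blinfun_apply X h"
  have p: "0 \<le> Re (cinner ?y h)" using assms(1) by (simp add: positive_op_iff)
  have "(cmod (cinner ?y ?y))\<^sup>2 \<le> Re (cinner ?y h) * Re (cinner (blinfun_apply X ?y) ?y)"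
    by (rule positive_op_Cauchy_Schwarz[OF assms(1)])
  also have "\<dots> \<le> Re (cinner ?y h) * (norm ?y)\<^sup>2"
    using op_leD[OF assms(2), of ?y] p by (intro mult_left_mono) (auto simp: Re_cinner_self)
  finally have *: "(norm ?y)\<^sup>2 * (norm ?y)\<^sup>2 \<le> Re (cinner ?y h) * (norm ?y)\<^sup>2"
    unfolding cinner_self norm_of_real by (simp add: power2_eq_square)
  have "(norm ?y)\<^sup>2 \<le> Re (cinner ?y h)"
  proof (cases "?y = 0")
    case False
    then show ?thesis using * by (metis mult_right_le_imp_le zero_less_norm_iff zero_less_power)
  qed (use p in simp)
  then show "Re (cinner (blinfun_apply (adj X o\<^sub>L X) h) h) \<le> Re (cinner ?y h)"
    using X(1) by (simp add: cinner_adj_left Re_cinner_self)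
qed (rule assms)

lemma power_square_swap: "((a :: real) ^ m)\<^sup>2 = (a\<^sup>2) ^ m"
  by (metis power_mult mult.commute)

lemma op_Zorn:
  assumes S: "\<And>A. A \<in> S \<Longrightarrow> positive_op A \<and> op_le A id_blinfun" and ne: "S \<noteq> {}"
    and ch: "\<And>\<C>. \<lbrakk>contraction_chain \<C>; \<C> \<subseteq> S\<rbrakk> \<Longrightarrow> \<exists>u\<in>S. \<forall>a\<in>\<C>. op_le a u"
  obtains m where "m \<in> S" "\<And>a. \<lbrakk>a \<in> S; op_le m a\<rbrakk> \<Longrightarrow> a = m"
proof -
  have "\<exists>m\<in>S. \<forall>a\<in>S. op_le m a \<longrightarrow> a = m"
  proof (rule predicate_Zorn)
    show "partial_order_on S (relation_of op_le S)"
      by (rule partial_order_on_relation_ofI) (auto intro: op_le_trans op_le_antisym)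
    fix \<C> assume "\<C> \<in> Chains (relation_of op_le S)"
    then have C: "\<C> \<subseteq> S" "\<And>A B. A \<in> \<C> \<Longrightarrow> B \<in> \<C> \<Longrightarrow> op_le A B \<or> op_le B A"
      by (auto simp: Chains_def relation_of_def)
    show "\<exists>u\<in>S. \<forall>a\<in>\<C>. op_le a u"
    proof (cases "\<C> = {}")
      case False
      then have "contraction_chain \<C>" using C S unfolding contraction_chain_def by blast
      then show ?thesis using ch C(1) by blast
    qed (use ne in auto)
  qed
  then show ?thesis using that by blast
qed

section \<open>Star-isomorphisms as order isomorphisms\<close>

lemma star_isomorphism_inv:
  assumes iso: "star_isomorphism \<M> \<N> \<pi>" and vn: "von_neumann_algebra \<M>"
  shows "star_isomorphism \<N> \<M> (inv_into \<M> \<pi>)"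
proof -
  let ?\<phi> = "inv_into \<M> \<pi>"
  note M = von_neumann_algebraD[OF vn]
  have bij: "bij_betw \<pi> \<M> \<N>" using iso by (simp add: star_isomorphism_def)
  have in_M: "?\<phi> B \<in> \<M>" and pi: "\<pi> (?\<phi> B) = B" if "B \<in> \<N>" for B
    using bij that by (auto simp: bij_betw_def inv_into_into f_inv_into_f)
  have eq: "?\<phi> B = A" if "A \<in> \<M>" "\<pi> A = B" for A B
    using bij that by (auto simp: bij_betw_def)
  show ?thesis
    unfolding star_isomorphism_def
  proof (intro conjI ballI allI)
    show "bij_betw ?\<phi> \<N> \<M>" using bij by (rule bij_betw_inv_into)
    fix A B assume A: "A \<in> \<N>" and B: "B \<in> \<N>"
    show "?\<phi> (A + B) = ?\<phi> A + ?\<phi> B"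
      using iso in_M[OF A] in_M[OF B] pi[OF A] pi[OF B] by (intro eq M) (auto simp: star_isomorphism_def)
    show "?\<phi> (A o\<^sub>L B) = ?\<phi> A o\<^sub>L ?\<phi> B"
      using iso in_M[OF A] in_M[OF B] pi[OF A] pi[OF B] by (intro eq M) (auto simp: star_isomorphism_def)
  next
    fix c A assume A: "A \<in> \<N>"
    show "?\<phi> (c *\<^sub>C A) = c *\<^sub>C ?\<phi> A"
      using iso in_M[OF A] pi[OF A] by (intro eq M) (auto simp: star_isomorphism_def)
  next
    fix A assume A: "A \<in> \<N>"
    show "?\<phi> (adj A) = adj (?\<phi> A)"
      using iso in_M[OF A] pi[OF A] by (intro eq M) (auto simp: star_isomorphism_def)
  qed
qed

context
  fixes \<M> :: "('h::complex_hilbert \<Rightarrow>\<^sub>L 'h) set" and \<N> :: "('l::complex_hilbert \<Rightarrow>\<^sub>L 'l) set"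
    and \<pi> :: "('h \<Rightarrow>\<^sub>L 'h) \<Rightarrow> ('l \<Rightarrow>\<^sub>L 'l)"
  assumes vM: "von_neumann_algebra \<M>" and vN: "von_neumann_algebra \<N>"
    and iso: "star_isomorphism \<M> \<N> \<pi>"
begin

private lemmas MA = von_neumann_algebraD[OF vM]
private lemmas NA = von_neumann_algebraD[OF vN]

lemma iso_in [simp]: "A \<in> \<M> \<Longrightarrow> \<pi> A \<in> \<N>"
  and iso_add: "A \<in> \<M> \<Longrightarrow> B \<in> \<M> \<Longrightarrow> \<pi> (A + B) = \<pi> A + \<pi> B"
  and iso_scaleC: "A \<in> \<M> \<Longrightarrow> \<pi> (c *\<^sub>C A) = c *\<^sub>C \<pi> A"
  and iso_comp: "A \<in> \<M> \<Longrightarrow> B \<in> \<M> \<Longrightarrow> \<pi> (A o\<^sub>L B) = \<pi> A o\<^sub>L \<pi> B"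
  and iso_adj: "A \<in> \<M> \<Longrightarrow> \<pi> (adj A) = adj (\<pi> A)"
  and iso_bij: "bij_betw \<pi> \<M> \<N>"
  using iso by (auto simp: star_isomorphism_def bij_betw_def)

lemma iso_scaleR: "A \<in> \<M> \<Longrightarrow> \<pi> (r *\<^sub>R A) = r *\<^sub>R \<pi> A"
  by (simp add: scaleR_blinfun_scaleC iso_scaleC)

lemma iso_diff: "A \<in> \<M> \<Longrightarrow> B \<in> \<M> \<Longrightarrow> \<pi> (A - B) = \<pi> A - \<pi> B"
  using iso_add[of A "(-1) *\<^sub>C B"] iso_scaleC[of B "-1"] MA(11)[of B "-1"] by (simp add: scaleC_minus_one)

text \<open>Preservation of the unit follows from surjectivity: a preimage \<open>u\<close> of the
  identity gives \<open>1 = \<pi> (u 1) = \<pi> u \<pi> 1 = \<pi> 1\<close>.\<close>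

lemma iso_id: "\<pi> id_blinfun = id_blinfun"
proof -
  obtain u where u: "u \<in> \<M>" "\<pi> u = id_blinfun"
    using iso_bij NA(3) unfolding bij_betw_def by (metis imageE)
  have "\<pi> (u o\<^sub>L id_blinfun) = \<pi> u o\<^sub>L \<pi> id_blinfun" by (rule iso_comp[OF u(1) MA(3)])
  then show ?thesis by (simp add: u(2))
qed

text \<open>Positivity is algebraic: the root of \<open>A\<close> lies in the algebra, so
  \<open>A\<close> is the square of a self-adjoint element, and so is its image.\<close>

lemma iso_positive:
  assumes "A \<in> \<M>" "positive_op A" shows "positive_op (\<pi> A)"
proof -
  let ?B = "sqrt_op A"
  have B: "?B \<in> \<M>" by (rule von_neumann_sqrt[OF vM assms])
  have "adj ?B = ?B" using positive_op_adj[OF sqrt_op_positive[OF assms(2)]] .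
  then have "\<pi> A = adj (\<pi> ?B) o\<^sub>L \<pi> ?B"
    using iso_comp[OF B B] iso_adj[OF B] sqrt_op_square[OF assms(2)] by simp
  then show ?thesis using positive_op_adj_self[OF NA(5)[OF iso_in[OF B]]] by simp
qed

lemma iso_le: "\<lbrakk>A \<in> \<M>; B \<in> \<M>; op_le A B\<rbrakk> \<Longrightarrow> op_le (\<pi> A) (\<pi> B)"
  unfolding op_le_def using iso_positive[of "B - A"] iso_diff[of B A] MA(9)[of B A] by simp

end

context
  fixes \<M> :: "('h::complex_hilbert \<Rightarrow>\<^sub>L 'h) set" and \<N> :: "('l::complex_hilbert \<Rightarrow>\<^sub>L 'l) set"
    and \<pi> :: "('h \<Rightarrow>\<^sub>L 'h) \<Rightarrow> ('l \<Rightarrow>\<^sub>L 'l)"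
  assumes vM: "von_neumann_algebra \<M>" and vN: "von_neumann_algebra \<N>"
    and iso: "star_isomorphism \<M> \<N> \<pi>"
begin

private lemmas M = von_neumann_algebraD[OF vM]
private lemmas N = von_neumann_algebraD[OF vN]
private lemmas p_in = iso_in[OF vM vN iso]
private lemmas p_add = iso_add[OF vM vN iso]
private lemmas p_scaleC = iso_scaleC[OF vM vN iso]
private lemmas p_comp = iso_comp[OF vM vN iso]
private lemmas p_adj = iso_adj[OF vM vN iso]
private lemmas p_diff = iso_diff[OF vM vN iso]
private lemmas p_id = iso_id[OF vM vN iso]
private lemmas p_positive = iso_positive[OF vM vN iso]
private lemmas p_le = iso_le[OF vM vN iso]

text \<open>A \<open>*\<close>-isomorphism is an order isomorphism, so it maps suprema to suprema.\<close>

lemma iso_chain_sup: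
  assumes C: "contraction_chain \<C>" "\<C> \<subseteq> \<M>" and T: "T \<in> \<M>" "positive_op T"
    and ub: "\<And>A. A \<in> \<C> \<Longrightarrow> op_le A T"
    and lub: "\<And>S. \<lbrakk>positive_op S; \<And>A. A \<in> \<C> \<Longrightarrow> op_le A S\<rbrakk> \<Longrightarrow> op_le T S" and e: "0 < e"
  obtains A where "A \<in> \<C>" "Re (cinner (ampl (\<pi> T) \<zeta>) \<zeta>) - Re (cinner (ampl (\<pi> A) \<zeta>) \<zeta>) < e"
proof -
  let ?\<phi> = "inv_into \<M> \<pi>"
  have Cp: "\<And>A. A \<in> \<C> \<Longrightarrow> positive_op A" and C1: "\<And>A. A \<in> \<C> \<Longrightarrow> op_le A id_blinfun"
    and CM: "\<And>A. A \<in> \<C> \<Longrightarrow> A \<in> \<M>"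
    using C by (auto simp: contraction_chain_def)
  have lin: "\<And>A B. A \<in> \<C> \<Longrightarrow> B \<in> \<C> \<Longrightarrow> op_le A B \<or> op_le B A" using C(1) by (auto simp: contraction_chain_def)
  have ch: "contraction_chain (\<pi> ` \<C>)"
    unfolding contraction_chain_def
  proof (intro conjI ballI)
    show "\<pi> ` \<C> \<noteq> {}" using C(1) by (simp add: contraction_chain_def)
    fix X assume "X \<in> \<pi> ` \<C>"
    then obtain A where A: "A \<in> \<C>" "X = \<pi> A" by blast
    show "positive_op X" using A p_positive CM Cp by blast
    show "op_le X id_blinfun" using p_le[OF CM[OF A(1)] M(3) C1[OF A(1)]] by (simp add: A(2) p_id)
    fix Y assume "Y \<in> \<pi> ` \<C>"
    then obtain B where B: "B \<in> \<C>" "Y = \<pi> B" by blast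
    show "op_le X Y \<or> op_le Y X" using lin[OF A(1) B(1)] p_le CM A B by blast
  qed
  have sub: "\<pi> ` \<C> \<subseteq> \<N>" using CM p_in by blast
  obtain S where S: "S \<in> \<N>" "positive_op S" "op_le S id_blinfun" "\<And>X. X \<in> \<pi> ` \<C> \<Longrightarrow> op_le X S"
    and lim: "\<And>h k. ((\<lambda>B. cinner (blinfun_apply B h) k) \<longlongrightarrow> cinner (blinfun_apply S h) k) (chain_filter (\<pi> ` \<C>))"
    and least: "\<And>S'. \<lbrakk>positive_op S'; \<And>A. A \<in> \<pi> ` \<C> \<Longrightarrow> op_le A S'\<rbrakk> \<Longrightarrow> op_le S S'"
    using chain_sup_von_neumann[OF vN ch sub] by metis
  note inv = star_isomorphism_inv[OF iso vM]
  have bij: "bij_betw \<pi> \<M> \<N>" by (rule iso_bij[OF vM vN iso])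
  have inv_pi: "?\<phi> (\<pi> A) = A" if "A \<in> \<M>" for A using bij that by (auto simp: bij_betw_def)
  have pi_inv: "\<pi> (?\<phi> S) = S" using bij S(1) by (auto simp: bij_betw_def f_inv_into_f)
  \<comment> \<open>\<open>S\<close>, the supremum of the image chain, is compared with
    \<open>\<pi> T\<close> from both sides; the second inequality pulls \<open>S\<close> back along
    the inverse isomorphism.\<close>
  have "op_le S (\<pi> T)"
    by (rule least[OF p_positive[OF T]]) (use p_le CM T(1) ub in blast)
  moreover have "op_le (\<pi> T) S"
  proof -
    have "op_le T (?\<phi> S)"
    proof (rule lub)
      show "positive_op (?\<phi> S)" by (rule iso_positive[OF vN vM inv S(1,2)])
      show "op_le A (?\<phi> S)" if "A \<in> \<C>" for A
        using iso_le[OF vN vM inv p_in[OF CM[OF that]] S(1) S(4)] that CM inv_pi by force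
    qed
    then have "op_le (\<pi> T) (\<pi> (?\<phi> S))" by (rule p_le[OF T(1) iso_in[OF vN vM inv S(1)]])
    then show ?thesis by (simp add: pi_inv)
  qed
  ultimately have ST: "S = \<pi> T" by (rule op_le_antisym)
  let ?F = "chain_filter (\<pi> ` \<C>)"
  have "((\<lambda>B. cinner (ampl B \<zeta>) \<zeta>) \<longlongrightarrow> cinner (ampl S \<zeta>) \<zeta>) ?F"
    by (rule chain_sup_ampl_tendsto[OF ch contraction_bound(2)[OF S(2,3)] lim])
  then have "((\<lambda>B. Re (cinner (ampl B \<zeta>) \<zeta>)) \<longlongrightarrow> Re (cinner (ampl S \<zeta>) \<zeta>)) ?F" by (rule tendsto_Re)
  then have "\<forall>\<^sub>F B in ?F. Re (cinner (ampl S \<zeta>) \<zeta>) - e < Re (cinner (ampl B \<zeta>) \<zeta>)"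
    by (rule order_tendstoD) (use e in simp)
  with chain_filter_facts(2)[OF ch] have "\<forall>\<^sub>F B in ?F. B \<in> \<pi> ` \<C> \<and> Re (cinner (ampl S \<zeta>) \<zeta>) - e < Re (cinner (ampl B \<zeta>) \<zeta>)"
    by (rule eventually_conj)
  then obtain X where "X \<in> \<pi> ` \<C>" "Re (cinner (ampl S \<zeta>) \<zeta>) - e < Re (cinner (ampl X \<zeta>) \<zeta>)"
    using eventually_happens'[OF chain_filter_facts(1)[OF ch]] by blast
  then show ?thesis using that ST by fastforce
qed

text \<open>For a fixed vector \<open>\<zeta>\<close> of the amplification of \<open>\<N>\<close> let \<open>\<J>\<close> consist of the \<open>B \<in> \<M>\<close> for which
  \<open>A \<mapsto> \<pi>(A B) \<zeta>\<close> is dominated by the \<open>\<sigma>\<close>-strong seminorm of some \<open>\<xi>\<close>. Normality amounts to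
  \<open>1 \<in> \<J>\<close>.\<close>

context
  fixes \<zeta> :: "'l l2seq"
begin

definition gns :: "('h \<Rightarrow>\<^sub>L 'h) \<Rightarrow> 'l l2seq" where "gns A = ampl (\<pi> A) \<zeta>"

definition sigma_dominated :: "('h \<Rightarrow>\<^sub>L 'h) \<Rightarrow> 'h l2seq \<Rightarrow> bool" where
  "sigma_dominated B \<xi> \<longleftrightarrow> (\<forall>A\<in>\<M>. norm (gns (A o\<^sub>L B)) \<le> norm (ampl A \<xi>))"

definition sigma_ideal :: "('h \<Rightarrow>\<^sub>L 'h) set" where
  "sigma_ideal = {B \<in> \<M>. \<exists>\<xi>. sigma_dominated B \<xi>}"

lemma gns_add: "A \<in> \<M> \<Longrightarrow> B \<in> \<M> \<Longrightarrow> gns (A + B) = gns A + gns B"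
  by (simp add: gns_def p_add ampl_add_left)

lemma gns_diff: "A \<in> \<M> \<Longrightarrow> B \<in> \<M> \<Longrightarrow> gns (A - B) = gns A - gns B"
  by (simp add: gns_def p_diff ampl_diff_left)

lemma gns_comp: "A \<in> \<M> \<Longrightarrow> B \<in> \<M> \<Longrightarrow> gns (A o\<^sub>L B) = ampl (\<pi> A) (gns B)"
  by (simp add: gns_def p_comp ampl_comp)

lemma norm_gns_sq: "A \<in> \<M> \<Longrightarrow> (norm (gns A))\<^sup>2 = Re (cinner (ampl (\<pi> (adj A o\<^sub>L A)) \<zeta>) \<zeta>)"
proof -
  assume A: "A \<in> \<M>"
  have "cinner (ampl (\<pi> (adj A o\<^sub>L A)) \<zeta>) \<zeta> = cinner (ampl (adj (\<pi> A)) (gns A)) \<zeta>"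
    using A M(7) by (simp add: p_comp p_adj ampl_comp gns_def)
  also have "\<dots> = cinner (gns A) (gns A)"
    using A N(5)[OF p_in[OF A]] by (subst cinner_ampl_adj) (auto simp: gns_def)
  finally show ?thesis by (simp add: Re_cinner_self)
qed

text \<open>If \<open>\<xi>\<close> dominates for \<open>B\<close>, then \<open>ampl C \<xi>\<close>
  dominates for the product.\<close>

lemma sigma_ideal_left: "B \<in> sigma_ideal \<Longrightarrow> C \<in> \<M> \<Longrightarrow> C o\<^sub>L B \<in> sigma_ideal"
proof -
  assume B: "B \<in> sigma_ideal" and C: "C \<in> \<M>"
  then obtain \<xi> where \<xi>: "\<And>A. A \<in> \<M> \<Longrightarrow> norm (gns (A o\<^sub>L B)) \<le> norm (ampl A \<xi>)" and BM: "B \<in> \<M>"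
    unfolding sigma_ideal_def sigma_dominated_def by blast
  have "norm (gns (A o\<^sub>L (C o\<^sub>L B))) \<le> norm (ampl A (ampl C \<xi>))" if A: "A \<in> \<M>" for A
  proof -
    have "A o\<^sub>L (C o\<^sub>L B) = (A o\<^sub>L C) o\<^sub>L B" by (rule blinfun_eqI) simp
    then show ?thesis using \<xi>[OF M(6)[OF A C]] by (simp add: ampl_comp)
  qed
  then show ?thesis using M(6)[OF C BM] unfolding sigma_ideal_def sigma_dominated_def by blast
qed

lemma sigma_ideal_add: "B \<in> sigma_ideal \<Longrightarrow> C \<in> sigma_ideal \<Longrightarrow> B + C \<in> sigma_ideal"
proof -
  assume "B \<in> sigma_ideal" "C \<in> sigma_ideal"
  then obtain x y where x: "\<And>A. A \<in> \<M> \<Longrightarrow> norm (gns (A o\<^sub>L B)) \<le> norm (ampl A x)"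
    and y: "\<And>A. A \<in> \<M> \<Longrightarrow> norm (gns (A o\<^sub>L C)) \<le> norm (ampl A y)" and BC: "B \<in> \<M>" "C \<in> \<M>"
    unfolding sigma_ideal_def sigma_dominated_def by blast
  have "norm (gns (A o\<^sub>L (B + C))) \<le> norm (ampl A (sqrt 2 *\<^sub>R interleave x y))" if A: "A \<in> \<M>" for A
  proof -
    have "A o\<^sub>L (B + C) = (A o\<^sub>L B) + (A o\<^sub>L C)"
      by (rule blinfun_eqI) (simp add: blinfun.add_left blinfun.add_right)
    then have "gns (A o\<^sub>L (B + C)) = gns (A o\<^sub>L B) + gns (A o\<^sub>L C)"
      using A BC by (simp add: gns_add M(6))
    then show ?thesis
      using add_le_interleave[OF norm_ge_zero norm_ge_zero x[OF A] y[OF A]]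
        norm_triangle_ineq[of "gns (A o\<^sub>L B)" "gns (A o\<^sub>L C)"] by (simp add: ampl_scaleR_right ampl_interleave)
  qed
  then show ?thesis using M(8)[OF BC] unfolding sigma_ideal_def sigma_dominated_def by blast
qed

lemma sigma_ideal_diff: "B \<in> sigma_ideal \<Longrightarrow> C \<in> sigma_ideal \<Longrightarrow> B - C \<in> sigma_ideal"
proof -
  assume B: "B \<in> sigma_ideal" and C: "C \<in> sigma_ideal"
  have "((-1) *\<^sub>R id_blinfun) o\<^sub>L C \<in> sigma_ideal" by (rule sigma_ideal_left[OF C]) (intro M)
  moreover have "((-1) *\<^sub>R id_blinfun) o\<^sub>L C = - C"
    by (rule blinfun_eqI) (simp add: blinfun.minus_left)
  ultimately show ?thesis using sigma_ideal_add[OF B, of "- C"] by simp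
qed

text \<open>Replacing \<open>\<xi>\<close> by \<open>(\<xi> + r) / 2\<close>, where \<open>r\<close> represents \<open>A \<mapsto> \<langle>\<pi>(A B) \<zeta>, \<pi>(B) \<zeta>\<rangle>\<close> against \<open>\<xi>\<close>, is one
  step of Heron's iteration for the square root of the Radon-Nikodym derivative; it drives
  \<open>\<parallel>\<xi>\<parallel>\<close> down to \<open>\<parallel>\<pi>(B) \<zeta>\<parallel>\<close> without losing domination.\<close>

lemma sigma_dominated_step:
  assumes B: "B \<in> \<M>" and dom: "sigma_dominated B \<xi>"
  obtains \<xi>' where "sigma_dominated B \<xi>'" "(norm \<xi>')\<^sup>2 \<le> ((norm \<xi>)\<^sup>2 + 3 * (norm (gns B))\<^sup>2) / 4"
proof -
  define l where "l A = cinner (gns (A o\<^sub>L B)) (gns B)" for A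
  have cl: "clinear_on \<M> l"
    unfolding clinear_on_def
  proof (intro conjI ballI allI)
    fix X Y assume XY: "X \<in> \<M>" "Y \<in> \<M>"
    show "l (X + Y) = l X + l Y"
      using XY B by (simp add: l_def gns_comp M(8) p_add ampl_add_left cinner_add_left)
  next
    fix c X assume X: "X \<in> \<M>"
    show "l (c *\<^sub>C X) = c * l X"
      using X B by (simp add: l_def gns_comp M(11) p_scaleC ampl_scaleC_left cinner_scaleC_left)
  qed
  obtain r where r: "norm r \<le> norm (gns B)" "\<And>A. A \<in> \<M> \<Longrightarrow> l A = cinner (ampl A \<xi>) r"
  proof (rule Riesz_complex[OF M(2), of "\<lambda>A. ampl A \<xi>" l "norm (gns B)"])
    fix A assume A: "A \<in> \<M>"
    have "cmod (l A) \<le> norm (gns (A o\<^sub>L B)) * norm (gns B)" unfolding l_def by (rule norm_cinner_le)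
    also have "\<dots> \<le> norm (ampl A \<xi>) * norm (gns B)"
      using dom A unfolding sigma_dominated_def by (intro mult_right_mono) auto
    finally show "cmod (l A) \<le> norm (gns B) * norm (ampl A \<xi>)" by (simp add: mult.commute)
  qed (auto simp: ampl_add_left ampl_scaleC_left cl)
  define \<xi>' where "\<xi>' = (1/2) *\<^sub>R (\<xi> + r)"
  have "sigma_dominated B \<xi>'"
    unfolding sigma_dominated_def
  proof
    fix A assume A: "A \<in> \<M>"
    \<comment> \<open>At \<open>adj A\<close> times \<open>A\<close> the functional \<open>l\<close>
      takes the value \<open>|\<pi>(A B) \<zeta>|^2\<close>, and its representation reads
      \<open>\<langle>A \<xi>, A r\<rangle>\<close>. The inequality
      \<open>4 Re \<langle>u, v\<rangle> \<le> |u + v|^2\<close> then gives domination by the mean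
      of \<open>\<xi>\<close> and \<open>r\<close>.\<close>
    have AA: "adj A o\<^sub>L A \<in> \<M>" using A by (intro M)
    have "l (adj A o\<^sub>L A) = cinner (gns (A o\<^sub>L B)) (gns (A o\<^sub>L B))"
      using A B M(7)[OF A] N(5)[OF p_in[OF A]] cinner_ampl_adj[of "adj (\<pi> A)" "ampl (\<pi> A) (gns B)" "gns B"]
      by (simp add: l_def gns_comp AA p_comp p_adj ampl_comp)
    then have "(norm (gns (A o\<^sub>L B)))\<^sup>2 = Re (cinner (ampl (adj A o\<^sub>L A) \<xi>) r)"
      using r(2)[OF AA] by (simp add: Re_cinner_self[symmetric])
    also have "cinner (ampl (adj A o\<^sub>L A) \<xi>) r = cinner (ampl A \<xi>) (ampl A r)"
      using cinner_ampl_adj[of "adj A" "ampl A \<xi>" r] M(5)[OF A] by (simp add: ampl_comp)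
    also have "Re \<dots> \<le> (norm ((1/2) *\<^sub>R (ampl A \<xi> + ampl A r)))\<^sup>2"
    proof -
      have "(norm (ampl A \<xi> - ampl A r))\<^sup>2
          = (norm (ampl A \<xi>))\<^sup>2 - 2 * Re (cinner (ampl A \<xi>) (ampl A r)) + (norm (ampl A r))\<^sup>2"
        using norm_add_sq[of "ampl A \<xi>" "- ampl A r"] by (simp add: cinner_minus_right)
      then have "4 * Re (cinner (ampl A \<xi>) (ampl A r)) \<le> (norm (ampl A \<xi> + ampl A r))\<^sup>2"
        using norm_add_sq[of "ampl A \<xi>" "ampl A r"] zero_le_power2[of "norm (ampl A \<xi> - ampl A r)"]
        by linarith
      then show ?thesis by (simp add: power_divide)
    qed
    finally have "(norm (gns (A o\<^sub>L B)))\<^sup>2 \<le> (norm (ampl A \<xi>'))\<^sup>2"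
      by (simp only: \<xi>'_def ampl_scaleR_right ampl_add_right)
    then show "norm (gns (A o\<^sub>L B)) \<le> norm (ampl A \<xi>')" by (rule power2_le_imp_le) simp
  qed
  moreover have "(norm \<xi>')\<^sup>2 \<le> ((norm \<xi>)\<^sup>2 + 3 * (norm (gns B))\<^sup>2) / 4"
  proof -
    \<comment> \<open>The representation at \<open>A = 1\<close>. Expanding
      \<open>|\<xi> + r|^2\<close>, the mixed term contributes 2 and \<open>|r|^2\<close> at most 1
      to the coefficient 3.\<close>
    have "Re (cinner \<xi> r) = (norm (gns B))\<^sup>2"
      using r(2)[OF M(3)] by (simp add: l_def Re_cinner_self[symmetric])
    moreover have "(norm r)\<^sup>2 \<le> (norm (gns B))\<^sup>2" using r(1) by (intro power_mono) auto
    ultimately show ?thesis using norm_add_sq[of \<xi> r] by (simp add: \<xi>'_def power_divide)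
  qed
  ultimately show ?thesis using that by blast
qed

text \<open>Each step divides the bound on the excess of \<open>|\<xi>|^2\<close> over the square of
  \<open>norm (gns B)\<close> by 4. The dominating vector of an element with small
  \<open>gns\<close> can thus be taken small, and infinitely many of them become summable.\<close>

lemma sigma_dominated_norm_control:
  assumes B: "B \<in> \<M>" and dom: "sigma_dominated B \<xi>" and e: "0 < e"
  obtains \<xi>' where "sigma_dominated B \<xi>'" "(norm \<xi>')\<^sup>2 \<le> (norm (gns B))\<^sup>2 + e"
proof -
  have it: "\<exists>\<xi>'. sigma_dominated B \<xi>' \<and> (norm \<xi>')\<^sup>2 \<le> (norm (gns B))\<^sup>2 + (norm \<xi>)\<^sup>2 / 4 ^ n" for n :: nat
  proof (induction n)
    case 0
    then show ?case using dom by (intro exI[of _ \<xi>]) simp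
  next
    case (Suc n)
    then obtain x where x: "sigma_dominated B x" "(norm x)\<^sup>2 \<le> (norm (gns B))\<^sup>2 + (norm \<xi>)\<^sup>2 / 4 ^ n" by blast
    obtain y where "sigma_dominated B y" "(norm y)\<^sup>2 \<le> ((norm x)\<^sup>2 + 3 * (norm (gns B))\<^sup>2) / 4"
      by (rule sigma_dominated_step[OF B x(1)])
    moreover have "((norm x)\<^sup>2 + 3 * (norm (gns B))\<^sup>2) / 4 \<le> (norm (gns B))\<^sup>2 + (norm \<xi>)\<^sup>2 / 4 ^ Suc n"
      using x(2) by (simp add: field_simps)
    ultimately show ?case by (meson order_trans)
  qed
  have "(\<lambda>n. (norm \<xi>)\<^sup>2 / 4 ^ n) \<longlonglongrightarrow> 0"
    by (rule LIMSEQ_divide_realpow_zero) simp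
  then have "\<forall>\<^sub>F n in sequentially. (norm \<xi>)\<^sup>2 / 4 ^ n < e" by (rule order_tendstoD) (rule e)
  then obtain n where n: "(norm \<xi>)\<^sup>2 / 4 ^ n < e" by (auto simp: eventually_sequentially)
  obtain \<xi>' where "sigma_dominated B \<xi>'" "(norm \<xi>')\<^sup>2 \<le> (norm (gns B))\<^sup>2 + (norm \<xi>)\<^sup>2 / 4 ^ n" using it by blast
  then show ?thesis using that[of \<xi>'] n by linarith
qed

text \<open>\<open>T\<close> is approached by a sequence \<open>c\<close> from the chain for which
  \<open>gns (c m)\<close> converges geometrically. The successive differences lie in the ideal, and
  norm control makes their dominating vectors square-summable, so that \<open>l2_combine\<close>
  merges them. The sequence need not be increasing: its differences only have to belong to the
  ideal.\<close>

lemma sigma_ideal_chain_sup: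
  assumes C: "contraction_chain \<C>" "\<C> \<subseteq> sigma_ideal"
  obtains T where "T \<in> sigma_ideal" "positive_op T" "op_le T id_blinfun" "\<And>A. A \<in> \<C> \<Longrightarrow> op_le A T"
proof -
  have CM: "\<C> \<subseteq> \<M>" using C(2) by (auto simp: sigma_ideal_def)
  have Cp: "\<And>A. A \<in> \<C> \<Longrightarrow> positive_op A" using C(1) by (auto simp: contraction_chain_def)
  obtain T where T: "T \<in> \<M>" "positive_op T" "op_le T id_blinfun" "\<And>A. A \<in> \<C> \<Longrightarrow> op_le A T"
    and least: "\<And>S. \<lbrakk>positive_op S; \<And>A. A \<in> \<C> \<Longrightarrow> op_le A S\<rbrakk> \<Longrightarrow> op_le T S"
    using chain_sup_von_neumann[OF vM C(1) CM] by metis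
  have "\<exists>A\<in>\<C>. norm (gns (T - A)) \<le> (1/4) ^ m" for m :: nat
  proof -
    \<comment> \<open>Since \<open>X^2 \<le> X\<close> for \<open>X = T - A\<close>, a gap of
      \<open>(1/16) ^ m\<close> between the values of the state yields distance
      \<open>(1/4) ^ m\<close> between the vectors.\<close>
    have e: "(0 :: real) < (1/16) ^ m" by simp
    obtain A where A: "A \<in> \<C>" "Re (cinner (ampl (\<pi> T) \<zeta>) \<zeta>) - Re (cinner (ampl (\<pi> A) \<zeta>) \<zeta>) < (1/16) ^ m"
      by (rule iso_chain_sup[OF C(1) CM T(1,2,4) least e])
    have AM: "A \<in> \<M>" using A(1) CM by blast
    have X: "T - A \<in> \<M>" by (rule M(9)[OF T(1) AM])
    have Xp: "positive_op (T - A)" using T(4)[OF A(1)] by (simp add: op_le_def)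
    have X1: "op_le (T - A) id_blinfun"
    proof -
      have "positive_op ((id_blinfun - T) + A)"
        using T(3) Cp[OF A(1)] by (intro positive_op_add) (auto simp: op_le_def)
      then show ?thesis by (simp add: op_le_def algebra_simps)
    qed
    have "(norm (gns (T - A)))\<^sup>2 \<le> Re (cinner (ampl (\<pi> (T - A)) \<zeta>) \<zeta>)"
      unfolding norm_gns_sq[OF X]
      by (intro ampl_le p_le positive_square_le Xp X1 M X)
    also have "\<dots> < (1/16) ^ m" using A(2) by (simp add: p_diff T(1) AM ampl_diff_left cinner_diff_left)
    finally have "(norm (gns (T - A)))\<^sup>2 \<le> ((1/4) ^ m)\<^sup>2"
      by (simp add: power_square_swap power_divide)
    then have "norm (gns (T - A)) \<le> (1/4) ^ m" by (rule power2_le_imp_le) simp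
    then show ?thesis using A(1) by blast
  qed
  then obtain c where c: "\<And>m. c m \<in> \<C>" "\<And>m. norm (gns (T - c m)) \<le> (1/4) ^ m" by metis
  have cM: "\<And>m. c m \<in> \<M>" and cJ: "\<And>m. c m \<in> sigma_ideal" using c(1) CM C(2) by auto
  define \<Delta> where "\<Delta> m = c (Suc m) - c m" for m
  have \<Delta>M: "\<Delta> m \<in> \<M>" and \<Delta>J: "\<Delta> m \<in> sigma_ideal" for m
    unfolding \<Delta>_def using cM cJ by (auto intro: M(9) sigma_ideal_diff)
  have n\<Delta>: "norm (gns (\<Delta> m)) \<le> 2 * (1/4) ^ m" for m
  proof -
    have "gns (\<Delta> m) = gns (T - c m) - gns (T - c (Suc m))"
      by (simp add: \<Delta>_def gns_diff cM T(1))
    then have "norm (gns (\<Delta> m)) \<le> norm (gns (T - c m)) + norm (gns (T - c (Suc m)))"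
      by (simp only: norm_triangle_ineq4)
    also have "\<dots> \<le> (1/4) ^ m + (1/4) ^ Suc m" by (intro add_mono c(2))
    also have "\<dots> \<le> 2 * (1/4) ^ m" by simp
    finally show ?thesis .
  qed
  \<comment> \<open>5 = 4 + 1: the square of \<open>2 (1/4) ^ m\<close>, plus the tolerance
    \<open>(1/16) ^ m\<close>.\<close>
  have "\<exists>\<xi>. sigma_dominated (\<Delta> m) \<xi> \<and> (norm \<xi>)\<^sup>2 \<le> 5 * (1/16) ^ m" for m
  proof -
    obtain \<xi>0 where "sigma_dominated (\<Delta> m) \<xi>0" using \<Delta>J[of m] unfolding sigma_ideal_def by blast
    then obtain \<xi> where \<xi>: "sigma_dominated (\<Delta> m) \<xi>" "(norm \<xi>)\<^sup>2 \<le> (norm (gns (\<Delta> m)))\<^sup>2 + (1/16) ^ m"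
      using sigma_dominated_norm_control[OF \<Delta>M, of m \<xi>0 "(1/16) ^ m"] by auto
    have "(norm (gns (\<Delta> m)))\<^sup>2 \<le> (2 * (1/4) ^ m)\<^sup>2" using n\<Delta>[of m] by (intro power_mono) auto
    also have "\<dots> = 4 * (1/16) ^ m"
      by (simp add: power_mult_distrib power_square_swap power_divide)
    finally have "(norm \<xi>)\<^sup>2 \<le> 5 * (1/16) ^ m" using \<xi>(2) by linarith
    then show ?thesis using \<xi>(1) by blast
  qed
  then obtain \<xi> where \<xi>: "\<And>m. sigma_dominated (\<Delta> m) (\<xi> m)" "\<And>m. (norm (\<xi> m))\<^sup>2 \<le> 5 * (1/16) ^ m"
    by metis
  obtain \<eta> where \<eta>: "\<And>A. A \<in> \<M> \<Longrightarrow> norm (gns (A o\<^sub>L c 0)) \<le> norm (ampl A \<eta>)"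
    using cJ[of 0] unfolding sigma_ideal_def sigma_dominated_def by blast
  \<comment> \<open>The weights leave the squared norms summable with ratio 1/4, while the inverse
    weights are square-summable. Cauchy-Schwarz then bounds the sum of all
    \<open>norm (ampl A (\<xi> m))\<close> by \<open>sqrt 2\<close> times
    \<open>norm (ampl A z)\<close>.\<close>
  define x where "x m = 2 ^ m *\<^sub>R \<xi> m" for m
  have "summable (\<lambda>m. (norm (x m))\<^sup>2)"
  proof (rule summable_comparison_test')
    show "summable (\<lambda>m. 5 * (1/4 :: real) ^ m)" by (intro summable_mult summable_geometric) simp
    fix m :: nat
    have "(norm (x m))\<^sup>2 = 4 ^ m * (norm (\<xi> m))\<^sup>2"
      by (simp add: x_def power_mult_distrib power_square_swap)
    also have "\<dots> \<le> 4 ^ m * (5 * (1/16) ^ m)" by (intro mult_left_mono \<xi>) simp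
    also have "\<dots> = 5 * (4 * (1/16)) ^ m" by (subst power_mult_distrib) simp
    finally show "norm ((norm (x m))\<^sup>2) \<le> 5 * (1/4) ^ m" by simp
  qed
  then obtain z :: "'h l2seq" where z: "\<And>(A :: 'h \<Rightarrow>\<^sub>L 'h) N. (\<Sum>m<N. (norm (ampl A (x m)))\<^sup>2) \<le> (norm (ampl A z))\<^sup>2"
    using l2_combine by blast
  have dom: "norm (gns (A o\<^sub>L T)) \<le> norm (ampl A \<eta>) + sqrt 2 * norm (ampl A z)" if A: "A \<in> \<M>" for A
  proof -
    have geo: "(\<Sum>m<N. ((1/2 :: real) ^ m)\<^sup>2) \<le> 2" for N
    proof -
      have "(\<Sum>m<N. ((1/2 :: real) ^ m)\<^sup>2) = (\<Sum>m<N. (1/4) ^ m)"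
        by (simp add: power_square_swap power_divide)
      also have "\<dots> \<le> (\<Sum>m. (1/4) ^ m)" by (intro sum_le_suminf summable_geometric) auto
      also have "\<dots> \<le> 2" by (subst suminf_geometric) auto
      finally show ?thesis .
    qed
    have tail: "(\<Sum>m<N. norm (ampl A (\<xi> m))) \<le> sqrt 2 * norm (ampl A z)" for N
    proof (rule power2_le_imp_le)
      have "(\<Sum>m<N. norm (ampl A (\<xi> m))) = (\<Sum>m<N. (1/2) ^ m * norm (ampl A (x m)))"
        by (simp add: x_def ampl_scaleR_right power_divide)
      then have "(\<Sum>m<N. norm (ampl A (\<xi> m)))\<^sup>2 \<le> (\<Sum>m<N. ((1/2) ^ m)\<^sup>2) * (\<Sum>m<N. (norm (ampl A (x m)))\<^sup>2)"
        using Cauchy_Schwarz_ineq_sum[of "\<lambda>m. (1/2) ^ m" "\<lambda>m. norm (ampl A (x m))" "{..<N}"] by simp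
      also have "\<dots> \<le> 2 * (norm (ampl A z))\<^sup>2" by (intro mult_mono geo z sum_nonneg) auto
      finally show "(\<Sum>m<N. norm (ampl A (\<xi> m)))\<^sup>2 \<le> (sqrt 2 * norm (ampl A z))\<^sup>2"
        by (simp add: power_mult_distrib)
    qed simp
    have step: "norm (gns (A o\<^sub>L c N)) \<le> norm (ampl A \<eta>) + (\<Sum>m<N. norm (ampl A (\<xi> m)))" for N
    proof (induction N)
      case 0
      then show ?case using \<eta>[OF A] by simp
    next
      case (Suc N)
      have "A o\<^sub>L c (Suc N) = (A o\<^sub>L c N) + (A o\<^sub>L \<Delta> N)"
        by (rule blinfun_eqI) (simp add: \<Delta>_def blinfun.add_left blinfun.diff_left blinfun.diff_right)
      then have "gns (A o\<^sub>L c (Suc N)) = gns (A o\<^sub>L c N) + gns (A o\<^sub>L \<Delta> N)"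
        using A cM \<Delta>M by (simp add: gns_add M(6))
      moreover have "norm (gns (A o\<^sub>L \<Delta> N)) \<le> norm (ampl A (\<xi> N))"
        using \<xi>(1)[of N] A unfolding sigma_dominated_def by blast
      ultimately show ?case
        using Suc norm_triangle_ineq[of "gns (A o\<^sub>L c N)" "gns (A o\<^sub>L \<Delta> N)"] by simp
    qed
    have "(\<lambda>N. gns (A o\<^sub>L c N)) \<longlonglongrightarrow> gns (A o\<^sub>L T)"
    proof -
      have "(\<lambda>N. gns (T - c N)) \<longlonglongrightarrow> 0"
      proof (rule Lim_null_comparison)
        show "(\<lambda>N. (1/4 :: real) ^ N) \<longlonglongrightarrow> 0" by (rule LIMSEQ_power_zero) simp
      qed (use c(2) in auto)
      then have "(\<lambda>N. gns T - gns (T - c N)) \<longlonglongrightarrow> gns T - 0" by (intro tendsto_intros)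
      then have "(\<lambda>N. gns (c N)) \<longlonglongrightarrow> gns T" using T(1) cM by (simp add: gns_diff)
      then have "(\<lambda>N. ampl (\<pi> A) (gns (c N))) \<longlonglongrightarrow> ampl (\<pi> A) (gns T)" by (rule tendsto_ampl)
      then show ?thesis using A cM T(1) by (simp add: gns_comp)
    qed
    then have "(\<lambda>N. norm (gns (A o\<^sub>L c N))) \<longlonglongrightarrow> norm (gns (A o\<^sub>L T))" by (rule tendsto_norm)
    then show ?thesis
      by (rule LIMSEQ_le_const2) (use add_left_mono[OF tail] step order_trans in blast)
  qed
  \<comment> \<open>\<open>\<eta>\<close> accounts for the starting element \<open>c 0\<close> and
    \<open>z\<close> for all the differences.\<close>
  have "sigma_dominated T (sqrt 2 *\<^sub>R interleave \<eta> (sqrt 2 *\<^sub>R z))"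
    unfolding sigma_dominated_def
  proof
    fix A assume A: "A \<in> \<M>"
    have "norm (ampl A \<eta>) + sqrt 2 * norm (ampl A z) \<le> norm (sqrt 2 *\<^sub>R interleave (ampl A \<eta>) (ampl A (sqrt 2 *\<^sub>R z)))"
      by (rule add_le_interleave) (auto simp: ampl_scaleR_right)
    then show "norm (gns (A o\<^sub>L T)) \<le> norm (ampl A (sqrt 2 *\<^sub>R interleave \<eta> (sqrt 2 *\<^sub>R z)))"
      using dom[OF A] by (simp add: ampl_scaleR_right ampl_interleave)
  qed
  then show ?thesis using that T unfolding sigma_ideal_def by blast
qed

text \<open>A maximal contraction \<open>E\<close> in \<open>\<J>\<close> is the identity. Otherwise pick \<open>\<xi>\<close> whose vector state exceeds
  \<open>\<phi> = \<langle>\<pi>(\<cdot>) \<zeta>, \<zeta>\<rangle>\<close> at \<open>P = 1 - E\<close>, and a maximal \<open>T \<le> P\<close> on which it does not exceed \<open>\<phi>\<close>. Then \<open>\<phi>\<close> is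
  dominated by the vector state on everything below \<open>D = P - T\<close>, so that \<open>D \<in> \<J>\<close>.\<close>

lemma id_in_sigma_ideal: "id_blinfun \<in> sigma_ideal"
proof -
  define S where "S = {B \<in> sigma_ideal. positive_op B \<and> op_le B id_blinfun}"
  define \<phi> where "\<phi> A = Re (cinner (ampl (\<pi> A) \<zeta>) \<zeta>)" for A
  have \<phi>_add: "\<phi> (A + B) = \<phi> A + \<phi> B" if "A \<in> \<M>" "B \<in> \<M>" for A B
    using that by (simp add: \<phi>_def p_add ampl_add_left cinner_add_left)
  have \<phi>_scale: "\<phi> (r *\<^sub>R A) = r * \<phi> A" if "A \<in> \<M>" for r A
    using that by (simp add: \<phi>_def iso_scaleR[OF vM vN iso] ampl_scaleR_left cinner_scaleR_left)
  have \<phi>_mono: "\<phi> A \<le> \<phi> B" if "A \<in> \<M>" "B \<in> \<M>" "op_le A B" for A B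
    unfolding \<phi>_def by (rule ampl_le[OF p_le[OF that]])
  have \<phi>_0: "\<phi> 0 = 0" using \<phi>_scale[OF M(12), of 0] by simp
  have zero: "0 \<in> sigma_ideal"
  proof -
    have "gns (A o\<^sub>L 0) = 0" for A
    proof -
      have "A o\<^sub>L 0 = 0" by (rule blinfun_eqI) simp
      moreover have "gns 0 = 0" using gns_diff[OF M(12) M(12)] by simp
      ultimately show ?thesis by simp
    qed
    then show ?thesis using M(12) unfolding sigma_ideal_def sigma_dominated_def by auto
  qed
  have le0: "op_le 0 A" if "positive_op A" for A using that by (simp add: op_le_def)
  obtain E where E: "E \<in> S" and Emax: "\<And>A. \<lbrakk>A \<in> S; op_le E A\<rbrakk> \<Longrightarrow> A = E"
  proof (rule op_Zorn[of S])
    have "0 \<in> S" using zero le0[OF positive_op_id] by (simp add: S_def)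
    then show "S \<noteq> {}" by blast
    fix \<C> assume C: "contraction_chain \<C>" "\<C> \<subseteq> S"
    then have "\<C> \<subseteq> sigma_ideal" by (auto simp: S_def)
    then obtain T where "T \<in> sigma_ideal" "positive_op T" "op_le T id_blinfun" "\<And>A. A \<in> \<C> \<Longrightarrow> op_le A T"
      using sigma_ideal_chain_sup[OF C(1)] by blast
    then show "\<exists>u\<in>S. \<forall>a\<in>\<C>. op_le a u" by (auto simp: S_def)
  qed (auto simp: S_def)
  have EJ: "E \<in> sigma_ideal" and Ep: "positive_op E" and E1: "op_le E id_blinfun"
    using E by (auto simp: S_def)
  have EM: "E \<in> \<M>" using EJ by (simp add: sigma_ideal_def)
  define P where "P = id_blinfun - E"
  have PM: "P \<in> \<M>" unfolding P_def by (rule M(9)[OF M(3) EM])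
  have Pp: "positive_op P" using E1 by (simp add: P_def op_le_def)
  have P1: "op_le P id_blinfun" using Ep by (simp add: P_def op_le_def)
  have "P = 0"
  proof (rule ccontr)
    assume "P \<noteq> 0"
    then obtain h where h: "blinfun_apply P h \<noteq> 0" by (metis blinfun_eqI zero_blinfun.rep_eq)
    define d where "d = Re (cinner (blinfun_apply P h) h)"
    have d: "d > 0"
      using positive_op_zero[OF Pp, of h] h Pp unfolding d_def positive_op_iff by (metis order_le_less)
    have f0: "0 \<le> \<phi> P" using \<phi>_mono[OF M(12) PM le0[OF Pp]] by (simp add: \<phi>_0)
    \<comment> \<open>The scaling makes
      \<open>\<langle>P \<xi>, \<xi>\<rangle> = \<phi> P + 1\<close>, strictly above
      \<open>\<phi> P\<close>; this excludes \<open>T = P\<close> at the end.\<close>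
    define \<xi> where "\<xi> = sqrt ((\<phi> P + 1) / d) *\<^sub>R h"
    have "Re (cinner (blinfun_apply P \<xi>) \<xi>) = (sqrt ((\<phi> P + 1) / d) * sqrt ((\<phi> P + 1) / d)) * d"
      by (simp only: \<xi>_def d_def blinfun.scaleR_right cinner_scaleR_left cinner_scaleR_right
          mult.assoc of_real_mult[symmetric] Re_complex_of_real) simp
    also have "\<dots> = \<phi> P + 1" using d f0 by simp
    finally have P\<xi>: "Re (cinner (blinfun_apply P \<xi>) \<xi>) > \<phi> P" by simp
    define U where "U = {T \<in> \<M>. positive_op T \<and> op_le T P \<and> Re (cinner (blinfun_apply T \<xi>) \<xi>) \<le> \<phi> T}"
    obtain T where T: "T \<in> U" and Tmax: "\<And>A. \<lbrakk>A \<in> U; op_le T A\<rbrakk> \<Longrightarrow> A = T"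
    proof (rule op_Zorn[of U])
      show "U \<noteq> {}" using M(12) le0[OF Pp] by (auto simp: U_def \<phi>_0)
      show "positive_op A \<and> op_le A id_blinfun" if "A \<in> U" for A
        using that op_le_trans[OF _ P1] by (auto simp: U_def)
      fix \<C> assume C: "contraction_chain \<C>" "\<C> \<subseteq> U"
      then have CM: "\<C> \<subseteq> \<M>" by (auto simp: U_def)
      obtain T where T: "T \<in> \<M>" "positive_op T" "\<And>A. A \<in> \<C> \<Longrightarrow> op_le A T"
        and lim: "\<And>h k. ((\<lambda>B. cinner (blinfun_apply B h) k) \<longlongrightarrow> cinner (blinfun_apply T h) k) (chain_filter \<C>)"
        and least: "\<And>S. \<lbrakk>positive_op S; \<And>A. A \<in> \<C> \<Longrightarrow> op_le A S\<rbrakk> \<Longrightarrow> op_le T S"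
        using chain_sup_von_neumann[OF vM C(1) CM] by metis
      have "op_le T P" by (rule least[OF Pp]) (use C(2) in \<open>auto simp: U_def\<close>)
      moreover have "Re (cinner (blinfun_apply T \<xi>) \<xi>) \<le> \<phi> T"
      proof (rule tendsto_upperbound[OF tendsto_Re[OF lim]])
        show "\<forall>\<^sub>F B in chain_filter \<C>. Re (cinner (blinfun_apply B \<xi>) \<xi>) \<le> \<phi> T"
          using chain_filter_facts(2)[OF C(1)]
        proof (rule eventually_mono)
          fix B assume B: "B \<in> \<C>"
          then have "Re (cinner (blinfun_apply B \<xi>) \<xi>) \<le> \<phi> B" "B \<in> \<M>" using C(2) by (auto simp: U_def)
          then show "Re (cinner (blinfun_apply B \<xi>) \<xi>) \<le> \<phi> T" using \<phi>_mono[OF _ T(1) T(3)[OF B]] by linarith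
        qed
      qed (rule chain_filter_facts(1)[OF C(1)])
      ultimately show "\<exists>u\<in>U. \<forall>a\<in>\<C>. op_le a u" using T by (auto simp: U_def)
    qed (rule that)
    have TM: "T \<in> \<M>" and Tp: "positive_op T" and TP: "op_le T P"
      and T\<xi>: "Re (cinner (blinfun_apply T \<xi>) \<xi>) \<le> \<phi> T"
      using T by (auto simp: U_def)
    define D where "D = P - T"
    have DM: "D \<in> \<M>" unfolding D_def by (rule M(9)[OF PM TM])
    have Dp: "positive_op D" using TP by (simp add: D_def op_le_def)
    \<comment> \<open>If \<open>\<phi>\<close> exceeded the vector state at \<open>X\<close>, then
      \<open>T + X\<close> would lie in \<open>U\<close>, since the defining inequality is additive
      and \<open>X \<le> P - T\<close>. Maximality forces \<open>X = 0\<close>, where both sides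
      vanish.\<close>
    have below: "\<phi> X \<le> Re (cinner (blinfun_apply X \<xi>) \<xi>)" if X: "X \<in> \<M>" "positive_op X" "op_le X D" for X
    proof (rule ccontr)
      assume n: "\<not> ?thesis"
      have "T + X \<in> U"
        using n T\<xi> X M(8)[OF TM X(1)] positive_op_add[OF Tp X(2)]
        by (simp add: U_def op_le_def D_def \<phi>_add TM blinfun.add_left cinner_add_left diff_diff_eq)
      moreover have "op_le T (T + X)" using X(2) by (simp add: op_le_def)
      ultimately have "T + X = T" by (rule Tmax)
      then have "X = 0" by simp
      then show False using n \<phi>_0 by simp
    qed
    \<comment> \<open>The square of \<open>norm (gns (A B))\<close> is \<open>\<phi>\<close> at
      \<open>B (adj A) A B\<close>, an element below a multiple of \<open>B B = D\<close>, hence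
      within reach of \<open>below\<close>.\<close>
    define B where "B = sqrt_op D"
    have BM: "B \<in> \<M>" unfolding B_def by (rule von_neumann_sqrt[OF vM DM Dp])
    have Bp: "positive_op B" and BB: "B o\<^sub>L B = D"
      unfolding B_def using sqrt_op_positive[OF Dp] sqrt_op_square[OF Dp] by auto
    have Bsa: "adj B = B" and Bb: "B \<in> bops" using Bp positive_op_adj positive_op_bops by auto
    have "norm (gns (A o\<^sub>L B)) \<le> norm (ampl A (single_l2 (blinfun_apply B \<xi>)))" if A: "A \<in> \<M>" for A
    proof -
      have Ab: "A \<in> bops" by (rule M(5)[OF A])
      define X where "X = adj (A o\<^sub>L B) o\<^sub>L (A o\<^sub>L B)"
      have XM: "X \<in> \<M>" unfolding X_def using A BM by (intro M)
      have Xh: "Re (cinner (blinfun_apply X h) h) = (norm (blinfun_apply A (blinfun_apply B h)))\<^sup>2" for h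
        using Ab Bb by (simp add: X_def cinner_adj_left Re_cinner_self)
      have Dh: "Re (cinner (blinfun_apply D h) h) = (norm (blinfun_apply B h))\<^sup>2" for h
        using cinner_adj_left[OF Bb, of "blinfun_apply B h" h] Bsa by (simp add: BB[symmetric] Re_cinner_self)
      \<comment> \<open>\<open>X\<close> is at most \<open>(norm A)^2\<close> times
        \<open>D\<close>; adding 1 makes \<open>c\<close> positive, so that division by it is
        possible and brings \<open>X\<close> below \<open>D\<close>.\<close>
      define c where "c = (norm A)\<^sup>2 + 1"
      have c: "c > 0" unfolding c_def by (simp add: add_nonneg_pos)
      have Xp: "positive_op ((1/c) *\<^sub>R X)"
        unfolding X_def using c Ab Bb by (intro positive_op_scaleR positive_op_adj_self) auto
      have "op_le ((1/c) *\<^sub>R X) D"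
      proof (rule op_leI[OF Xp Dp])
        fix h
        have "(norm (blinfun_apply A (blinfun_apply B h)))\<^sup>2 \<le> (norm A * norm (blinfun_apply B h))\<^sup>2"
          by (intro power_mono norm_blinfun) auto
        also have "\<dots> \<le> c * (norm (blinfun_apply B h))\<^sup>2"
          unfolding power_mult_distrib by (intro mult_right_mono) (auto simp: c_def)
        finally show "Re (cinner (blinfun_apply ((1/c) *\<^sub>R X) h) h) \<le> Re (cinner (blinfun_apply D h) h)"
          using c by (simp add: blinfun.scaleR_left cinner_scaleR_left Xh Dh field_simps)
      qed
      from below[OF M(10)[OF XM] Xp this]
      have "\<phi> X \<le> (norm (blinfun_apply A (blinfun_apply B \<xi>)))\<^sup>2"
        using c by (simp add: \<phi>_scale XM blinfun.scaleR_left cinner_scaleR_left Xh divide_le_cancel)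
      then have "(norm (gns (A o\<^sub>L B)))\<^sup>2 \<le> (norm (blinfun_apply A (blinfun_apply B \<xi>)))\<^sup>2"
        using norm_gns_sq[OF M(6)[OF A BM]] by (simp add: \<phi>_def X_def)
      then show ?thesis unfolding ampl_single norm_single by (rule power2_le_imp_le) simp
    qed
    then have "B \<in> sigma_ideal" using BM unfolding sigma_ideal_def sigma_dominated_def by blast
    then have DJ: "D \<in> sigma_ideal" using sigma_ideal_left[OF _ BM] BB by metis
    \<comment> \<open>The complement of \<open>E + D\<close> in the identity is \<open>T\<close>,
      hence positive.\<close>
    have "E + D \<in> S"
      using sigma_ideal_add[OF EJ DJ] positive_op_add[OF Ep Dp] Tp
      by (simp add: S_def op_le_def D_def P_def)
    moreover have "op_le E (E + D)" using Dp by (simp add: op_le_def)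
    ultimately have "E + D = E" by (rule Emax)
    then have "T = P" by (simp add: D_def)
    then show False using T\<xi> P\<xi> by simp
  qed
  then have "E = id_blinfun" by (simp add: P_def)
  then show ?thesis using EJ by simp
qed

end

text \<open>Domination by a single \<open>\<xi>\<close> makes the coefficient of
  \<open>\<pi> A\<close> a functional bounded by \<open>norm (ampl A \<xi>)\<close>, and Riesz turns
  it into a coefficient of \<open>A\<close>. In this form normality pulls measurability and
  integrals back along \<open>\<pi>\<close>.\<close>

theorem iso_normal:
  obtains \<xi> g where "\<And>A. A \<in> \<M> \<Longrightarrow> cinner (ampl (\<pi> A) \<zeta>) \<zeta>' = cinner (ampl A \<xi>) g"
proof -
  obtain \<xi> where \<xi>: "\<And>A. A \<in> \<M> \<Longrightarrow> norm (gns \<zeta> (A o\<^sub>L id_blinfun)) \<le> norm (ampl A \<xi>)"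
    using id_in_sigma_ideal[of \<zeta>] unfolding sigma_ideal_def sigma_dominated_def by blast
  obtain g where "\<And>A. A \<in> \<M> \<Longrightarrow> cinner (ampl (\<pi> A) \<zeta>) \<zeta>' = cinner (ampl A \<xi>) g"
  proof (rule Riesz_complex[OF M(2), of "\<lambda>A. ampl A \<xi>" "\<lambda>A. cinner (ampl (\<pi> A) \<zeta>) \<zeta>'" "norm \<zeta>'"])
    show "clinear_on \<M> (\<lambda>A. cinner (ampl (\<pi> A) \<zeta>) \<zeta>')"
      by (simp add: clinear_on_def p_add p_scaleC ampl_add_left ampl_scaleC_left cinner_linear)
    fix A assume A: "A \<in> \<M>"
    have "cmod (cinner (ampl (\<pi> A) \<zeta>) \<zeta>') \<le> norm (ampl (\<pi> A) \<zeta>) * norm \<zeta>'" by (rule norm_cinner_le)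
    also have "\<dots> \<le> norm (ampl A \<xi>) * norm \<zeta>'"
      using \<xi>[OF A] by (intro mult_right_mono) (auto simp: gns_def)
    finally show "cmod (cinner (ampl (\<pi> A) \<zeta>) \<zeta>') \<le> norm \<zeta>' * norm (ampl A \<xi>)" by (simp add: mult.commute)
  qed (auto simp: ampl_add_left ampl_scaleC_left)
  then show ?thesis using that by blast
qed

end

text \<open>\<open>\<Psi>\<close> is a function of its own that agrees with
  \<open>\<pi> \<circ> \<Phi>\<close> on the space only. So the lemma also covers the way back,
  where the inverse isomorphism recovers the original function on the space only.\<close>

lemma star_isomorphism_transfer:
  assumes vM: "von_neumann_algebra \<M>" and vN: "von_neumann_algebra \<N>"
    and iso: "star_isomorphism \<M> \<N> \<pi>" and \<Phi>: "\<Phi> \<in> space M \<rightarrow> \<M>"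
    and \<Psi>: "\<And>\<sigma>. \<sigma> \<in> space M \<Longrightarrow> \<Psi> \<sigma> = \<pi> (\<Phi> \<sigma>)"
  shows "pw_weakly_measurable M \<Phi> \<Longrightarrow> pw_weakly_measurable M \<Psi>"
    "GP_integrable M (sigma_op_topology \<T> \<M>) \<Phi> \<Longrightarrow> GP_integrable M (sigma_op_topology \<T> \<N>) \<Psi>"
    "\<lbrakk>GP_integrable M (sigma_op_topology \<T> \<M>) \<Phi>; S \<in> sets M\<rbrakk> \<Longrightarrow>
      GP_integral M (sigma_op_topology \<T> \<N>) \<Psi> S = \<pi> (GP_integral M (sigma_op_topology \<T> \<M>) \<Phi> S)"
proof -
  note VM = von_neumann_algebraD(1,2)[OF vM] and VN = von_neumann_algebraD(1,2)[OF vN]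
  have \<Phi>M: "\<Phi> \<sigma> \<in> \<M>" if "\<sigma> \<in> space M" for \<sigma> using \<Phi> that by auto
  have \<Psi>N: "\<Psi> \<in> space M \<rightarrow> \<N>" using iso_in[OF vM vN iso \<Phi>M] \<Psi> by simp
  have pull: "\<exists>\<xi> g. (\<forall>A\<in>\<M>. cinner (ampl (\<pi> A) h) k = cinner (ampl A \<xi>) g) \<and>
      (\<forall>\<sigma>\<in>space M. cinner (ampl (\<Psi> \<sigma>) h) k = cinner (ampl (\<Phi> \<sigma>) \<xi>) g)" for h k
  proof -
    obtain \<xi> g where "\<And>A. A \<in> \<M> \<Longrightarrow> cinner (ampl (\<pi> A) h) k = cinner (ampl A \<xi>) g"
      using iso_normal[OF vM vN iso, of h k] by metis
    then show ?thesis using \<Phi>M \<Psi> by (intro exI[of _ \<xi>] exI[of _ g]) simp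
  qed
  show "pw_weakly_measurable M \<Psi>" if pw: "pw_weakly_measurable M \<Phi>"
    unfolding pw_weakly_measurable_def
  proof (intro allI)
    fix h k
    obtain \<xi> g where eq: "\<forall>\<sigma>\<in>space M. cinner (ampl (\<Psi> \<sigma>) (single_l2 h)) (single_l2 k) = cinner (ampl (\<Phi> \<sigma>) \<xi>) g"
      using pull by blast
    have "(\<lambda>\<sigma>. cinner (ampl (\<Phi> \<sigma>) \<xi>) g) \<in> borel_measurable M"
      using pw unfolding pw_weakly_measurable_def by (intro measurable_ampl) auto
    then show "(\<lambda>\<sigma>. cinner (blinfun_apply (\<Psi> \<sigma>) h) k) \<in> borel_measurable M"
      using eq unfolding ampl_single cinner_single by (subst measurable_cong) auto
  qed
  have main: "GP_integrable M (sigma_op_topology \<T> \<N>) \<Psi>"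
    "S \<in> sets M \<Longrightarrow> is_GP_integral M (sigma_op_topology \<T> \<N>) \<Psi> S (\<pi> (GP_integral M (sigma_op_topology \<T> \<M>) \<Phi> S))"
    if G: "GP_integrable M (sigma_op_topology \<T> \<M>) \<Phi>" for S
  proof -
    note int = GP_integrable_sigma_imp[OF VM \<Phi> G]
    have I: "is_GP_integral M (sigma_op_topology \<T> \<N>) \<Psi> S (\<pi> I)"
      if S: "S \<in> sets M" and I: "is_GP_integral M (sigma_op_topology \<T> \<M>) \<Phi> S I" for S I
      unfolding is_GP_integral_sigma_iff[OF VN \<Psi>N S]
    proof (intro conjI allI)
      have IM: "I \<in> \<M>" and Iint: "\<And>h k. cinner (ampl I h) k = (LINT \<sigma>:S|M. cinner (ampl (\<Phi> \<sigma>) h) k)"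
        using I unfolding is_GP_integral_sigma_iff[OF VM \<Phi> S] by auto
      show "\<pi> I \<in> \<N>" by (rule iso_in[OF vM vN iso IM])
      fix h k
      obtain \<xi> g where A: "\<forall>A\<in>\<M>. cinner (ampl (\<pi> A) h) k = cinner (ampl A \<xi>) g"
        and B: "\<forall>\<sigma>\<in>space M. cinner (ampl (\<Psi> \<sigma>) h) k = cinner (ampl (\<Phi> \<sigma>) \<xi>) g"
        using pull by blast
      have "cinner (ampl (\<pi> I) h) k = (LINT \<sigma>:S|M. cinner (ampl (\<Phi> \<sigma>) \<xi>) g)" using A IM Iint by simp
      also have "\<dots> = (LINT \<sigma>:S|M. cinner (ampl (\<Psi> \<sigma>) h) k)"
        by (rule LINT_cong_space[OF S]) (simp add: B)
      finally show "cinner (ampl (\<pi> I) h) k = (LINT \<sigma>:S|M. cinner (ampl (\<Psi> \<sigma>) h) k)" .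
    qed
    have ex: "\<exists>I. is_GP_integral M (sigma_op_topology \<T> \<M>) \<Phi> S I" if "S \<in> sets M" for S
      using G that unfolding GP_integrable_def by blast
    show "GP_integrable M (sigma_op_topology \<T> \<N>) \<Psi>"
    proof (rule GP_integrable_sigmaI[OF VN \<Psi>N])
      fix h k
      obtain \<xi> g where B: "\<forall>\<sigma>\<in>space M. cinner (ampl (\<Psi> \<sigma>) h) k = cinner (ampl (\<Phi> \<sigma>) \<xi>) g"
        using pull by blast
      show "integrable M (\<lambda>\<sigma>. cinner (ampl (\<Psi> \<sigma>) h) k)"
        using int[of \<xi> g] B by (subst Bochner_Integration.integrable_cong) auto
    next
      fix S assume S: "S \<in> sets M"
      then obtain I where "is_GP_integral M (sigma_op_topology \<T> \<M>) \<Phi> S I" using ex by blast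
      from I[OF S this] show "\<exists>I\<in>\<N>. \<forall>h k. cinner (ampl I h) k = (LINT \<sigma>:S|M. cinner (ampl (\<Psi> \<sigma>) h) k)"
        unfolding is_GP_integral_sigma_iff[OF VN \<Psi>N S] by blast
    qed
    assume S: "S \<in> sets M"
    then obtain J where J: "is_GP_integral M (sigma_op_topology \<T> \<M>) \<Phi> S J" using ex by blast
    have "GP_integral M (sigma_op_topology \<T> \<M>) \<Phi> S = J"
      by (rule GP_integral_sigma_eqI[OF VM \<Phi> S J])
    then show "is_GP_integral M (sigma_op_topology \<T> \<N>) \<Psi> S (\<pi> (GP_integral M (sigma_op_topology \<T> \<M>) \<Phi> S))"
      using I[OF S J] by simp
  qed
  show "GP_integrable M (sigma_op_topology \<T> \<M>) \<Phi> \<Longrightarrow> GP_integrable M (sigma_op_topology \<T> \<N>) \<Psi>"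
    by (rule main(1))
  show "GP_integral M (sigma_op_topology \<T> \<N>) \<Psi> S = \<pi> (GP_integral M (sigma_op_topology \<T> \<M>) \<Phi> S)"
    if "GP_integrable M (sigma_op_topology \<T> \<M>) \<Phi>" "S \<in> sets M"
    by (rule GP_integral_sigma_eqI[OF VN \<Psi>N that(2) main(2)[OF that]])
qed

lemma star_isomorphism_invariance:
  assumes vM: "von_neumann_algebra \<M>" and vN: "von_neumann_algebra \<N>"
    and iso: "star_isomorphism \<M> \<N> \<pi>" and \<Phi>: "\<Phi> \<in> space M \<rightarrow> \<M>"
  shows "pw_weakly_measurable M \<Phi> \<longleftrightarrow> pw_weakly_measurable M (\<pi> \<circ> \<Phi>)"
    "GP_integrable M (sigma_op_topology \<T> \<M>) \<Phi> \<longleftrightarrow> GP_integrable M (sigma_op_topology \<T> \<N>) (\<pi> \<circ> \<Phi>)"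
    "\<lbrakk>GP_integrable M (sigma_op_topology \<T> \<M>) \<Phi>; S \<in> sets M\<rbrakk> \<Longrightarrow>
      GP_integral M (sigma_op_topology \<T> \<N>) (\<pi> \<circ> \<Phi>) S = \<pi> (GP_integral M (sigma_op_topology \<T> \<M>) \<Phi> S)"
proof -
  have \<Phi>M: "\<Phi> \<sigma> \<in> \<M>" if "\<sigma> \<in> space M" for \<sigma> using \<Phi> that by auto
  have \<Psi>N: "\<pi> \<circ> \<Phi> \<in> space M \<rightarrow> \<N>" using iso_in[OF vM vN iso \<Phi>M] by simp
  have inv: "\<Phi> \<sigma> = inv_into \<M> \<pi> ((\<pi> \<circ> \<Phi>) \<sigma>)" if "\<sigma> \<in> space M" for \<sigma>
    using iso_bij[OF vM vN iso] \<Phi>M[OF that] by (simp add: bij_betw_def)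
  have fwd: "(\<pi> \<circ> \<Phi>) \<sigma> = \<pi> (\<Phi> \<sigma>)" for \<sigma> by simp
  note F = star_isomorphism_transfer[OF vM vN iso \<Phi> fwd]
    and B = star_isomorphism_transfer[OF vN vM star_isomorphism_inv[OF iso vM] \<Psi>N inv]
  show "pw_weakly_measurable M \<Phi> \<longleftrightarrow> pw_weakly_measurable M (\<pi> \<circ> \<Phi>)"
    using F(1) B(1) by blast
  show "GP_integrable M (sigma_op_topology \<T> \<M>) \<Phi> \<longleftrightarrow> GP_integrable M (sigma_op_topology \<T> \<N>) (\<pi> \<circ> \<Phi>)"
    using F(2) B(2) by blast
  show "\<lbrakk>GP_integrable M (sigma_op_topology \<T> \<M>) \<Phi>; S \<in> sets M\<rbrakk> \<Longrightarrow>
      GP_integral M (sigma_op_topology \<T> \<N>) (\<pi> \<circ> \<Phi>) S = \<pi> (GP_integral M (sigma_op_topology \<T> \<M>) \<Phi> S)"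
    by (rule F(3))
qed

section \<open>The main theorem\<close>

theorem theorem3p3p6:
  fixes \<rho> :: "'s measure"
    and V :: "('h::complex_hilbert \<Rightarrow>\<^sub>L 'k::complex_hilbert) set"
    and F :: "'s \<Rightarrow> 'h \<Rightarrow>\<^sub>L 'k"
    and \<T> :: optop
  assumes "V \<subseteq> bops" and "csubspace V" and "F \<in> space \<rho> \<rightarrow> V"
  shows
    \<comment> \<open>(i)\<close>
    "(let \<F> = sigma_alg V {\<lambda>A. trace_op (A o\<^sub>L B) |B. B \<in> trace_class};
          \<G> = sigma_alg V {\<lambda>A. cinner (blinfun_apply A h) k |h k. True}
      in \<F> = \<G> \<and> \<G> = sigma_alg V (top_dual (sigma_op_topology \<T> V)) \<and>
         sigma_alg V (top_dual (sigma_op_topology \<T> V)) = sigma_alg V (top_dual (op_topology \<T> V)))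
     \<and> (pw_weakly_measurable \<rho> F \<longleftrightarrow> weakly_measurable \<rho> (op_topology \<T> V) F)
     \<and> (weakly_measurable \<rho> (op_topology \<T> V) F \<longleftrightarrow>
          weakly_measurable \<rho> (sigma_op_topology \<T> V) F)

     \<comment> \<open>(ii)\<close>
     \<and> (pw_Pettis_integrable_in \<rho> V F \<longleftrightarrow> GP_integrable \<rho> (op_topology \<T> V) F)
     \<and> (pw_Pettis_integrable_in \<rho> V F \<longrightarrow>
          (\<forall>S\<in>sets \<rho>. pw_Pettis_integral \<rho> F S = GP_integral \<rho> (op_topology \<T> V) F S) \<and>
          ennreal (norm (GP_integral \<rho> (op_topology \<T> V) F (space \<rho>)))
            \<le> lower_integral \<rho> (\<lambda>\<sigma>. ennreal (norm (F \<sigma>))))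

     \<comment> \<open>(iii)\<close>
     \<and> (closedin (sigma_op_topology WOT bops) V \<longrightarrow>
          (GP_integrable \<rho> (sigma_op_topology \<T> V) F \<longleftrightarrow>
             weakstar_integrable \<rho> (predual V) (functional_norm V) (\<lambda>\<sigma>. predual_eval V (F \<sigma>))) \<and>
          (weakstar_integrable \<rho> (predual V) (functional_norm V) (\<lambda>\<sigma>. predual_eval V (F \<sigma>)) \<longleftrightarrow>
             pw_weakly_measurable \<rho> F \<and>
             (\<forall>h\<in>ell2. \<forall>k\<in>ell2.
                (\<integral>\<^sup>+\<sigma>. ennreal (cmod (ell2_inner (\<lambda>n. blinfun_apply (F \<sigma>) (h n)) k)) \<partial>\<rho>) < \<infinity>)) \<and>
          (GP_integrable \<rho> (sigma_op_topology \<T> V) F \<longrightarrow>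
             pw_Pettis_integrable_in \<rho> V F \<and>
             (\<forall>S\<in>sets \<rho>.
                pw_Pettis_integral \<rho> F S = GP_integral \<rho> (sigma_op_topology \<T> V) F S \<and>
                weakstar_integral \<rho> (predual V) (\<lambda>\<sigma>. predual_eval V (F \<sigma>)) S =
                  predual_eval V (GP_integral \<rho> (sigma_op_topology \<T> V) F S))))

     \<comment> \<open>(iv)\<close>
     \<and> (\<forall>(\<M> :: ('h \<Rightarrow>\<^sub>L 'h) set) (\<N> :: ('l::complex_hilbert \<Rightarrow>\<^sub>L 'l) set) \<pi> (\<Phi> :: 's \<Rightarrow> 'h \<Rightarrow>\<^sub>L 'h).
          von_neumann_algebra \<M> \<and> von_neumann_algebra \<N> \<and> star_isomorphism \<M> \<N> \<pi> \<and>
          \<Phi> \<in> space \<rho> \<rightarrow> \<M> \<longrightarrow>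
            (pw_weakly_measurable \<rho> \<Phi> \<longleftrightarrow> pw_weakly_measurable \<rho> (\<pi> \<circ> \<Phi>)) \<and>
            (GP_integrable \<rho> (sigma_op_topology \<T> \<M>) \<Phi> \<longleftrightarrow>
               GP_integrable \<rho> (sigma_op_topology \<T> \<N>) (\<pi> \<circ> \<Phi>)) \<and>
            (GP_integrable \<rho> (sigma_op_topology \<T> \<M>) \<Phi> \<longrightarrow>
               (\<forall>S\<in>sets \<rho>. GP_integral \<rho> (sigma_op_topology \<T> \<N>) (\<pi> \<circ> \<Phi>) S =
                  \<pi> (GP_integral \<rho> (sigma_op_topology \<T> \<M>) \<Phi> S))))"
proof -
  note V = assms(1,2) and F = assms(3)
  note sg = sigma_algebras_eq[OF V]
  note wm = weakly_measurable_op_iff[OF V F, of \<T>] weakly_measurable_sigma_iff[OF V F, of \<T>]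
  note gp = GP_integrable_op_iff[OF V F, of \<T>]
  have ii: "pw_Pettis_integrable_in \<rho> V F \<longrightarrow> (\<forall>S\<in>sets \<rho>. pw_Pettis_integral \<rho> F S = GP_integral \<rho> (op_topology \<T> V) F S) \<and>
      ennreal (norm (GP_integral \<rho> (op_topology \<T> V) F (space \<rho>)))
        \<le> lower_integral \<rho> (\<lambda>\<sigma>. ennreal (norm (F \<sigma>)))"
  proof
    assume P: "pw_Pettis_integrable_in \<rho> V F"
    then have "pw_Pettis_integrable \<rho> F" by (simp add: pw_Pettis_integrable_in_def)
    from norm_pw_Pettis_integral_le[OF V F this]
    show "(\<forall>S\<in>sets \<rho>. pw_Pettis_integral \<rho> F S = GP_integral \<rho> (op_topology \<T> V) F S) \<and>
      ennreal (norm (GP_integral \<rho> (op_topology \<T> V) F (space \<rho>)))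
        \<le> lower_integral \<rho> (\<lambda>\<sigma>. ennreal (norm (F \<sigma>)))"
      by (simp add: GP_integral_op_eq[OF V F P])
  qed
  have iii: "closedin (sigma_op_topology WOT bops) V \<longrightarrow> (GP_integrable \<rho> (sigma_op_topology \<T> V) F \<longleftrightarrow>
             weakstar_integrable \<rho> (predual V) (functional_norm V) (\<lambda>\<sigma>. predual_eval V (F \<sigma>))) \<and>
          (weakstar_integrable \<rho> (predual V) (functional_norm V) (\<lambda>\<sigma>. predual_eval V (F \<sigma>)) \<longleftrightarrow>
             pw_weakly_measurable \<rho> F \<and>
             (\<forall>h\<in>ell2. \<forall>k\<in>ell2.
                (\<integral>\<^sup>+\<sigma>. ennreal (cmod (ell2_inner (\<lambda>n. blinfun_apply (F \<sigma>) (h n)) k)) \<partial>\<rho>) < \<infinity>)) \<and>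
          (GP_integrable \<rho> (sigma_op_topology \<T> V) F \<longrightarrow>
             pw_Pettis_integrable_in \<rho> V F \<and>
             (\<forall>S\<in>sets \<rho>.
                pw_Pettis_integral \<rho> F S = GP_integral \<rho> (sigma_op_topology \<T> V) F S \<and>
                weakstar_integral \<rho> (predual V) (\<lambda>\<sigma>. predual_eval V (F \<sigma>)) S =
                  predual_eval V (GP_integral \<rho> (sigma_op_topology \<T> V) F S)))"
  proof (intro impI conjI ballI)
    assume cl: "closedin (sigma_op_topology WOT bops) V"
    show "GP_integrable \<rho> (sigma_op_topology \<T> V) F \<longleftrightarrow>
        weakstar_integrable \<rho> (predual V) (functional_norm V) (\<lambda>\<sigma>. predual_eval V (F \<sigma>))"
      unfolding GP_integrable_sigma_iff[OF V F cl] weakstar_integrable_iff[OF V F] ..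
  qed (simp_all only: GP_integral_sigma_closed[OF V F] weakstar_integrable_iff[OF V F]
      sigma_integrable_iff[OF V F])
  \<comment> \<open>Unfolding rewrites the \<open>\<sigma>\<close>-algebras, the measurability
    notions and the integrability notions of (ii) to common terms, so that reflexivity settles (i)
    and the equivalence in (ii).\<close>
  show ?thesis
    unfolding Let_def sg wm gp
    by (intro conjI refl ii iii; intro allI impI; elim conjE; intro conjI impI ballI;
        rule star_isomorphism_invariance; assumption)
qed

end
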